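(* Squashed entanglement $E_{sq}$ is superadditive in general and additive on tensor products: (a) for every density operator $\rho^{AA'BB'}$ on $\mathcal{H}_A\otimes\mathcal{H}_{A'}\otimes\mathcal{H}_B\otimes\mathcal{H}_{B'}$ (finite-dimensional Hilbert spaces), with $\rho^{AB}=\operatorname{Tr}_{A'B'}\rho^{AA'BB'}$ and $\rho^{A'B'}=\operatorname{Tr}_{AB}\rho^{AA'BB'}$, $$E_{sq}(\rho^{AA'BB'})\ge E_{sq}(\rho^{AB})+E_{sq}(\rho^{A'B'}),$$ where $E_{sq}(\rho^{AA'BB'})$ is taken with respect to the bipartition $AA'$ versus $BB'$; (b) if $\rho^{AA'BB'}=\rho^{AB}\otimes\rho^{A'B'}$, then $$E_{sq}(\rho^{AA'BB'})=E_{sq}(\rho^{AB})+E_{sq}(\rho^{A'B'}).$$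
   Context: All Hilbert spaces are finite dimensional. For a state $\rho$ on a tensor product of systems, $\rho^X$ denotes its reduced state on the subsystem $X$, and $S(X)=S(\rho^X)=-\operatorname{Tr}\rho^X\log\rho^X$ is the von Neumann entropy ($\log$ to base 2). For a tripartite state $\rho^{ABE}$ the quantum conditional mutual information is $I(A;B|E)=S(AE)+S(BE)-S(ABE)-S(E)$. The squashed entanglement of a state $\rho^{AB}$ on $\mathcal{H}_A\otimes\mathcal{H}_B$ is $$E_{sq}(\rho^{AB})=\inf\left\{\tfrac12 I(A;B|E)\;:\;\rho^{ABE}\text{ a state on }\mathcal{H}_A\otimes\mathcal{H}_B\otimes\mathcal{H}_E\text{ with }\operatorname{Tr}_E\rho^{ABE}=\rho^{AB}\right\},$$ where the infimum is over all extensions $\rho^{ABE}$, with $\mathcal{H}_E$ of arbitrary (a priori unbounded) finite dimension. *)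

theory Defs
  imports Complex_Main "Jordan_Normal_Form.Schur_Decomposition"
begin

text \<open>
  A Hilbert space of dimension \<open>n\<close> is $\mathbb{C}^n$ and its operators are the complex
  \<open>n \<times> n\<close> matrices. A tensor product $\mathbb{C}^m \otimes \mathbb{C}^n$ is
  $\mathbb{C}^{mn}$, where the product basis vector $e_i \otimes e_j$ has index \<open>i * n + j\<close>;
  with this convention tensor products of spaces are strictly associative.
\<close>

definition mat_tr :: "complex mat \<Rightarrow> complex" where
  "mat_tr A = (\<Sum>i<dim_row A. A $$ (i, i))"

text \<open>In the order on the complex numbers, \<open>0 \<le> z\<close> says that \<open>z\<close> is real and nonnegative;
  hence the condition below also makes the matrix Hermitian.\<close>

definition psd_mat :: "nat \<Rightarrow> complex mat \<Rightarrow> bool" where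
  "psd_mat n A \<longleftrightarrow> A \<in> carrier_mat n n \<and> (\<forall>v \<in> carrier_vec n. 0 \<le> (A *\<^sub>v v) \<bullet>c v)"

definition density_operator :: "nat \<Rightarrow> complex mat \<Rightarrow> bool" where
  "density_operator n \<rho> \<longleftrightarrow> psd_mat n \<rho> \<and> mat_tr \<rho> = 1"

definition unitary_mat :: "nat \<Rightarrow> complex mat \<Rightarrow> bool" where
  "unitary_mat n U \<longleftrightarrow> U \<in> carrier_mat n n \<and> U * mat_adjoint U = 1\<^sub>m n"

text \<open>Functional calculus for Hermitian matrices: if \<open>A\<close> is $U \operatorname{diag}(d) U^*$ then
  \<open>f(A)\<close> is $U \operatorname{diag}(f \circ d) U^*$. The result does not depend on the chosen
  diagonalisation. Matrices that are not Hermitian have no such form, so that the value is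
  then unspecified.\<close>

definition mat_fun :: "(real \<Rightarrow> real) \<Rightarrow> complex mat \<Rightarrow> complex mat" where
  "mat_fun f A = (SOME B. \<exists>U d.
     unitary_mat (dim_row A) U \<and>
     A = U * mat_diag (dim_row A) (\<lambda>i. complex_of_real (d i)) * mat_adjoint U \<and>
     B = U * mat_diag (dim_row A) (\<lambda>i. complex_of_real (f (d i))) * mat_adjoint U)"

text \<open>Since \<open>log 2 0 = 0\<close>, the kernel of \<open>\<rho>\<close> contributes nothing to the trace: this is the
  usual convention \<open>0 log 0 = 0\<close>.\<close>

definition vn_entropy :: "complex mat \<Rightarrow> real" where
  "vn_entropy \<rho> = - Re (mat_tr (\<rho> * mat_fun (log 2) \<rho>))"

text \<open>\<open>partial_trace l m r M\<close> traces out the middle factor of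
  $\mathbb{C}^l \otimes \mathbb{C}^m \otimes \mathbb{C}^r$. The first or last factor of a bipartite
  space is traced out by taking \<open>l = 1\<close> or \<open>r = 1\<close>.\<close>

definition partial_trace :: "nat \<Rightarrow> nat \<Rightarrow> nat \<Rightarrow> complex mat \<Rightarrow> complex mat" where
  "partial_trace l m r M = mat (l * r) (l * r) (\<lambda>(i, j).
     \<Sum>k<m. M $$ ((i div r * m + k) * r + i mod r, (j div r * m + k) * r + j mod r))"

definition tensor_mat :: "complex mat \<Rightarrow> complex mat \<Rightarrow> complex mat" where
  "tensor_mat A B = mat (dim_row A * dim_row B) (dim_col A * dim_col B) (\<lambda>(i, j).
     A $$ (i div dim_row B, j div dim_col B) * B $$ (i mod dim_row B, j mod dim_col B))"

text \<open>The identification of operators on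
  $\mathbb{C}^l \otimes \mathbb{C}^m \otimes \mathbb{C}^n \otimes \mathbb{C}^r$ with operators on
  $\mathbb{C}^l \otimes \mathbb{C}^n \otimes \mathbb{C}^m \otimes \mathbb{C}^r$.
  \<open>swap_middle_index\<close> maps the index of $e_x \otimes e_z \otimes e_y \otimes e_w$ in the second
  space to the index of $e_x \otimes e_y \otimes e_z \otimes e_w$ in the first one.\<close>

definition swap_middle_index :: "nat \<Rightarrow> nat \<Rightarrow> nat \<Rightarrow> nat \<Rightarrow> nat" where
  "swap_middle_index m n r i =
     (let w = i mod r; y = i div r mod m; z = i div r div m mod n; x = i div r div m div n
      in ((x * m + y) * n + z) * r + w)"

definition swap_middle :: "nat \<Rightarrow> nat \<Rightarrow> nat \<Rightarrow> nat \<Rightarrow> complex mat \<Rightarrow> complex mat" where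
  "swap_middle l m n r M = mat (l * n * m * r) (l * n * m * r) (\<lambda>(i, j).
     M $$ (swap_middle_index m n r i, swap_middle_index m n r j))"

text \<open>\<open>I(A;B|E)\<close> for an operator on $A \otimes B \otimes E$, the factors having
  dimensions \<open>a\<close>, \<open>b\<close> and \<open>e\<close>.\<close>

definition cond_mutual_info :: "nat \<Rightarrow> nat \<Rightarrow> nat \<Rightarrow> complex mat \<Rightarrow> real" where
  "cond_mutual_info a b e \<rho> =
     vn_entropy (partial_trace a b e \<rho>) + vn_entropy (partial_trace 1 a (b * e) \<rho>)
     - vn_entropy \<rho> - vn_entropy (partial_trace 1 (a * b) e \<rho>)"

text \<open>For a density operator \<open>\<rho>\<close> the set below contains the value of the trivial extension
  (\<open>e = 1\<close>) and, by strong subadditivity, is bounded below by 0, so that the real infimum is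
  meaningful. An extension with \<open>e = 0\<close> does not exist, as its trace would be 0.\<close>

definition squashed_entanglement :: "nat \<Rightarrow> nat \<Rightarrow> complex mat \<Rightarrow> real" where
  "squashed_entanglement a b \<rho> = Inf {1 / 2 * cond_mutual_info a b e \<sigma> | e \<sigma>.
     density_operator (a * b * e) \<sigma> \<and> partial_trace (a * b) e 1 \<sigma> = \<rho>}"

end

theory Submission
  imports Defs
begin

text \<open>
  By the chain rule, \<open>I(AA';BB'|E) = I(A;B|E) + I(A';B'|AE) + I(A;B'|BE) + I(A';B|AB'E)\<close>. The last
  two terms are nonnegative by strong subadditivity, and \<open>E\<close>, \<open>AE\<close> are extension systems for
  \<open>\<rho>\<^sup>A\<^sup>B\<close> and \<open>\<rho>\<^sup>A\<^sup>'\<^sup>B\<^sup>'\<close>; this gives superadditivity. Products of extensions give the converse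
  inequality for product states.

  Strong subadditivity is obtained from the monotonicity of relative entropy under partial trace.
  For \<open>Q > 0\<close> one has \<open>sup\<^sub>Y (2 Re Tr P Y\<^sup>* - Tr Y\<^sup>* Q Y - t Tr Y\<^sup>* Y P) = F(t)\<close>, where
  \<open>F(t) = \<Sum>\<^sub>k\<^sub>l \<bar>\<langle>\<phi>\<^sub>l,\<psi>\<^sub>k\<rangle>\<bar>\<^sup>2 p\<^sub>k\<^sup>2 / (q\<^sub>l + t p\<^sub>k)\<close> in terms of eigenbases \<open>\<psi>\<close> of \<open>P\<close> and \<open>\<phi>\<close> of \<open>Q\<close>. Testing with
  \<open>Y \<otimes> 1\<close> shows that \<open>F(t)\<close> does not increase under partial trace, and integration over \<open>t\<close> turns
  \<open>F\<close> into the relative entropy.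

  All of this takes place on operators indexed by finite sets, where a tensor product of spaces is a
  product of index sets and a regrouping of factors is a bijection.
\<close>

section \<open>Operators on finite index sets and eigenbases\<close>

text \<open>Strong subadditivity is the case of monotonicity under \<open>Tr_B\<close> for the pair
  \<open>rho^ABE\<close> and \<open>1_A tensor rho^BE\<close>: the relative entropy is
  \<open>S(BE) - S(ABE)\<close> before the trace and \<open>S(E) - S(AE)\<close> after it. The
  obstacle is that \<open>rho^BE\<close> may be singular, while the variational formula divides by
  \<open>q + t p\<close> and asks for \<open>q > 0\<close>. So \<open>rho^BE\<close> is replaced by
  \<open>rho^BE + eps\<close>; its partial trace over \<open>B\<close> is
  \<open>rho^E + |B| eps\<close>, and \<open>eps\<close> tends to 0 at the end. The variational form
  suits partial traces because, for fixed \<open>Y\<close>, it is linear in the pair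
  \<open>(P, Q)\<close>. A trial operator of the small system, tensored with the identity, is a
  trial operator of the large one with exactly the same value, so the supremum can only be larger
  there. Logarithms are applied to eigenvalues only; no matrix logarithm enters before the final
  translation to matrices. The dimension of the extension system is unbounded and the infimum need
  not be attained. Every estimate is therefore made for one extension at a time, and infima are
  taken last.\<close>

definition inner_on :: "'i set \<Rightarrow> ('i \<Rightarrow> complex) \<Rightarrow> ('i \<Rightarrow> complex) \<Rightarrow> complex" where
  "inner_on I u v = (\<Sum>i\<in>I. cnj (u i) * v i)"

definition apply_op :: "'i set \<Rightarrow> ('i \<Rightarrow> 'i \<Rightarrow> complex) \<Rightarrow> ('i \<Rightarrow> complex) \<Rightarrow> 'i \<Rightarrow> complex" where
  "apply_op I M v = (\<lambda>i. \<Sum>j\<in>I. M i j * v j)"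

definition trace_on :: "'i set \<Rightarrow> ('i \<Rightarrow> 'i \<Rightarrow> complex) \<Rightarrow> complex" where
  "trace_on I M = (\<Sum>i\<in>I. M i i)"

definition psd :: "'i set \<Rightarrow> ('i \<Rightarrow> 'i \<Rightarrow> complex) \<Rightarrow> bool" where
  "psd I M \<longleftrightarrow> (\<forall>v. 0 \<le> inner_on I v (apply_op I M v))"

text \<open>Orthonormality and completeness are both part of the notion, so its uses never compare
  the sizes of \<open>K\<close> and \<open>I\<close>. The labels \<open>K\<close> are independent of
  \<open>I\<close>: spectral decompositions are labelled by numbers, those of tensor products by
  pairs.\<close>

definition eigenbasis :: "'i set \<Rightarrow> ('i \<Rightarrow> 'i \<Rightarrow> complex) \<Rightarrow> 'k set \<Rightarrow> ('k \<Rightarrow> 'i \<Rightarrow> complex)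
    \<Rightarrow> ('k \<Rightarrow> real) \<Rightarrow> bool" where
  "eigenbasis I M K u d \<longleftrightarrow> finite I \<and> finite K \<and>
     (\<forall>k\<in>K. \<forall>l\<in>K. inner_on I (u k) (u l) = of_bool (k = l)) \<and>
     (\<forall>i\<in>I. \<forall>j\<in>I. (\<Sum>k\<in>K. u k i * cnj (u k j)) = of_bool (i = j)) \<and>
     (\<forall>i\<in>I. \<forall>j\<in>I. M i j = (\<Sum>k\<in>K. of_real (d k) * u k i * cnj (u k j)))"

text \<open>Vectors and operators are total functions of which only the values on the index set
  count. Regroupings agree only there, which is why congruence rules recur throughout.\<close>

lemma inner_on_cong: "(\<And>i. i \<in> I \<Longrightarrow> u i = u' i) \<Longrightarrow> (\<And>i. i \<in> I \<Longrightarrow> v i = v' i) \<Longrightarrow> inner_on I u v = inner_on I u' v'"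
  by (simp add: inner_on_def)

lemma cnj_inner_on: "cnj (inner_on I u v) = inner_on I v u"
  by (simp add: inner_on_def mult.commute)

lemma inner_on_scale_right: "inner_on I u (\<lambda>i. c * v i) = c * inner_on I u v"
  by (simp add: inner_on_def sum_distrib_left algebra_simps)

lemma inner_on_scale_left: "inner_on I (\<lambda>i. c * u i) v = cnj c * inner_on I u v"
  by (simp add: inner_on_def sum_distrib_left algebra_simps)

lemma inner_on_sum_right: "inner_on I u (\<lambda>i. \<Sum>k\<in>K. v k i) = (\<Sum>k\<in>K. inner_on I u (v k))"
proof -
  have "inner_on I u (\<lambda>i. \<Sum>k\<in>K. v k i) = (\<Sum>i\<in>I. \<Sum>k\<in>K. cnj (u i) * v k i)"
    by (simp add: inner_on_def sum_distrib_left)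
  also have "\<dots> = (\<Sum>k\<in>K. \<Sum>i\<in>I. cnj (u i) * v k i)" by (rule sum.swap)
  finally show ?thesis by (simp add: inner_on_def)
qed

lemma inner_on_self: "inner_on I u u = of_real (\<Sum>i\<in>I. (cmod (u i))\<^sup>2)"
  unfolding inner_on_def of_real_sum by (rule sum.cong[OF refl]) (metis complex_norm_square mult.commute of_real_power)

lemma inner_on_mult_cnj: "inner_on I u v * inner_on I v u = of_real ((cmod (inner_on I u v))\<^sup>2)"
  by (subst cnj_inner_on[of I u v, symmetric]) (simp only: complex_norm_square)

lemma eigenbasisD:
  assumes "eigenbasis I M K u d"
  shows "finite I" "finite K"
    "\<And>k l. k \<in> K \<Longrightarrow> l \<in> K \<Longrightarrow> inner_on I (u k) (u l) = of_bool (k = l)"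
    "\<And>i j. i \<in> I \<Longrightarrow> j \<in> I \<Longrightarrow> (\<Sum>k\<in>K. u k i * cnj (u k j)) = of_bool (i = j)"
    "\<And>i j. i \<in> I \<Longrightarrow> j \<in> I \<Longrightarrow> M i j = (\<Sum>k\<in>K. of_real (d k) * u k i * cnj (u k j))"
  using assms unfolding eigenbasis_def by blast+

lemma apply_op_eigenbasis_expand:
  assumes E: "eigenbasis I M K u d" and i: "i \<in> I"
  shows "apply_op I M v i = (\<Sum>k\<in>K. of_real (d k) * inner_on I (u k) v * u k i)"
proof -
  have "apply_op I M v i = (\<Sum>j\<in>I. \<Sum>k\<in>K. of_real (d k) * (cnj (u k j) * v j) * u k i)"
    by (simp add: apply_op_def eigenbasisD(5)[OF E i] sum_distrib_right sum_distrib_left mult_ac)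
  also have "\<dots> = (\<Sum>k\<in>K. \<Sum>j\<in>I. of_real (d k) * (cnj (u k j) * v j) * u k i)" by (rule sum.swap)
  finally show ?thesis by (simp add: inner_on_def sum_distrib_right sum_distrib_left)
qed

lemma expand_eigenbasis:
  assumes E: "eigenbasis I M K u d" and i: "i \<in> I"
  shows "v i = (\<Sum>k\<in>K. inner_on I (u k) v * u k i)"
proof -
  have "(\<Sum>k\<in>K. inner_on I (u k) v * u k i) = (\<Sum>k\<in>K. \<Sum>j\<in>I. (u k i * cnj (u k j)) * v j)"
    by (simp add: inner_on_def sum_distrib_left mult_ac)
  also have "\<dots> = (\<Sum>j\<in>I. \<Sum>k\<in>K. (u k i * cnj (u k j)) * v j)" by (rule sum.swap)
  also have "\<dots> = (\<Sum>j\<in>I. of_bool (i = j) * v j)"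
    by (rule sum.cong) (simp_all add: sum_distrib_right[symmetric] eigenbasisD(4)[OF E i])
  also have "\<dots> = v i" using i eigenbasisD(1)[OF E] by (simp add: of_bool_def if_distrib[where f="\<lambda>x. x * _"] sum.delta cong: if_cong)
  finally show ?thesis by simp
qed

lemma parseval:
  assumes E: "eigenbasis I M K u d"
  shows "inner_on I v w = (\<Sum>k\<in>K. inner_on I v (u k) * inner_on I (u k) w)"
proof -
  have "inner_on I v w = inner_on I v (\<lambda>i. \<Sum>k\<in>K. inner_on I (u k) w * u k i)"
    by (rule inner_on_cong) (auto intro: expand_eigenbasis[OF E])
  thus ?thesis by (simp only: inner_on_sum_right inner_on_scale_right) (simp add: mult.commute)
qed

lemma parseval_norm:
  assumes E: "eigenbasis I M K u d"
  shows "inner_on I v v = of_real (\<Sum>k\<in>K. (cmod (inner_on I (u k) v))\<^sup>2)"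
  unfolding parseval[OF E, of v v]
  by (simp, rule sum.cong, simp) (metis inner_on_mult_cnj mult.commute of_real_power)

lemma inner_on_apply_op_eigenbasis:
  assumes E: "eigenbasis I M K u d"
  shows "inner_on I v (apply_op I M w) = (\<Sum>k\<in>K. of_real (d k) * (inner_on I v (u k) * inner_on I (u k) w))"
proof -
  have "inner_on I v (apply_op I M w) = inner_on I v (\<lambda>i. \<Sum>k\<in>K. (of_real (d k) * inner_on I (u k) w) * u k i)"
    by (rule inner_on_cong) (auto intro: apply_op_eigenbasis_expand[OF E])
  thus ?thesis by (simp only: inner_on_sum_right inner_on_scale_right) (simp add: mult_ac)
qed

lemma inner_on_eigvec_apply_op:
  assumes E: "eigenbasis I M K u d" and k: "k \<in> K"
  shows "inner_on I (u k) (apply_op I M w) = of_real (d k) * inner_on I (u k) w"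
  using k eigenbasisD(2)[OF E]
  by (simp add: inner_on_apply_op_eigenbasis[OF E] eigenbasisD(3)[OF E k] of_bool_def if_distrib if_distribR sum.delta cong: if_cong)

lemma apply_op_eigvec:
  assumes E: "eigenbasis I M K u d" and k: "k \<in> K" and i: "i \<in> I"
  shows "apply_op I M (u k) i = of_real (d k) * u k i"
proof -
  have "apply_op I M (u k) i = (\<Sum>l\<in>K. if l = k then of_real (d k) * u k i else 0)"
    unfolding apply_op_eigenbasis_expand[OF E i] by (rule sum.cong) (auto simp: eigenbasisD(3)[OF E _ k])
  thus ?thesis using k eigenbasisD(2)[OF E] by simp
qed

lemma inner_on_apply_op_self_eigenbasis:
  assumes E: "eigenbasis I M K u d"
  shows "inner_on I v (apply_op I M v) = of_real (\<Sum>k\<in>K. d k * (cmod (inner_on I (u k) v))\<^sup>2)"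
  unfolding inner_on_apply_op_eigenbasis[OF E]
  by (simp, rule sum.cong, simp) (metis inner_on_mult_cnj mult.commute of_real_power)

lemma trace_on_eigenbasis:
  assumes E: "eigenbasis I M K u d"
  shows "trace_on I M = of_real (\<Sum>k\<in>K. d k)"
proof -
  have "trace_on I M = (\<Sum>i\<in>I. \<Sum>k\<in>K. of_real (d k) * (cnj (u k i) * u k i))"
    by (simp add: trace_on_def eigenbasisD(5)[OF E] mult_ac)
  also have "\<dots> = (\<Sum>k\<in>K. \<Sum>i\<in>I. of_real (d k) * (cnj (u k i) * u k i))" by (rule sum.swap)
  also have "\<dots> = (\<Sum>k\<in>K. of_real (d k) * inner_on I (u k) (u k))" by (simp add: inner_on_def sum_distrib_left)
  finally show ?thesis by (simp add: eigenbasisD(3)[OF E])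
qed

text \<open>The squared overlaps of two eigenbases form a doubly stochastic matrix that is supported
  on the pairs with equal eigenvalues.\<close>

lemma sum_eigenvalues_unique:
  fixes g :: "real \<Rightarrow> real"
  assumes E: "eigenbasis I M K u d" and F: "eigenbasis I M L v e"
  shows "(\<Sum>k\<in>K. g (d k)) = (\<Sum>l\<in>L. g (e l))"
proof -
  define c where "c k l = (cmod (inner_on I (u k) (v l)))\<^sup>2" for k l
  have eq: "c k l * g (d k) = c k l * g (e l)" if k: "k \<in> K" and l: "l \<in> L" for k l
  proof -
    \<comment> \<open>\<open><u k, M v l>\<close> is evaluated with \<open>M\<close> acting to the
      left and then to the right, so the overlap vanishes unless the two eigenvalues agree.\<close>
    have "of_real (d k) * inner_on I (u k) (v l) = inner_on I (u k) (apply_op I M (v l))"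
      by (simp add: inner_on_eigvec_apply_op[OF E k])
    also have "\<dots> = inner_on I (u k) (\<lambda>i. of_real (e l) * v l i)"
      by (rule inner_on_cong) (auto simp: apply_op_eigvec[OF F l])
    also have "\<dots> = of_real (e l) * inner_on I (u k) (v l)" by (rule inner_on_scale_right)
    finally have "d k = e l \<or> c k l = 0" by (auto simp: c_def)
    thus ?thesis by auto
  qed
  have 1: "(\<Sum>l\<in>L. c k l) = 1" if "k \<in> K" for k
  proof -
    have "of_real (\<Sum>l\<in>L. c k l) = inner_on I (u k) (u k)"
      by (simp only: parseval_norm[OF F] c_def) (metis cnj_inner_on complex_mod_cnj)
    thus ?thesis using that by (simp add: eigenbasisD(3)[OF E] del: of_real_sum)
  qed
  have 2: "(\<Sum>k\<in>K. c k l) = 1" if "l \<in> L" for l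
  proof -
    have "of_real (\<Sum>k\<in>K. c k l) = inner_on I (v l) (v l)"
      by (simp only: parseval_norm[OF E] c_def)
    thus ?thesis using that by (simp add: eigenbasisD(3)[OF F] del: of_real_sum)
  qed
  have "(\<Sum>k\<in>K. g (d k)) = (\<Sum>k\<in>K. \<Sum>l\<in>L. c k l * g (d k))"
    by (simp add: sum_distrib_right[symmetric] 1)
  also have "\<dots> = (\<Sum>k\<in>K. \<Sum>l\<in>L. c k l * g (e l))" by (intro sum.cong refl eq)
  also have "\<dots> = (\<Sum>l\<in>L. \<Sum>k\<in>K. c k l * g (e l))" by (rule sum.swap)
  also have "\<dots> = (\<Sum>l\<in>L. g (e l))" by (simp add: sum_distrib_right[symmetric] 2)
  finally show ?thesis .
qed

lemma psd_eigenbasis: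
  assumes E: "eigenbasis I M K u d" and "\<And>k. k \<in> K \<Longrightarrow> 0 \<le> d k"
  shows "psd I M"
  unfolding psd_def inner_on_apply_op_self_eigenbasis[OF E] using assms(2)
  by (auto simp: less_eq_complex_def intro!: sum_nonneg)

lemma psd_eigenvalue_nonneg:
  assumes E: "eigenbasis I M K u d" and P: "psd I M" and k: "k \<in> K"
  shows "0 \<le> d k"
proof -
  have "0 \<le> inner_on I (u k) (apply_op I M (u k))" using P by (simp add: psd_def)
  thus ?thesis using k by (simp add: inner_on_eigvec_apply_op[OF E k] eigenbasisD(3)[OF E] less_eq_complex_def)
qed

section \<open>Transport along bijections of index sets\<close>

lemma eigenbasis_reindex:
  assumes h: "bij_betw h I' I" and E: "eigenbasis I M K u d"
  shows "eigenbasis I' (\<lambda>i j. M (h i) (h j)) K (\<lambda>k i. u k (h i)) d"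
proof -
  have inj: "h i = h j \<longleftrightarrow> i = j" if "i \<in> I'" "j \<in> I'" for i j
    using h that by (auto simp: bij_betw_def inj_on_def)
  have mem: "h i \<in> I" if "i \<in> I'" for i using h that by (auto simp: bij_betw_def)
  have "inner_on I' (\<lambda>i. u k (h i)) (\<lambda>i. u l (h i)) = inner_on I (u k) (u l)" for k l
    unfolding inner_on_def using sum.reindex_bij_betw[OF h, of "\<lambda>i. cnj (u k i) * u l i"] by simp
  moreover have "finite I'" using bij_betw_finite[OF h] eigenbasisD(1)[OF E] by simp
  ultimately show ?thesis
    unfolding eigenbasis_def using eigenbasisD(2)[OF E] eigenbasisD(3,4,5)[OF E] inj mem by simp
qed

lemma eigenbasis_reindex_basis:
  assumes h: "bij_betw h K' K" and E: "eigenbasis I M K u d"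
  shows "eigenbasis I M K' (\<lambda>k. u (h k)) (\<lambda>k. d (h k))"
proof -
  have inj: "h i = h j \<longleftrightarrow> i = j" if "i \<in> K'" "j \<in> K'" for i j
    using h that by (auto simp: bij_betw_def inj_on_def)
  have mem: "h i \<in> K" if "i \<in> K'" for i using h that by (auto simp: bij_betw_def)
  have "finite K'" using bij_betw_finite[OF h] eigenbasisD(2)[OF E] by simp
  moreover have "(\<Sum>k\<in>K'. u (h k) i * cnj (u (h k) j)) = (\<Sum>k\<in>K. u k i * cnj (u k j))" for i j
    by (rule sum.reindex_bij_betw[OF h])
  moreover have "(\<Sum>k\<in>K'. of_real (d (h k)) * u (h k) i * cnj (u (h k) j)) = (\<Sum>k\<in>K. of_real (d k) * u k i * cnj (u k j))" for i j
    by (rule sum.reindex_bij_betw[OF h])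
  ultimately show ?thesis
    unfolding eigenbasis_def using eigenbasisD(1)[OF E] eigenbasisD(3,4,5)[OF E] inj mem by simp
qed

lemma eigenbasis_cong:
  assumes "\<And>i j. i \<in> I \<Longrightarrow> j \<in> I \<Longrightarrow> M i j = M' i j"
  shows "eigenbasis I M K u d = eigenbasis I M' K u d"
  unfolding eigenbasis_def using assms by simp

lemma psd_cong:
  assumes "\<And>i j. i \<in> I \<Longrightarrow> j \<in> I \<Longrightarrow> M i j = M' i j"
  shows "psd I M = psd I M'"
proof -
  have "inner_on I v (apply_op I M v) = inner_on I v (apply_op I M' v)" for v
    by (rule inner_on_cong) (auto simp: apply_op_def assms)
  thus ?thesis by (simp add: psd_def)
qed

lemma inner_on_reindex: "bij_betw h I' I \<Longrightarrow> inner_on I' (\<lambda>i. v (h i)) (\<lambda>i. w (h i)) = inner_on I v w"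
  unfolding inner_on_def by (rule sum.reindex_bij_betw)

lemma apply_op_reindex: "bij_betw h I' I \<Longrightarrow> apply_op I' (\<lambda>i j. M (h i) (h j)) (\<lambda>i. v (h i)) = (\<lambda>i. apply_op I M v (h i))"
  unfolding apply_op_def by (rule ext, rule sum.reindex_bij_betw)

lemma psd_reindex:
  assumes h: "bij_betw h I' I" and P: "psd I M"
  shows "psd I' (\<lambda>i j. M (h i) (h j))"
  unfolding psd_def
proof
  fix v :: "_ \<Rightarrow> complex"
  \<comment> \<open>A test vector on \<open>I'\<close> is carried to \<open>I\<close> by the inverse
    bijection, where positivity of \<open>M\<close> applies.\<close>
  define w where "w = (\<lambda>i. v (inv_into I' h i))"
  have w: "v i = w (h i)" if "i \<in> I'" for i
    using h that by (simp add: w_def bij_betw_def)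
  have "inner_on I' v (apply_op I' (\<lambda>i j. M (h i) (h j)) v) = inner_on I' (\<lambda>i. w (h i)) (apply_op I' (\<lambda>i j. M (h i) (h j)) (\<lambda>i. w (h i)))"
    by (rule inner_on_cong) (auto simp: apply_op_def w)
  also have "\<dots> = inner_on I w (apply_op I M w)" by (simp add: apply_op_reindex[OF h] inner_on_reindex[OF h])
  finally show "0 \<le> inner_on I' v (apply_op I' (\<lambda>i j. M (h i) (h j)) v)" using P by (simp add: psd_def)
qed

lemma trace_on_reindex: "bij_betw h I' I \<Longrightarrow> trace_on I' (\<lambda>i j. M (h i) (h j)) = trace_on I M"
  unfolding trace_on_def by (rule sum.reindex_bij_betw)

section \<open>The spectral theorem\<close>

lemma mat_tr_mult_commute:
  assumes A: "A \<in> carrier_mat n m" and B: "B \<in> carrier_mat m n"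
  shows "mat_tr (A * B) = mat_tr (B * A)"
proof -
  have "mat_tr (A * B) = (\<Sum>i<n. \<Sum>j<m. A $$ (i, j) * B $$ (j, i))"
    unfolding mat_tr_def using A B by (auto simp: scalar_prod_def atLeast0LessThan intro!: sum.cong)
  also have "\<dots> = (\<Sum>j<m. \<Sum>i<n. A $$ (i, j) * B $$ (j, i))" by (rule sum.swap)
  also have "\<dots> = mat_tr (B * A)"
    unfolding mat_tr_def using A B by (auto simp: scalar_prod_def atLeast0LessThan mult.commute intro!: sum.cong)
  finally show ?thesis .
qed

text \<open>By Schur triangularisation the trace is the sum of the roots of the characteristic
  polynomial, so not all roots vanish. A nonzero eigenvalue is wanted because deflation gives the
  vectors already found the eigenvalue 0.\<close>

lemma nonzero_trace_eigenvector:
  assumes A: "A \<in> carrier_mat n n" and t: "mat_tr A \<noteq> 0"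
  obtains v \<mu> where "eigenvector A v \<mu>" "\<mu> \<noteq> 0"
proof -
  obtain es where es: "char_poly A = (\<Prod>a\<leftarrow>es. [:- a, 1:])"
    using char_poly_factorized[OF A] by blast
  obtain B P Q where S: "schur_decomposition A es = (B, P, Q)" by (metis prod_cases3)
  have sim: "similar_mat_wit A B P Q" and d: "diag_mat B = es"
    using schur_decomposition[OF A es S] by auto
  note w = similar_mat_witD2[OF A sim]
  have "mat_tr A = mat_tr (P * (B * Q))" using w by (simp add: assoc_mult_mat[of P n n B n Q n])
  also have "\<dots> = mat_tr ((B * Q) * P)" by (rule mat_tr_mult_commute) (use w in auto)
  also have "\<dots> = mat_tr B" using w by (simp add: assoc_mult_mat[of B n n Q n P n])
  also have "\<dots> = sum_list es"
    unfolding d[symmetric] diag_mat_def mat_tr_def by (simp add: sum_list_sum_nth atLeast0LessThan)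
  finally have "sum_list es \<noteq> 0" using t by simp
  then obtain \<mu> where \<mu>: "\<mu> \<in> set es" "\<mu> \<noteq> 0"
    by (metis sum_list_neutral)
  have "poly (char_poly A) \<mu> = 0" unfolding es using \<mu>(1) by (auto simp: poly_prod_list prod_list_zero_iff)
  hence "eigenvalue A \<mu>" using eigenvalue_root_char_poly[OF A] by simp
  thus ?thesis using that \<mu>(2) unfolding eigenvalue_def by blast
qed

lemma nonzero_trace_on_eigvec:
  fixes M :: "nat \<Rightarrow> nat \<Rightarrow> complex"
  assumes "trace_on {..<n} M \<noteq> 0"
  obtains v \<mu> where "\<mu> \<noteq> 0" "\<exists>i<n. v i \<noteq> 0" "\<And>i. i < n \<Longrightarrow> apply_op {..<n} M v i = \<mu> * v i"
proof -
  define A where "A = mat n n (\<lambda>(i, j). M i j)"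
  have A: "A \<in> carrier_mat n n" by (simp add: A_def)
  have "mat_tr A = trace_on {..<n} M" by (simp add: mat_tr_def trace_on_def A_def)
  then obtain v \<mu> where v: "eigenvector A v \<mu>" "\<mu> \<noteq> 0"
    using nonzero_trace_eigenvector[OF A] assms by metis
  have d: "v \<in> carrier_vec n" and nz: "v \<noteq> 0\<^sub>v n" and e: "A *\<^sub>v v = \<mu> \<cdot>\<^sub>v v"
    using v(1) A by (auto simp: eigenvector_def)
  have "\<exists>i<n. v $ i \<noteq> 0" using d nz by auto
  moreover have "apply_op {..<n} M (\<lambda>i. v $ i) i = \<mu> * v $ i" if i: "i < n" for i
  proof -
    have "(A *\<^sub>v v) $ i = (\<mu> \<cdot>\<^sub>v v) $ i" by (simp add: e)
    thus ?thesis using i d A by (simp add: apply_op_def A_def scalar_prod_def atLeast0LessThan)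
  qed
  ultimately show ?thesis using that v(2) by blast
qed

definition hermitian_on :: "'i set \<Rightarrow> ('i \<Rightarrow> 'i \<Rightarrow> complex) \<Rightarrow> bool" where
  "hermitian_on I M \<longleftrightarrow> (\<forall>i\<in>I. \<forall>j\<in>I. M j i = cnj (M i j))"

lemma hermitian_on_inner_on:
  assumes "hermitian_on I M"
  shows "inner_on I (apply_op I M v) w = inner_on I v (apply_op I M w)"
proof -
  have "inner_on I (apply_op I M v) w = (\<Sum>i\<in>I. \<Sum>j\<in>I. cnj (M i j) * cnj (v j) * w i)"
    by (simp add: inner_on_def apply_op_def sum_distrib_right)
  also have "\<dots> = (\<Sum>j\<in>I. \<Sum>i\<in>I. cnj (M i j) * cnj (v j) * w i)" by (rule sum.swap)
  also have "\<dots> = (\<Sum>j\<in>I. \<Sum>i\<in>I. cnj (v j) * (M j i * w i))"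
  proof (intro sum.cong refl)
    fix i j assume "j \<in> I" "i \<in> I"
    hence "cnj (M i j) = M j i" using assms unfolding hermitian_on_def by metis
    thus "cnj (M i j) * cnj (v j) * w i = cnj (v j) * (M j i * w i)" by simp
  qed
  finally show ?thesis by (simp add: inner_on_def apply_op_def sum_distrib_left)
qed

text \<open>Polarisation: the form is real at \<open>x e_i + y e_j\<close>. The choices
  \<open>(1, 0)\<close> and \<open>(0, 1)\<close> make the diagonal real, \<open>(1, 1)\<close>
  compares the imaginary parts of \<open>M i j\<close> and \<open>M j i\<close>, and
  \<open>(1, \<i>)\<close> their real parts.\<close>

lemma psd_hermitian_on:
  assumes fin: "finite I" and P: "psd I M"
  shows "hermitian_on I M"
  unfolding hermitian_on_def
proof (intro ballI)
  fix i j assume ij: "i \<in> I" "j \<in> I"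
  define v where "v x y k = (if k = i then x else 0) + (if k = j then y else 0)" for x y :: complex and k
  have s: "(\<Sum>k\<in>I. f k * v x y k) = f i * x + f j * y" for f x y
    using fin ij unfolding v_def by (simp add: distrib_left sum.distrib if_distrib[where f="\<lambda>x. _ * x"] cong: if_cong)
  have q: "inner_on I (v x y) (apply_op I M (v x y)) =
      (M i i * x + M i j * y) * cnj x + (M j i * x + M j j * y) * cnj y" for x y
  proof -
    have "inner_on I (v x y) (apply_op I M (v x y)) = cnj (inner_on I (apply_op I M (v x y)) (v x y))"
      by (simp add: cnj_inner_on)
    also have "\<dots> = cnj (cnj (M i i * x + M i j * y) * x + cnj (M j i * x + M j j * y) * y)"
      unfolding inner_on_def apply_op_def s by simp
    finally show ?thesis by simp
  qed
  have im: "Im ((M i i * x + M i j * y) * cnj x + (M j i * x + M j j * y) * cnj y) = 0" for x y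
    using P unfolding psd_def q[symmetric] less_eq_complex_def by (metis zero_complex.simps(2))
  show "M j i = cnj (M i j)"
    using im[of 1 0] im[of 0 1] im[of 1 1] im[of 1 \<i>] by (auto simp: complex_eq_iff)
qed

text \<open>Deflation: adding \<open>s\<close> times the identity and subtracting \<open>d k + s\<close> times the projection onto
  each eigenvector \<open>u k\<close> found so far leaves a matrix that annihilates them. For suitable \<open>s\<close> its trace is nonzero, and then it has an eigenvector for a nonzero
  eigenvalue, which is orthogonal to all previous ones.\<close>

lemma hermitian_on_partial_eigenbasis:
  fixes M :: "nat \<Rightarrow> nat \<Rightarrow> complex"
  assumes H: "hermitian_on {..<n} M" and "m \<le> n"
  shows "\<exists>u d. (\<forall>k<m. \<forall>l<m. inner_on {..<n} (u k) (u l) = of_bool (k = l)) \<and>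
     (\<forall>k<m. \<forall>i<n. apply_op {..<n} M (u k) i = of_real (d k) * u k i)"
  using \<open>m \<le> n\<close>
proof (induction m)
  case (Suc m)
  let ?I = "{..<n}"
  have "m \<le> n" using Suc.prems by simp
  from Suc.IH[OF this] obtain u :: "nat \<Rightarrow> nat \<Rightarrow> complex" and d :: "nat \<Rightarrow> real" where
    o: "\<And>k l. k < m \<Longrightarrow> l < m \<Longrightarrow> inner_on ?I (u k) (u l) = of_bool (k = l)" and
    e: "\<And>k i. k < m \<Longrightarrow> i < n \<Longrightarrow> apply_op ?I M (u k) i = of_real (d k) * u k i"
    by blast
  \<comment> \<open>The trace of \<open>N\<close> below will be
    \<open>(trace M - sum of d) + s (n - m)\<close> with \<open>m < n\<close>, so
    \<open>s = 1\<close> is used exactly when the first part vanishes.\<close>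
  define s :: real where "s = (if trace_on ?I M - of_real (\<Sum>k<m. d k) = 0 then 1 else 0)"
  define N where "N i j = M i j + of_real s * of_bool (i = j)
      - (\<Sum>k<m. of_real (d k + s) * u k i * cnj (u k j))" for i j
  have apN: "apply_op ?I N v i = apply_op ?I M v i + of_real s * v i - (\<Sum>k<m. of_real (d k + s) * inner_on ?I (u k) v * u k i)"
    if "i < n" for v i
  proof -
    have "(\<Sum>j<n. (\<Sum>k<m. of_real (d k + s) * u k i * cnj (u k j)) * v j)
        = (\<Sum>j<n. \<Sum>k<m. of_real (d k + s) * (cnj (u k j) * v j) * u k i)"
      by (simp add: sum_distrib_left sum_distrib_right mult_ac)
    also have "\<dots> = (\<Sum>k<m. \<Sum>j<n. of_real (d k + s) * (cnj (u k j) * v j) * u k i)" by (rule sum.swap)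
    also have "\<dots> = (\<Sum>k<m. of_real (d k + s) * inner_on ?I (u k) v * u k i)"
      by (simp add: inner_on_def sum_distrib_left sum_distrib_right)
    moreover have "(\<Sum>j<n. of_real s * of_bool (i = j) * v j) = of_real s * v i"
      using that by (simp add: of_bool_def if_distrib if_distribR cong: if_cong)
    ultimately show ?thesis
      by (simp add: apply_op_def N_def left_diff_distrib distrib_right sum_subtractf sum.distrib)
  qed
  have Nu: "apply_op ?I N (u l) i = 0" if "l < m" "i < n" for l i
  proof -
    have "(\<Sum>k<m. of_real (d k + s) * inner_on ?I (u k) (u l) * u k i) = (\<Sum>k<m. if k = l then of_real (d l + s) * u l i else 0)"
      using that by (intro sum.cong) (auto simp: o)
    thus ?thesis using that by (simp add: apN e algebra_simps)
  qed
  have HN: "hermitian_on ?I N"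
    unfolding hermitian_on_def
  proof (intro ballI)
    fix i j assume "i \<in> ?I" "j \<in> ?I"
    hence "M j i = cnj (M i j)" using H unfolding hermitian_on_def by blast
    moreover have "of_bool (j = i) = (of_bool (i = j) :: complex)" by (cases "i = j") auto
    ultimately show "N j i = cnj (N i j)" by (simp add: N_def mult_ac)
  qed
  have "trace_on ?I N = trace_on ?I M + of_real s * of_nat n - (\<Sum>i<n. \<Sum>k<m. of_real (d k + s) * (cnj (u k i) * u k i))"
    by (simp add: trace_on_def N_def sum.distrib sum_subtractf mult_ac)
  also have "(\<Sum>i<n. \<Sum>k<m. of_real (d k + s) * (cnj (u k i) * u k i))
      = (\<Sum>k<m. \<Sum>i<n. of_real (d k + s) * (cnj (u k i) * u k i))" by (rule sum.swap)
  also have "\<dots> = (\<Sum>k<m. of_real (d k + s) * inner_on ?I (u k) (u k))" by (simp add: inner_on_def sum_distrib_left)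
  also have "\<dots> = of_real (\<Sum>k<m. d k) + of_nat m * of_real s" by (simp add: o sum.distrib)
  finally have "trace_on ?I N = (trace_on ?I M - of_real (\<Sum>k<m. d k)) + of_real s * (of_nat n - of_nat m)"
    by (simp add: algebra_simps)
  hence "trace_on ?I N \<noteq> 0" using \<open>Suc m \<le> n\<close> by (auto simp: s_def)
  then obtain v \<mu> where \<mu>: "\<mu> \<noteq> 0" and v: "\<exists>i<n. v i \<noteq> 0" and ev: "\<And>i. i < n \<Longrightarrow> apply_op ?I N v i = \<mu> * v i"
    using nonzero_trace_on_eigvec[of n N] by metis
  have orth: "inner_on ?I (u k) v = 0" if k: "k < m" for k
  proof -
    have "\<mu> * inner_on ?I (u k) v = inner_on ?I (u k) (apply_op ?I N v)"
      unfolding inner_on_scale_right[symmetric] by (rule inner_on_cong) (auto simp: ev)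
    also have "\<dots> = inner_on ?I (apply_op ?I N (u k)) v" by (simp add: hermitian_on_inner_on[OF HN])
    also have "\<dots> = 0" unfolding inner_on_def using Nu[OF k] by simp
    finally show ?thesis using \<mu> by simp
  qed
  define r where "r = (\<Sum>i<n. (cmod (v i))\<^sup>2)"
  have r: "r > 0" using v unfolding r_def by (auto intro!: sum_pos2)
  have vv: "inner_on ?I v v = of_real r" by (simp add: inner_on_self r_def)
  \<comment> \<open>The eigenvalue has to be real, since \<open>d\<close> takes real values;
    hermiticity of \<open>N\<close> gives this.\<close>
  have "cnj \<mu> * inner_on ?I v v = inner_on ?I (apply_op ?I N v) v"
    unfolding inner_on_scale_left[symmetric] by (rule inner_on_cong) (auto simp: ev)
  also have "\<dots> = inner_on ?I v (apply_op ?I N v)" by (simp add: hermitian_on_inner_on[OF HN])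
  also have "\<dots> = \<mu> * inner_on ?I v v"
    unfolding inner_on_scale_right[symmetric] by (rule inner_on_cong) (auto simp: ev)
  finally have "cnj \<mu> = \<mu>" using r by (simp add: vv)
  hence re: "\<mu> = of_real (Re \<mu>)" by (simp add: complex_eq_iff)
  \<comment> \<open>As \<open>v\<close> is orthogonal to every \<open>u k\<close>, the projections
    in \<open>N\<close> annihilate it and only \<open>M + s\<close> acts, so the eigenvalue for
    \<open>M\<close> is shifted by \<open>s\<close>.\<close>
  have Mv: "apply_op ?I M v i = of_real (Re \<mu> - s) * v i" if "i < n" for i
  proof -
    have "apply_op ?I M v i + of_real s * v i = of_real (Re \<mu>) * v i"
      using ev[OF that] re by (simp add: apN[OF that] orth)
    thus ?thesis by (simp add: algebra_simps)
  qed
  define w where "w = (\<lambda>i. of_real (1 / sqrt r) * v i)"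
  have uw: "inner_on ?I (u k) w = 0" if "k < m" for k
    unfolding w_def inner_on_scale_right by (simp add: orth that)
  have wu: "inner_on ?I w (u k) = 0" if "k < m" for k
    using uw[OF that] cnj_inner_on[of ?I "u k" w] by simp
  have "inner_on ?I w w = of_real (1 / sqrt r * (1 / sqrt r) * r)"
    unfolding w_def inner_on_scale_right inner_on_scale_left vv by (simp only: complex_cnj_complex_of_real of_real_mult mult_ac)
  also have "1 / sqrt r * (1 / sqrt r) * r = 1" using r by (simp add: field_simps)
  finally have ww: "inner_on ?I w w = 1" by simp
  have Mw: "apply_op ?I M w i = of_real (Re \<mu> - s) * w i" if "i < n" for i
  proof -
    have "apply_op ?I M w i = of_real (1 / sqrt r) * apply_op ?I M v i"
      by (simp add: apply_op_def w_def sum_distrib_left mult_ac)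
    thus ?thesis by (simp add: Mv[OF that] w_def)
  qed
  let ?u = "u(m := w)" and ?d = "d(m := Re \<mu> - s)"
  have "inner_on ?I (?u k) (?u l) = of_bool (k = l)" if "k < Suc m" "l < Suc m" for k l
    using that o[of k l] uw[of k] wu[of l] ww by (cases "k = m"; cases "l = m") auto
  moreover have "apply_op ?I M (?u k) i = of_real (?d k) * ?u k i" if "k < Suc m" "i < n" for k i
    using that e[of k i] Mw[of i] by (cases "k = m") auto
  ultimately show ?case by blast
qed auto

text \<open>For \<open>n\<close> orthonormal vectors, \<open>V * U = 1\<close> says orthonormality
  and \<open>U * V = 1\<close> says completeness; a left inverse of a square matrix is a right
  inverse. Completeness then turns the eigenvector equations into the expansion of
  \<open>M\<close>.\<close>

lemma hermitian_on_eigenbasis: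
  fixes M :: "nat \<Rightarrow> nat \<Rightarrow> complex"
  assumes H: "hermitian_on {..<n} M"
  shows "\<exists>u d. eigenbasis {..<n} M {..<n} u d"
proof -
  let ?I = "{..<n}"
  obtain u :: "nat \<Rightarrow> nat \<Rightarrow> complex" and d :: "nat \<Rightarrow> real" where
    o: "\<And>k l. k < n \<Longrightarrow> l < n \<Longrightarrow> inner_on ?I (u k) (u l) = of_bool (k = l)" and
    e: "\<And>k i. k < n \<Longrightarrow> i < n \<Longrightarrow> apply_op ?I M (u k) i = of_real (d k) * u k i"
    using hermitian_on_partial_eigenbasis[OF H order_refl] by blast
  define U where "U = mat n n (\<lambda>(i, k). u k i)"
  define V where "V = mat n n (\<lambda>(k, i). cnj (u k i))"
  have c: "U \<in> carrier_mat n n" "V \<in> carrier_mat n n" by (simp_all add: U_def V_def)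
  have "V * U = 1\<^sub>m n"
    using o by (intro eq_matI) (auto simp: U_def V_def scalar_prod_def inner_on_def atLeast0LessThan)
  hence "U * V = 1\<^sub>m n" using mat_mult_left_right_inverse[of V n U] c by simp
  hence comp: "(\<Sum>k<n. u k i * cnj (u k j)) = of_bool (i = j)" if "i < n" "j < n" for i j
    using that by (auto simp: U_def V_def scalar_prod_def atLeast0LessThan dest!: arg_cong[where f="\<lambda>A. A $$ (i, j)"])
  have "M i j = (\<Sum>k<n. of_real (d k) * u k i * cnj (u k j))" if i: "i < n" and j: "j < n" for i j
  proof -
    have "(\<Sum>k<n. of_real (d k) * u k i * cnj (u k j)) = (\<Sum>k<n. apply_op ?I M (u k) i * cnj (u k j))"
      using i by (simp add: e)
    also have "\<dots> = (\<Sum>k<n. \<Sum>l<n. M i l * (u k l * cnj (u k j)))"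
      by (simp add: apply_op_def sum_distrib_left sum_distrib_right mult_ac)
    also have "\<dots> = (\<Sum>l<n. \<Sum>k<n. M i l * (u k l * cnj (u k j)))" by (rule sum.swap)
    also have "\<dots> = (\<Sum>l<n. M i l * of_bool (l = j))"
      using j by (simp add: sum_distrib_left[symmetric] comp)
    finally show ?thesis using j by (simp add: of_bool_def if_distrib cong: if_cong)
  qed
  thus ?thesis using o comp unfolding eigenbasis_def by (auto intro!: exI[of _ u] exI[of _ d])
qed

text \<open>An enumeration of \<open>I\<close> carries the spectral decomposition from initial
  segments of the naturals to every finite index set; the labels of the eigenvectors stay
  numbers.\<close>

theorem psd_spectral:
  assumes fin: "finite I" and P: "psd I M"
  obtains u d where "eigenbasis I M {..<card I} u d" "\<And>k. k < card I \<Longrightarrow> 0 \<le> d k"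
proof -
  obtain h where h: "bij_betw h {..<card I} I"
    using ex_bij_betw_nat_finite[OF fin] by (auto simp: atLeast0LessThan)
  let ?h' = "inv_into {..<card I} h"
  have h': "bij_betw ?h' I {..<card I}" using h by (rule bij_betw_inv_into)
  have "psd {..<card I} (\<lambda>i j. M (h i) (h j))" by (rule psd_reindex[OF h P])
  then obtain u d where E: "eigenbasis {..<card I} (\<lambda>i j. M (h i) (h j)) {..<card I} u d"
    using hermitian_on_eigenbasis[OF psd_hermitian_on] by blast
  have "eigenbasis I (\<lambda>i j. M (h (?h' i)) (h (?h' j))) {..<card I} (\<lambda>k i. u k (?h' i)) d"
    by (rule eigenbasis_reindex[OF h' E])
  moreover have "h (?h' i) = i" if "i \<in> I" for i
    using bij_betw_inv_into_right[OF h that] .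
  ultimately have F: "eigenbasis I M {..<card I} (\<lambda>k i. u k (?h' i)) d"
    by (subst (asm) eigenbasis_cong[of _ _ M]) auto
  show ?thesis using that[OF F] psd_eigenvalue_nonneg[OF F P] by simp
qed

section \<open>Entropy and a variational formula\<close>

text \<open>By \<open>sum_eigenvalues_unique\<close> the value does not depend on the eigenbasis; it is unspecified for
  operators without one. Note that \<open>log 2 0 = 0\<close>.\<close>

definition entropy :: "'i set \<Rightarrow> ('i \<Rightarrow> 'i \<Rightarrow> complex) \<Rightarrow> real" where
  "entropy I M = (THE s. \<exists>(K :: nat set) u d. eigenbasis I M K u d \<and> s = - (\<Sum>k\<in>K. d k * log 2 (d k)))"

text \<open>The definition of \<open>entropy\<close> quantifies over labels in the naturals. This
  evaluation accepts labels of any type, such as the pairs from a tensor product, by enumerating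
  them.\<close>

lemma entropy_eq:
  assumes E: "eigenbasis I M K u d"
  shows "entropy I M = - (\<Sum>k\<in>K. d k * log 2 (d k))"
  unfolding entropy_def
proof (rule the_equality)
  obtain h where "bij_betw h {..<card K} K"
    using ex_bij_betw_nat_finite[OF eigenbasisD(2)[OF E]] by (auto simp: atLeast0LessThan)
  note F = eigenbasis_reindex_basis[OF this E]
  have "(\<Sum>k\<in>K. d k * log 2 (d k)) = (\<Sum>k<card K. d (h k) * log 2 (d (h k)))"
    by (rule sum_eigenvalues_unique[OF E F])
  thus "\<exists>(K' :: nat set) u' d'. eigenbasis I M K' u' d' \<and>
      - (\<Sum>k\<in>K. d k * log 2 (d k)) = - (\<Sum>k\<in>K'. d' k * log 2 (d' k))"
    using F by auto
next
  fix s assume "\<exists>(K' :: nat set) u' d'. eigenbasis I M K' u' d' \<and> s = - (\<Sum>k\<in>K'. d' k * log 2 (d' k))"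
  then obtain K' :: "nat set" and u' d' where
    F: "eigenbasis I M K' u' d'" and s: "s = - (\<Sum>k\<in>K'. d' k * log 2 (d' k))" by blast
  show "s = - (\<Sum>k\<in>K. d k * log 2 (d k))"
    unfolding s using sum_eigenvalues_unique[OF F E, of "\<lambda>x. x * log 2 x"] by simp
qed

lemma entropy_cong:
  assumes "\<And>i j. i \<in> I \<Longrightarrow> j \<in> I \<Longrightarrow> M i j = M' i j"
  shows "entropy I M = entropy I M'"
proof -
  have "eigenbasis I M K u d = eigenbasis I M' K u d" for K :: "nat set" and u d
    by (rule eigenbasis_cong) (rule assms)
  thus ?thesis unfolding entropy_def by simp
qed

section \<open>Spectra of tensor products, the identity and shifted operators\<close>

lemma eigenbasis_tensor:
  assumes E: "eigenbasis I M K u d" and F: "eigenbasis J N L v e"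
  shows "eigenbasis (I \<times> J) (\<lambda>x y. M (fst x) (fst y) * N (snd x) (snd y)) (K \<times> L)
           (\<lambda>k x. u (fst k) (fst x) * v (snd k) (snd x)) (\<lambda>k. d (fst k) * e (snd k))"
proof -
  have prod: "(\<Sum>x\<in>A \<times> B. f (fst x) * g (snd x)) = (\<Sum>a\<in>A. f a) * (\<Sum>b\<in>B. g b)"
    for f :: "'x \<Rightarrow> complex" and g :: "'y \<Rightarrow> complex" and A B
    by (simp add: sum_product sum.cartesian_product case_prod_beta)
  have "inner_on (I \<times> J) (\<lambda>x. u (fst k) (fst x) * v (snd k) (snd x)) (\<lambda>x. u (fst l) (fst x) * v (snd l) (snd x))
      = of_bool (k = l)" if "k \<in> K \<times> L" "l \<in> K \<times> L" for k l
  proof -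
    have "inner_on (I \<times> J) (\<lambda>x. u (fst k) (fst x) * v (snd k) (snd x)) (\<lambda>x. u (fst l) (fst x) * v (snd l) (snd x))
        = inner_on I (u (fst k)) (u (fst l)) * inner_on J (v (snd k)) (v (snd l))"
      unfolding inner_on_def prod[symmetric] by (simp add: mult_ac)
    also have "\<dots> = of_bool (fst k = fst l) * of_bool (snd k = snd l)"
      using that eigenbasisD(3)[OF E] eigenbasisD(3)[OF F] by (auto simp: mem_Times_iff)
    finally show ?thesis by (simp add: prod_eq_iff)
  qed
  moreover have "(\<Sum>k\<in>K \<times> L. u (fst k) (fst x) * v (snd k) (snd x) * cnj (u (fst k) (fst y) * v (snd k) (snd y)))
      = of_bool (x = y)" if "x \<in> I \<times> J" "y \<in> I \<times> J" for x y
  proof -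
    have "(\<Sum>k\<in>K \<times> L. u (fst k) (fst x) * v (snd k) (snd x) * cnj (u (fst k) (fst y) * v (snd k) (snd y)))
        = (\<Sum>k\<in>K. u k (fst x) * cnj (u k (fst y))) * (\<Sum>l\<in>L. v l (snd x) * cnj (v l (snd y)))"
      unfolding prod[symmetric] by (simp add: mult_ac)
    also have "\<dots> = of_bool (fst x = fst y) * of_bool (snd x = snd y)"
      using that eigenbasisD(4)[OF E] eigenbasisD(4)[OF F] by (auto simp: mem_Times_iff)
    finally show ?thesis by (simp add: prod_eq_iff)
  qed
  moreover have "M (fst x) (fst y) * N (snd x) (snd y) = (\<Sum>k\<in>K \<times> L. of_real (d (fst k) * e (snd k)) *
      (u (fst k) (fst x) * v (snd k) (snd x)) * cnj (u (fst k) (fst y) * v (snd k) (snd y)))"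
    if "x \<in> I \<times> J" "y \<in> I \<times> J" for x y
  proof -
    have "M (fst x) (fst y) * N (snd x) (snd y) = (\<Sum>k\<in>K. of_real (d k) * u k (fst x) * cnj (u k (fst y)))
        * (\<Sum>l\<in>L. of_real (e l) * v l (snd x) * cnj (v l (snd y)))"
      using that eigenbasisD(5)[OF E] eigenbasisD(5)[OF F] by (auto simp: mem_Times_iff)
    thus ?thesis unfolding prod[symmetric] by (simp add: mult_ac)
  qed
  ultimately show ?thesis
    unfolding eigenbasis_def using eigenbasisD(1,2)[OF E] eigenbasisD(1,2)[OF F] by (intro conjI finite_cartesian_product) blast+
qed

lemma eigenbasis_id:
  assumes "finite I"
  shows "eigenbasis I (\<lambda>i j. of_bool (i = j)) I (\<lambda>k i. of_bool (k = i)) (\<lambda>_. 1)"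
proof -
  have d: "(\<Sum>k\<in>I. of_bool (k = i) * (of_bool (k = j) :: complex)) = of_bool (i = j)" if "i \<in> I" for i j
  proof -
    have "(\<Sum>k\<in>I. of_bool (k = i) * (of_bool (k = j) :: complex)) = (\<Sum>k\<in>I. if k = i then of_bool (i = j) else 0)"
      by (rule sum.cong) auto
    thus ?thesis using that assms by simp
  qed
  have s: "cnj (of_bool (i = j)) = (of_bool (j = i) :: complex)" for i j :: 'a by (cases "i = j") auto
  show ?thesis
    unfolding eigenbasis_def inner_on_def
  proof (intro conjI ballI assms)
    fix k l assume "k \<in> I" "l \<in> I"
    have t: "of_bool (l = i) = (of_bool (i = l) :: complex)" for i by (cases "i = l") auto
    show "(\<Sum>i\<in>I. cnj (of_bool (k = i)) * of_bool (l = i)) = (of_bool (k = l) :: complex)"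
      unfolding s t by (rule d) fact
  next
    fix i j assume i: "i \<in> I" "j \<in> I"
    have t: "of_bool (k = i) * cnj (of_bool (k = j)) = of_bool (k = i) * (of_bool (k = j) :: complex)" for k
      by (cases "k = j") auto
    show "(\<Sum>k\<in>I. of_bool (k = i) * cnj (of_bool (k = j))) = (of_bool (i = j) :: complex)"
      unfolding t by (rule d) fact
    thus "of_bool (i = j) = (\<Sum>k\<in>I. of_real 1 * of_bool (k = i) * cnj (of_bool (k = j)))"
      by simp
  qed
qed

text \<open>By completeness the identity is the sum of the projections onto the \<open>u k\<close>.
  With \<open>c > 0\<close> this turns nonnegative eigenvalues into strictly positive ones, as the
  variational formula demands.\<close>

lemma eigenbasis_shift:
  assumes E: "eigenbasis I M K u d"
  shows "eigenbasis I (\<lambda>i j. M i j + of_real c * of_bool (i = j)) K u (\<lambda>k. d k + c)"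
proof -
  have "M i j + of_real c * of_bool (i = j) = (\<Sum>k\<in>K. of_real (d k + c) * u k i * cnj (u k j))"
    if ij: "i \<in> I" "j \<in> I" for i j
    unfolding eigenbasisD(5)[OF E ij] eigenbasisD(4)[OF E ij, symmetric]
    by (simp add: sum_distrib_left sum.distrib algebra_simps)
  thus ?thesis unfolding eigenbasis_def using eigenbasisD[OF E] by blast
qed

text \<open>The entries of \<open>2 Re Tr P Y^* - Tr Y^* Q Y - t Tr Y^* Y P\<close> written out.
  \<open>P\<close> and \<open>Q\<close> occur linearly, each against an expression in
  \<open>Y\<close> alone.\<close>

definition var_form :: "'i set \<Rightarrow> ('i \<Rightarrow> 'i \<Rightarrow> complex) \<Rightarrow> ('i \<Rightarrow> 'i \<Rightarrow> complex) \<Rightarrow> ('i \<Rightarrow> 'i \<Rightarrow> complex) \<Rightarrow> real \<Rightarrow> real" where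
  "var_form I P Q Y t = 2 * Re (\<Sum>i\<in>I. \<Sum>j\<in>I. P i j * cnj (Y i j))
     - Re (\<Sum>m\<in>I. \<Sum>i\<in>I. \<Sum>j\<in>I. cnj (Y i m) * Q i j * Y j m)
     - t * Re (\<Sum>i\<in>I. \<Sum>m\<in>I. \<Sum>j\<in>I. cnj (Y i m) * P j m * Y i j)"

text \<open>The three parts of the form are computed in the mixed coordinates
  \<open><phi l, Y psi k>\<close>: the right index of \<open>Y\<close> is expanded in the eigenbasis
  of \<open>P\<close>, the left one in that of \<open>Q\<close>.\<close>

lemma var_form_linear_part:
  assumes P: "eigenbasis I P K \<psi> p" and Q: "eigenbasis I Q L \<phi> q"
  shows "(\<Sum>i\<in>I. \<Sum>j\<in>I. P i j * cnj (Y i j))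
    = (\<Sum>k\<in>K. \<Sum>l\<in>L. of_real (p k) * (cnj (inner_on I (\<phi> l) (apply_op I Y (\<psi> k))) * inner_on I (\<phi> l) (\<psi> k)))"
proof -
  have "(\<Sum>i\<in>I. \<Sum>j\<in>I. P i j * cnj (Y i j))
      = (\<Sum>i\<in>I. \<Sum>j\<in>I. \<Sum>k\<in>K. of_real (p k) * (cnj (Y i j * \<psi> k j) * \<psi> k i))"
    by (intro sum.cong refl) (simp add: eigenbasisD(5)[OF P] sum_distrib_left sum_distrib_right mult_ac)
  also have "\<dots> = (\<Sum>i\<in>I. \<Sum>k\<in>K. \<Sum>j\<in>I. of_real (p k) * (cnj (Y i j * \<psi> k j) * \<psi> k i))"
    by (rule sum.cong[OF refl], rule sum.swap)
  also have "\<dots> = (\<Sum>k\<in>K. \<Sum>i\<in>I. \<Sum>j\<in>I. of_real (p k) * (cnj (Y i j * \<psi> k j) * \<psi> k i))"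
    by (rule sum.swap)
  also have "\<dots> = (\<Sum>k\<in>K. of_real (p k) * inner_on I (apply_op I Y (\<psi> k)) (\<psi> k))"
    by (simp add: inner_on_def apply_op_def sum_distrib_left sum_distrib_right mult_ac)
  also have "\<dots> = (\<Sum>k\<in>K. \<Sum>l\<in>L. of_real (p k) * (cnj (inner_on I (\<phi> l) (apply_op I Y (\<psi> k))) * inner_on I (\<phi> l) (\<psi> k)))"
    by (simp add: cnj_inner_on parseval[OF Q, of "apply_op I Y (\<psi> _)" "\<psi> _"] sum_distrib_left)
  finally show ?thesis .
qed

lemma var_form_left_part:
  assumes P: "eigenbasis I P K \<psi> p" and Q: "eigenbasis I Q L \<phi> q"
  shows "(\<Sum>m\<in>I. \<Sum>i\<in>I. \<Sum>j\<in>I. cnj (Y i m) * Q i j * Y j m)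
    = of_real (\<Sum>k\<in>K. \<Sum>l\<in>L. q l * (cmod (inner_on I (\<phi> l) (apply_op I Y (\<psi> k))))\<^sup>2)"
proof -
  \<comment> \<open>For fixed \<open>l\<close>, the row vector with entries
    \<open><phi l, Y e_m>\<close> has the same norm in the standard basis as in the basis
    \<open>psi\<close>.\<close>
  have row: "(\<Sum>m\<in>I. (cmod (inner_on I (\<phi> l) (\<lambda>i. Y i m)))\<^sup>2) = (\<Sum>k\<in>K. (cmod (inner_on I (\<phi> l) (apply_op I Y (\<psi> k))))\<^sup>2)" for l
  proof -
    let ?g = "\<lambda>m. cnj (inner_on I (\<phi> l) (\<lambda>i. Y i m))"
    have g: "inner_on I ?g (\<psi> k) = inner_on I (\<phi> l) (apply_op I Y (\<psi> k))" for k
    proof -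
      have "inner_on I ?g (\<psi> k) = (\<Sum>m\<in>I. \<Sum>i\<in>I. cnj (\<phi> l i) * (Y i m * \<psi> k m))"
        by (simp add: inner_on_def sum_distrib_left sum_distrib_right mult_ac)
      also have "\<dots> = (\<Sum>i\<in>I. \<Sum>m\<in>I. cnj (\<phi> l i) * (Y i m * \<psi> k m))" by (rule sum.swap)
      finally show ?thesis by (simp add: inner_on_def apply_op_def sum_distrib_left)
    qed
    have "of_real (\<Sum>m\<in>I. (cmod (inner_on I (\<phi> l) (\<lambda>i. Y i m)))\<^sup>2) = inner_on I ?g ?g"
      by (simp only: inner_on_self complex_mod_cnj)
    also have "\<dots> = of_real (\<Sum>k\<in>K. (cmod (inner_on I (\<psi> k) ?g))\<^sup>2)" by (rule parseval_norm[OF P])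
    also have "(\<Sum>k\<in>K. (cmod (inner_on I (\<psi> k) ?g))\<^sup>2) = (\<Sum>k\<in>K. (cmod (inner_on I (\<phi> l) (apply_op I Y (\<psi> k))))\<^sup>2)"
      by (intro sum.cong refl) (metis g cnj_inner_on complex_mod_cnj)
    finally show ?thesis by (simp only: of_real_eq_iff)
  qed
  have "(\<Sum>m\<in>I. \<Sum>i\<in>I. \<Sum>j\<in>I. cnj (Y i m) * Q i j * Y j m) = (\<Sum>m\<in>I. inner_on I (\<lambda>i. Y i m) (apply_op I Q (\<lambda>i. Y i m)))"
    by (simp add: inner_on_def apply_op_def sum_distrib_left mult.assoc)
  also have "\<dots> = of_real (\<Sum>m\<in>I. \<Sum>l\<in>L. q l * (cmod (inner_on I (\<phi> l) (\<lambda>i. Y i m)))\<^sup>2)"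
    by (simp add: inner_on_apply_op_self_eigenbasis[OF Q])
  also have "(\<Sum>m\<in>I. \<Sum>l\<in>L. q l * (cmod (inner_on I (\<phi> l) (\<lambda>i. Y i m)))\<^sup>2)
      = (\<Sum>l\<in>L. \<Sum>m\<in>I. q l * (cmod (inner_on I (\<phi> l) (\<lambda>i. Y i m)))\<^sup>2)" by (rule sum.swap)
  also have "\<dots> = (\<Sum>l\<in>L. \<Sum>k\<in>K. q l * (cmod (inner_on I (\<phi> l) (apply_op I Y (\<psi> k))))\<^sup>2)"
    by (simp add: sum_distrib_left[symmetric] row)
  also have "\<dots> = (\<Sum>k\<in>K. \<Sum>l\<in>L. q l * (cmod (inner_on I (\<phi> l) (apply_op I Y (\<psi> k))))\<^sup>2)" by (rule sum.swap)
  finally show ?thesis .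
qed

lemma var_form_right_part:
  assumes P: "eigenbasis I P K \<psi> p" and Q: "eigenbasis I Q L \<phi> q"
  shows "(\<Sum>i\<in>I. \<Sum>m\<in>I. \<Sum>j\<in>I. cnj (Y i m) * P j m * Y i j)
    = of_real (\<Sum>k\<in>K. \<Sum>l\<in>L. p k * (cmod (inner_on I (\<phi> l) (apply_op I Y (\<psi> k))))\<^sup>2)"
proof -
  have "(\<Sum>m\<in>I. \<Sum>j\<in>I. cnj (Y i m) * P j m * Y i j) = (\<Sum>k\<in>K. of_real (p k) * (cnj (apply_op I Y (\<psi> k) i) * apply_op I Y (\<psi> k) i))"
    for i
  proof -
    have "(\<Sum>m\<in>I. \<Sum>j\<in>I. cnj (Y i m) * P j m * Y i j)
        = (\<Sum>m\<in>I. \<Sum>j\<in>I. \<Sum>k\<in>K. of_real (p k) * (cnj (Y i m * \<psi> k m) * (Y i j * \<psi> k j)))"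
      by (intro sum.cong refl) (simp add: eigenbasisD(5)[OF P] sum_distrib_left sum_distrib_right mult_ac)
    also have "\<dots> = (\<Sum>m\<in>I. \<Sum>k\<in>K. \<Sum>j\<in>I. of_real (p k) * (cnj (Y i m * \<psi> k m) * (Y i j * \<psi> k j)))"
      by (rule sum.cong[OF refl], rule sum.swap)
    also have "\<dots> = (\<Sum>k\<in>K. \<Sum>m\<in>I. \<Sum>j\<in>I. of_real (p k) * (cnj (Y i m * \<psi> k m) * (Y i j * \<psi> k j)))"
      by (rule sum.swap)
    also have "\<dots> = (\<Sum>k\<in>K. of_real (p k) * (cnj (apply_op I Y (\<psi> k) i) * apply_op I Y (\<psi> k) i))"
      unfolding apply_op_def cnj_sum sum_product by (simp add: sum_distrib_left)
    finally show ?thesis .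
  qed
  hence "(\<Sum>i\<in>I. \<Sum>m\<in>I. \<Sum>j\<in>I. cnj (Y i m) * P j m * Y i j)
      = (\<Sum>i\<in>I. \<Sum>k\<in>K. of_real (p k) * (cnj (apply_op I Y (\<psi> k) i) * apply_op I Y (\<psi> k) i))" by simp
  also have "\<dots> = (\<Sum>k\<in>K. \<Sum>i\<in>I. of_real (p k) * (cnj (apply_op I Y (\<psi> k) i) * apply_op I Y (\<psi> k) i))" by (rule sum.swap)
  also have "\<dots> = (\<Sum>k\<in>K. of_real (p k) * inner_on I (apply_op I Y (\<psi> k)) (apply_op I Y (\<psi> k)))"
    by (simp add: inner_on_def sum_distrib_left)
  also have "\<dots> = of_real (\<Sum>k\<in>K. \<Sum>l\<in>L. p k * (cmod (inner_on I (\<phi> l) (apply_op I Y (\<psi> k))))\<^sup>2)"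
    by (simp add: parseval_norm[OF Q] sum_distrib_left)
  finally show ?thesis .
qed

text \<open>\<open>Q\<close> multiplies the left coordinate by \<open>q l\<close> and
  \<open>P\<close> the right one by \<open>p k\<close>, so in mixed coordinates the form decouples
  into independent quadratic functions of one complex number each.\<close>

lemma var_form_eigenbasis:
  assumes P: "eigenbasis I P K \<psi> p" and Q: "eigenbasis I Q L \<phi> q"
  shows "var_form I P Q Y t = (\<Sum>k\<in>K. \<Sum>l\<in>L.
    2 * p k * Re (cnj (inner_on I (\<phi> l) (apply_op I Y (\<psi> k))) * inner_on I (\<phi> l) (\<psi> k))
      - (q l + t * p k) * (cmod (inner_on I (\<phi> l) (apply_op I Y (\<psi> k))))\<^sup>2)"
  unfolding var_form_def var_form_linear_part[OF P Q] var_form_left_part[OF P Q] var_form_right_part[OF P Q] Re_complex_of_real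
  by (simp add: sum_distrib_left sum.distrib sum_subtractf algebra_simps)

text \<open>This is \<open>|p c - s y|^2 \<ge> 0\<close> divided by \<open>s\<close>; equality holds
  at \<open>y = p c / s\<close>.\<close>

lemma complete_square_le:
  fixes y c :: complex and p s :: real
  assumes "s > 0"
  shows "2 * p * Re (cnj y * c) - s * (cmod y)\<^sup>2 \<le> p\<^sup>2 * (cmod c)\<^sup>2 / s"
proof -
  have "0 \<le> (p * Re c - s * Re y)\<^sup>2 + (p * Im c - s * Im y)\<^sup>2" by simp
  hence "s * (2 * p * Re (cnj y * c) - s * (cmod y)\<^sup>2) \<le> p\<^sup>2 * (cmod c)\<^sup>2"
    unfolding cmod_power2 by (simp add: power2_eq_square algebra_simps)
  thus ?thesis using assms by (simp add: field_simps)
qed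

lemma var_form_le:
  assumes P: "eigenbasis I P K \<psi> p" and Q: "eigenbasis I Q L \<phi> q"
    and p: "\<And>k. k \<in> K \<Longrightarrow> 0 \<le> p k" and q: "\<And>l. l \<in> L \<Longrightarrow> 0 < q l" and t: "0 \<le> t"
  shows "var_form I P Q Y t \<le> (\<Sum>k\<in>K. \<Sum>l\<in>L. (p k)\<^sup>2 * (cmod (inner_on I (\<phi> l) (\<psi> k)))\<^sup>2 / (q l + t * p k))"
  unfolding var_form_eigenbasis[OF P Q]
  by (intro sum_mono complete_square_le add_pos_nonneg mult_nonneg_nonneg p q t)

lemma var_form_attained:
  assumes P: "eigenbasis I P K \<psi> p" and Q: "eigenbasis I Q L \<phi> q"
    and p: "\<And>k. k \<in> K \<Longrightarrow> 0 \<le> p k" and q: "\<And>l. l \<in> L \<Longrightarrow> 0 < q l" and t: "0 \<le> t"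
  obtains Y where "var_form I P Q Y t = (\<Sum>k\<in>K. \<Sum>l\<in>L. (p k)\<^sup>2 * (cmod (inner_on I (\<phi> l) (\<psi> k)))\<^sup>2 / (q l + t * p k))"
proof -
  \<comment> \<open>\<open>z l k\<close> is the vertex \<open>p c / s\<close> of each quadratic,
    with \<open>s = q l + t p k\<close>. As the coordinates are independent, all of them can be
    prescribed at once by assembling \<open>Y\<close> from them.\<close>
  define z where "z l k = of_real (p k / (q l + t * p k)) * inner_on I (\<phi> l) (\<psi> k)" for l k
  define Y where "Y i j = (\<Sum>l'\<in>L. \<Sum>k'\<in>K. z l' k' * \<phi> l' i * cnj (\<psi> k' j))" for i j
  have y: "inner_on I (\<phi> l) (apply_op I Y (\<psi> k)) = z l k" if l: "l \<in> L" and k: "k \<in> K" for l k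
  proof -
    have ex: "apply_op I Y (\<psi> k) i = (\<Sum>l'\<in>L. z l' k * \<phi> l' i)" for i
    proof -
      have "apply_op I Y (\<psi> k) i = (\<Sum>j\<in>I. \<Sum>l'\<in>L. \<Sum>k'\<in>K. z l' k' * \<phi> l' i * (cnj (\<psi> k' j) * \<psi> k j))"
        by (simp add: apply_op_def Y_def sum_distrib_left sum_distrib_right mult_ac)
      also have "\<dots> = (\<Sum>l'\<in>L. \<Sum>j\<in>I. \<Sum>k'\<in>K. z l' k' * \<phi> l' i * (cnj (\<psi> k' j) * \<psi> k j))" by (rule sum.swap)
      also have "\<dots> = (\<Sum>l'\<in>L. \<Sum>k'\<in>K. \<Sum>j\<in>I. z l' k' * \<phi> l' i * (cnj (\<psi> k' j) * \<psi> k j))"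
        by (rule sum.cong[OF refl], rule sum.swap)
      also have "\<dots> = (\<Sum>l'\<in>L. \<Sum>k'\<in>K. z l' k' * \<phi> l' i * inner_on I (\<psi> k') (\<psi> k))"
        by (simp add: inner_on_def sum_distrib_left)
      also have "\<dots> = (\<Sum>l'\<in>L. \<Sum>k'\<in>K. if k' = k then z l' k * \<phi> l' i else 0)"
      proof (intro sum.cong refl)
        fix l' k' assume "k' \<in> K"
        thus "z l' k' * \<phi> l' i * inner_on I (\<psi> k') (\<psi> k) = (if k' = k then z l' k * \<phi> l' i else 0)"
          using eigenbasisD(3)[OF P _ k, of k'] by simp
      qed
      finally show ?thesis using k eigenbasisD(2)[OF P] by simp
    qed
    have "inner_on I (\<phi> l) (apply_op I Y (\<psi> k)) = (\<Sum>l'\<in>L. z l' k * inner_on I (\<phi> l) (\<phi> l'))"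
      unfolding ex by (simp only: inner_on_sum_right inner_on_scale_right)
    also have "\<dots> = (\<Sum>l'\<in>L. if l' = l then z l k else 0)"
      by (intro sum.cong refl) (auto simp: eigenbasisD(3)[OF Q l])
    finally show ?thesis using l eigenbasisD(2)[OF Q] by simp
  qed
  have opt: "2 * p k * Re (cnj (z l k) * inner_on I (\<phi> l) (\<psi> k)) - (q l + t * p k) * (cmod (z l k))\<^sup>2
      = (p k)\<^sup>2 * (cmod (inner_on I (\<phi> l) (\<psi> k)))\<^sup>2 / (q l + t * p k)" if l: "l \<in> L" and k: "k \<in> K" for l k
  proof -
    define s where "s = q l + t * p k"
    have s: "s > 0" using p[OF k] q[OF l] t by (simp add: s_def add_pos_nonneg)
    define c where "c = inner_on I (\<phi> l) (\<psi> k)"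
    have z: "z l k = of_real (p k / s) * c" by (simp add: z_def s_def c_def)
    have 0: "Re (cnj (z l k) * c) = p k / s * (cmod c)\<^sup>2"
      unfolding z cmod_power2 by (simp add: power2_eq_square algebra_simps add_divide_distrib)
    have "(cmod (z l k))\<^sup>2 = (p k / s)\<^sup>2 * (cmod c)\<^sup>2"
      unfolding z norm_mult norm_of_real power_mult_distrib power2_abs ..
    note 1 = this
    have "s * (p k / s)\<^sup>2 = (p k)\<^sup>2 / s" using s by (simp add: power2_eq_square)
    hence 2: "s * ((p k / s)\<^sup>2 * (cmod c)\<^sup>2) = (p k)\<^sup>2 * (cmod c)\<^sup>2 / s" by (simp add: mult.assoc[symmetric])
    have 3: "2 * p k * (p k / s * (cmod c)\<^sup>2) = 2 * ((p k)\<^sup>2 * (cmod c)\<^sup>2 / s)"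
      by (simp add: power2_eq_square)
    have "2 * p k * Re (cnj (z l k) * c) - s * (cmod (z l k))\<^sup>2 = (p k)\<^sup>2 * (cmod c)\<^sup>2 / s"
      unfolding 0 1 2 3 by simp
    thus ?thesis by (simp only: s_def c_def)
  qed
  have "var_form I P Q Y t = (\<Sum>k\<in>K. \<Sum>l\<in>L. (p k)\<^sup>2 * (cmod (inner_on I (\<phi> l) (\<psi> k)))\<^sup>2 / (q l + t * p k))"
    unfolding var_form_eigenbasis[OF P Q] by (intro sum.cong refl) (simp only: y opt)
  thus ?thesis by (rule that)
qed

section \<open>Monotonicity of relative entropy\<close>

text \<open>The boundary value at infinity: \<open>p ln (q + t p)\<close> is an antiderivative of
  \<open>p^2 / (q + t p)\<close> and grows like \<open>p ln T\<close>. After that growth is removed,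
  \<open>(q + T p) / T\<close> tends to \<open>p\<close>. For \<open>p = 0\<close> all terms
  vanish.\<close>

lemma log_integrand_tendsto:
  fixes p q :: real
  assumes p: "0 \<le> p" and q: "0 < q"
  shows "((\<lambda>T. p * (ln (q + T * p) - ln q - ln T)) \<longlongrightarrow> p * (ln p - ln q)) at_top"
proof (cases "p = 0")
  case False
  with p have p: "p > 0" by simp
  have "((\<lambda>T. q / T) \<longlongrightarrow> 0) at_top"
    by (rule tendsto_divide_0[OF tendsto_const filterlim_at_top_imp_at_infinity[OF filterlim_ident]])
  hence "((\<lambda>T. p + q / T) \<longlongrightarrow> p + 0) at_top" by (intro tendsto_intros)
  hence "((\<lambda>T. p * (ln (p + q / T) - ln q)) \<longlongrightarrow> p * (ln p - ln q)) at_top"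
    using p by (intro tendsto_intros) auto
  moreover have "eventually (\<lambda>T. p * (ln (p + q / T) - ln q) = p * (ln (q + T * p) - ln q - ln T)) at_top"
    using eventually_gt_at_top[of 0]
  proof eventually_elim
    case (elim T)
    have "ln (p + q / T) = ln ((q + T * p) / T)" using elim by (simp add: field_simps)
    also have "\<dots> = ln (q + T * p) - ln T"
    proof -
      have "0 < q + T * p" using elim p q by (simp add: add_pos_pos)
      thus ?thesis using elim by (subst ln_div) auto
    qed
    finally show ?case by simp
  qed
  ultimately show ?thesis by (rule Lim_transform_eventually)
qed simp

lemma sum_overlaps_right:
  assumes P: "eigenbasis I P K \<psi> p" and Q: "eigenbasis I Q L \<phi> q" and k: "k \<in> K"
  shows "(\<Sum>l\<in>L. (cmod (inner_on I (\<phi> l) (\<psi> k)))\<^sup>2) = 1"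
proof -
  have "of_real (\<Sum>l\<in>L. (cmod (inner_on I (\<phi> l) (\<psi> k)))\<^sup>2) = inner_on I (\<psi> k) (\<psi> k)"
    by (rule parseval_norm[OF Q, symmetric])
  thus ?thesis by (simp add: eigenbasisD(3)[OF P k k] del: of_real_sum)
qed

text \<open>Since \<open>p * (ln p - ln q)\<close> is the integral of \<open>p\<^sup>2 / (q + t * p) - p / (1 + t)\<close> over \<open>t \<ge> 0\<close>
  and the second terms cancel between operators of equal trace, the two sides are compared through
  the antiderivatives \<open>G\<close> and \<open>G1\<close> of the suprema \<open>F\<close> and \<open>F1\<close> of the variational forms.\<close>

lemma relative_entropy_mono_dilation:
  assumes P: "eigenbasis I P K \<psi> p" and Q: "eigenbasis I Q L \<phi> q"
    and p: "\<And>k. k \<in> K \<Longrightarrow> 0 \<le> p k" and q: "\<And>l. l \<in> L \<Longrightarrow> 0 < q l"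
    and P1: "eigenbasis I1 P1 K1 \<psi>1 p1" and Q1: "eigenbasis I1 Q1 L1 \<phi>1 q1"
    and p1: "\<And>k. k \<in> K1 \<Longrightarrow> 0 \<le> p1 k" and q1: "\<And>l. l \<in> L1 \<Longrightarrow> 0 < q1 l"
    and dil: "\<And>Y1. \<exists>Y. \<forall>t. var_form I P Q Y t = var_form I1 P1 Q1 Y1 t"
    and trace_on: "(\<Sum>k\<in>K. p k) = (\<Sum>k\<in>K1. p1 k)"
  shows "(\<Sum>k\<in>K1. \<Sum>l\<in>L1. (cmod (inner_on I1 (\<phi>1 l) (\<psi>1 k)))\<^sup>2 * (p1 k * (ln (p1 k) - ln (q1 l))))
    \<le> (\<Sum>k\<in>K. \<Sum>l\<in>L. (cmod (inner_on I (\<phi> l) (\<psi> k)))\<^sup>2 * (p k * (ln (p k) - ln (q l))))"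
proof -
  define c where "c k l = (cmod (inner_on I (\<phi> l) (\<psi> k)))\<^sup>2" for k l
  define c1 where "c1 k l = (cmod (inner_on I1 (\<phi>1 l) (\<psi>1 k)))\<^sup>2" for k l
  define F where "F t = (\<Sum>k\<in>K. \<Sum>l\<in>L. (p k)\<^sup>2 * c k l / (q l + t * p k))" for t
  define F1 where "F1 t = (\<Sum>k\<in>K1. \<Sum>l\<in>L1. (p1 k)\<^sup>2 * c1 k l / (q1 l + t * p1 k))" for t
  define G where "G t = (\<Sum>k\<in>K. \<Sum>l\<in>L. c k l * (p k * (ln (q l + t * p k) - ln (q l))))" for t
  define G1 where "G1 t = (\<Sum>k\<in>K1. \<Sum>l\<in>L1. c1 k l * (p1 k * (ln (q1 l + t * p1 k) - ln (q1 l))))" for t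
  \<comment> \<open>The optimal \<open>Y1\<close> for the small system lifts to some
    \<open>Y\<close> with the same value, which the supremum \<open>F t\<close> dominates.\<close>
  have F_le: "F1 t \<le> F t" if "t \<ge> 0" for t
  proof -
    obtain Y1 where "var_form I1 P1 Q1 Y1 t = F1 t"
      using var_form_attained[OF P1 Q1 p1 q1 \<open>t \<ge> 0\<close>] unfolding F1_def c1_def by blast
    moreover obtain Y where "var_form I P Q Y t = var_form I1 P1 Q1 Y1 t" using dil by blast
    moreover have "var_form I P Q Y t \<le> F t" unfolding F_def c_def by (rule var_form_le[OF P Q p q that])
    ultimately show ?thesis by simp
  qed
  have dterm: "((\<lambda>t. a * (b * (ln (s + t * b) - ln s))) has_real_derivative b\<^sup>2 * a / (s + t * b)) (at t)"
    if "b \<ge> 0" "s > 0" "t \<ge> 0" for a b s t :: real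
  proof -
    have "s + t * b > 0" using that by (simp add: add_pos_nonneg)
    thus ?thesis by (auto intro!: derivative_eq_intros simp: power2_eq_square)
  qed
  have dG: "(G has_real_derivative F t) (at t)" if "t \<ge> 0" for t
    unfolding G_def F_def by (intro DERIV_sum dterm p q that)
  have dG1: "(G1 has_real_derivative F1 t) (at t)" if "t \<ge> 0" for t
    unfolding G1_def F1_def by (intro DERIV_sum dterm p1 q1 that)
  \<comment> \<open>Both antiderivatives vanish at 0, and the difference \<open>G - G1\<close> has
    the nonnegative derivative \<open>F - F1\<close>.\<close>
  have G_le: "G1 T \<le> G T" if T: "T \<ge> 0" for T
  proof -
    have "G 0 - G1 0 \<le> G T - G1 T"
    proof (rule DERIV_nonneg_imp_nondecreasing[OF T])
      fix t :: real assume "0 \<le> t"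
      hence "((\<lambda>t. G t - G1 t) has_real_derivative F t - F1 t) (at t)" by (intro DERIV_diff dG dG1)
      thus "\<exists>y. ((\<lambda>t. G t - G1 t) has_real_derivative y) (at t) \<and> 0 \<le> y" using F_le[OF \<open>0 \<le> t\<close>] by auto
    qed
    thus ?thesis by (simp add: G_def G1_def)
  qed
  have n: "(\<Sum>l\<in>L. c k l) = 1" if "k \<in> K" for k unfolding c_def by (rule sum_overlaps_right[OF P Q that])
  have n1: "(\<Sum>l\<in>L1. c1 k l) = 1" if "k \<in> K1" for k unfolding c1_def by (rule sum_overlaps_right[OF P1 Q1 that])
  \<comment> \<open>For each \<open>k\<close> the overlaps sum to one over \<open>L\<close>, so the
    counterterm with \<open>ln T\<close> can be spread over the double sum, where it makes every
    single summand converge.\<close>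
  have "G T - (\<Sum>k\<in>K. p k) * ln T = (\<Sum>k\<in>K. \<Sum>l\<in>L. c k l * (p k * (ln (q l + T * p k) - ln (q l) - ln T)))" for T
  proof -
    have "(\<Sum>k\<in>K. p k) * ln T = (\<Sum>k\<in>K. \<Sum>l\<in>L. c k l * (p k * ln T))"
      by (simp add: sum_distrib_right[symmetric] n)
    thus ?thesis by (simp add: G_def sum_subtractf[symmetric] right_diff_distrib)
  qed
  moreover have "((\<lambda>T. \<Sum>k\<in>K. \<Sum>l\<in>L. c k l * (p k * (ln (q l + T * p k) - ln (q l) - ln T)))
      \<longlongrightarrow> (\<Sum>k\<in>K. \<Sum>l\<in>L. c k l * (p k * (ln (p k) - ln (q l))))) at_top"
    by (intro tendsto_sum tendsto_mult_left log_integrand_tendsto p q)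
  ultimately have lim: "((\<lambda>T. G T - (\<Sum>k\<in>K. p k) * ln T)
      \<longlongrightarrow> (\<Sum>k\<in>K. \<Sum>l\<in>L. c k l * (p k * (ln (p k) - ln (q l))))) at_top" by simp
  have "G1 T - (\<Sum>k\<in>K1. p1 k) * ln T = (\<Sum>k\<in>K1. \<Sum>l\<in>L1. c1 k l * (p1 k * (ln (q1 l + T * p1 k) - ln (q1 l) - ln T)))" for T
  proof -
    have "(\<Sum>k\<in>K1. p1 k) * ln T = (\<Sum>k\<in>K1. \<Sum>l\<in>L1. c1 k l * (p1 k * ln T))"
      by (simp add: sum_distrib_right[symmetric] n1)
    thus ?thesis by (simp add: G1_def sum_subtractf[symmetric] right_diff_distrib)
  qed
  moreover have "((\<lambda>T. \<Sum>k\<in>K1. \<Sum>l\<in>L1. c1 k l * (p1 k * (ln (q1 l + T * p1 k) - ln (q1 l) - ln T)))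
      \<longlongrightarrow> (\<Sum>k\<in>K1. \<Sum>l\<in>L1. c1 k l * (p1 k * (ln (p1 k) - ln (q1 l))))) at_top"
    by (intro tendsto_sum tendsto_mult_left log_integrand_tendsto p1 q1)
  ultimately have lim1: "((\<lambda>T. G1 T - (\<Sum>k\<in>K1. p1 k) * ln T)
      \<longlongrightarrow> (\<Sum>k\<in>K1. \<Sum>l\<in>L1. c1 k l * (p1 k * (ln (p1 k) - ln (q1 l))))) at_top" by simp
  \<comment> \<open>Equality of the traces enters here: the same multiple of \<open>ln T\<close> is
    subtracted on both sides.\<close>
  have "eventually (\<lambda>T. G1 T - (\<Sum>k\<in>K1. p1 k) * ln T \<le> G T - (\<Sum>k\<in>K. p k) * ln T) at_top"
    using eventually_ge_at_top[of 0] by eventually_elim (simp add: G_le trace_on)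
  from tendsto_le[OF _ lim lim1 this] show ?thesis by (simp add: c_def c1_def)
qed

text \<open>The double sum over overlaps is \<open>Tr P ln P - Tr P ln Q\<close>; the second trace
  is read off from the diagonal of \<open>P\<close> in the eigenbasis of \<open>Q\<close>.\<close>

lemma relative_entropy_eigenbasis:
  assumes P: "eigenbasis I P K \<psi> p" and Q: "eigenbasis I Q L \<phi> q"
  shows "(\<Sum>k\<in>K. \<Sum>l\<in>L. (cmod (inner_on I (\<phi> l) (\<psi> k)))\<^sup>2 * (p k * (ln (p k) - ln (q l))))
    = (\<Sum>k\<in>K. p k * ln (p k)) - (\<Sum>l\<in>L. ln (q l) * Re (inner_on I (\<phi> l) (apply_op I P (\<phi> l))))"
proof -
  define c where "c k l = (cmod (inner_on I (\<phi> l) (\<psi> k)))\<^sup>2" for k l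
  have n: "(\<Sum>l\<in>L. c k l) = 1" if "k \<in> K" for k unfolding c_def by (rule sum_overlaps_right[OF P Q that])
  have "(\<Sum>k\<in>K. \<Sum>l\<in>L. c k l * (p k * (ln (p k) - ln (q l))))
     = (\<Sum>k\<in>K. \<Sum>l\<in>L. c k l * (p k * ln (p k))) - (\<Sum>k\<in>K. \<Sum>l\<in>L. c k l * (p k * ln (q l)))"
    by (simp add: sum_subtractf[symmetric] right_diff_distrib)
  also have "(\<Sum>k\<in>K. \<Sum>l\<in>L. c k l * (p k * ln (p k))) = (\<Sum>k\<in>K. p k * ln (p k))"
    by (simp add: sum_distrib_right[symmetric] n)
  also have "(\<Sum>k\<in>K. \<Sum>l\<in>L. c k l * (p k * ln (q l))) = (\<Sum>l\<in>L. \<Sum>k\<in>K. c k l * (p k * ln (q l)))"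
    by (rule sum.swap)
  also have "\<dots> = (\<Sum>l\<in>L. ln (q l) * Re (inner_on I (\<phi> l) (apply_op I P (\<phi> l))))"
  proof (rule sum.cong[OF refl])
    fix l
    have "(cmod (inner_on I (\<psi> k) (\<phi> l)))\<^sup>2 = c k l" for k
      unfolding c_def by (metis cnj_inner_on complex_mod_cnj)
    thus "(\<Sum>k\<in>K. c k l * (p k * ln (q l))) = ln (q l) * Re (inner_on I (\<phi> l) (apply_op I P (\<phi> l)))"
      by (simp add: inner_on_apply_op_self_eigenbasis[OF P] sum_distrib_left mult_ac del: of_real_sum)
  qed
  finally show ?thesis by (simp add: c_def)
qed

text \<open>For \<open>Y = Y1 tensor 1\<close> the operators \<open>Y^*\<close>,
  \<open>Y Y^*\<close> and \<open>Y^* Y\<close> are all of the form \<open>Z tensor 1\<close>, and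
  the trace of such an operator against \<open>P\<close> or \<open>Q\<close> depends only on the
  partial trace over \<open>B\<close>.\<close>

lemma var_form_dilate:
  assumes fin: "finite X" "finite B"
    and P1: "\<And>x y. x \<in> X \<Longrightarrow> y \<in> X \<Longrightarrow> P1 x y = (\<Sum>b\<in>B. P (x, b) (y, b))"
    and Q1: "\<And>x y. x \<in> X \<Longrightarrow> y \<in> X \<Longrightarrow> Q1 x y = (\<Sum>b\<in>B. Q (x, b) (y, b))"
  shows "var_form (X \<times> B) P Q (\<lambda>x y. Y1 (fst x) (fst y) * of_bool (snd x = snd y)) t = var_form X P1 Q1 Y1 t"
proof -
  let ?Y = "\<lambda>x y. Y1 (fst x) (fst y) * of_bool (snd x = snd y)"
  have prod: "(\<Sum>z\<in>X \<times> B. f z) = (\<Sum>x\<in>X. \<Sum>b\<in>B. f (x, b))" for f :: "_ \<Rightarrow> complex"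
    by (simp add: sum.cartesian_product)
  have cb: "cnj (of_bool a) = of_bool a" for a by (cases a) auto
  have d: "(\<Sum>b'\<in>B. of_bool (b = b') * f b') = f b" "(\<Sum>b'\<in>B. of_bool (b' = b) * f b') = f b"
    if "b \<in> B" for b and f :: "_ \<Rightarrow> complex"
    using that fin(2) by (simp_all add: of_bool_def if_distrib[where f="\<lambda>x. x * _"] cong: if_cong)
  have l: "(\<Sum>i\<in>X \<times> B. \<Sum>j\<in>X \<times> B. P i j * cnj (?Y i j)) = (\<Sum>x\<in>X. \<Sum>y\<in>X. P1 x y * cnj (Y1 x y))"
  proof -
    have "(\<Sum>i\<in>X \<times> B. \<Sum>j\<in>X \<times> B. P i j * cnj (?Y i j))
        = (\<Sum>x\<in>X. \<Sum>b\<in>B. \<Sum>y\<in>X. \<Sum>b'\<in>B. of_bool (b = b') * (P (x, b) (y, b') * cnj (Y1 x y)))"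
      by (simp add: prod cb mult_ac)
    also have "\<dots> = (\<Sum>x\<in>X. \<Sum>b\<in>B. \<Sum>y\<in>X. P (x, b) (y, b) * cnj (Y1 x y))"
      by (intro sum.cong refl d(1))
    also have "\<dots> = (\<Sum>x\<in>X. \<Sum>y\<in>X. \<Sum>b\<in>B. P (x, b) (y, b) * cnj (Y1 x y))"
      by (rule sum.cong[OF refl], rule sum.swap)
    also have "\<dots> = (\<Sum>x\<in>X. \<Sum>y\<in>X. P1 x y * cnj (Y1 x y))" by (simp add: P1 sum_distrib_right)
    finally show ?thesis .
  qed
  have q: "(\<Sum>m\<in>X \<times> B. \<Sum>i\<in>X \<times> B. \<Sum>j\<in>X \<times> B. cnj (?Y i m) * Q i j * ?Y j m)
      = (\<Sum>m\<in>X. \<Sum>x\<in>X. \<Sum>y\<in>X. cnj (Y1 x m) * Q1 x y * Y1 y m)"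
  proof -
    have "(\<Sum>m\<in>X \<times> B. \<Sum>i\<in>X \<times> B. \<Sum>j\<in>X \<times> B. cnj (?Y i m) * Q i j * ?Y j m)
        = (\<Sum>m\<in>X. \<Sum>c\<in>B. \<Sum>x\<in>X. \<Sum>b\<in>B. of_bool (b = c) *
             (\<Sum>y\<in>X. \<Sum>b'\<in>B. of_bool (b' = c) * (cnj (Y1 x m) * Q (x, b) (y, b') * Y1 y m)))"
      by (simp add: prod cb sum_distrib_left mult_ac)
    also have "\<dots> = (\<Sum>m\<in>X. \<Sum>c\<in>B. \<Sum>x\<in>X. \<Sum>y\<in>X. \<Sum>b'\<in>B. of_bool (b' = c) * (cnj (Y1 x m) * Q (x, c) (y, b') * Y1 y m))"
      by (intro sum.cong refl d(2))
    also have "\<dots> = (\<Sum>m\<in>X. \<Sum>c\<in>B. \<Sum>x\<in>X. \<Sum>y\<in>X. cnj (Y1 x m) * Q (x, c) (y, c) * Y1 y m)"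
      by (intro sum.cong refl d(2))
    also have "\<dots> = (\<Sum>m\<in>X. \<Sum>x\<in>X. \<Sum>c\<in>B. \<Sum>y\<in>X. cnj (Y1 x m) * Q (x, c) (y, c) * Y1 y m)"
      by (rule sum.cong[OF refl], rule sum.swap)
    also have "\<dots> = (\<Sum>m\<in>X. \<Sum>x\<in>X. \<Sum>y\<in>X. \<Sum>c\<in>B. cnj (Y1 x m) * Q (x, c) (y, c) * Y1 y m)"
      by (rule sum.cong[OF refl], rule sum.cong[OF refl], rule sum.swap)
    also have "\<dots> = (\<Sum>m\<in>X. \<Sum>x\<in>X. \<Sum>y\<in>X. cnj (Y1 x m) * Q1 x y * Y1 y m)"
      by (simp add: Q1 sum_distrib_left sum_distrib_right)
    finally show ?thesis .
  qed
  have r: "(\<Sum>i\<in>X \<times> B. \<Sum>m\<in>X \<times> B. \<Sum>j\<in>X \<times> B. cnj (?Y i m) * P j m * ?Y i j)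
      = (\<Sum>x\<in>X. \<Sum>m\<in>X. \<Sum>y\<in>X. cnj (Y1 x m) * P1 y m * Y1 x y)"
  proof -
    have "(\<Sum>i\<in>X \<times> B. \<Sum>m\<in>X \<times> B. \<Sum>j\<in>X \<times> B. cnj (?Y i m) * P j m * ?Y i j)
        = (\<Sum>x\<in>X. \<Sum>b\<in>B. \<Sum>m\<in>X. \<Sum>c\<in>B. of_bool (b = c) *
             (\<Sum>y\<in>X. \<Sum>b'\<in>B. of_bool (b = b') * (cnj (Y1 x m) * P (y, b') (m, c) * Y1 x y)))"
      by (simp add: prod cb sum_distrib_left mult_ac)
    also have "\<dots> = (\<Sum>x\<in>X. \<Sum>b\<in>B. \<Sum>m\<in>X. \<Sum>y\<in>X. \<Sum>b'\<in>B. of_bool (b = b') * (cnj (Y1 x m) * P (y, b') (m, b) * Y1 x y))"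
      by (intro sum.cong refl d(1))
    also have "\<dots> = (\<Sum>x\<in>X. \<Sum>b\<in>B. \<Sum>m\<in>X. \<Sum>y\<in>X. cnj (Y1 x m) * P (y, b) (m, b) * Y1 x y)"
      by (intro sum.cong refl d(1))
    also have "\<dots> = (\<Sum>x\<in>X. \<Sum>m\<in>X. \<Sum>b\<in>B. \<Sum>y\<in>X. cnj (Y1 x m) * P (y, b) (m, b) * Y1 x y)"
      by (rule sum.cong[OF refl], rule sum.swap)
    also have "\<dots> = (\<Sum>x\<in>X. \<Sum>m\<in>X. \<Sum>y\<in>X. \<Sum>b\<in>B. cnj (Y1 x m) * P (y, b) (m, b) * Y1 x y)"
      by (rule sum.cong[OF refl], rule sum.cong[OF refl], rule sum.swap)
    also have "\<dots> = (\<Sum>x\<in>X. \<Sum>m\<in>X. \<Sum>y\<in>X. cnj (Y1 x m) * P1 y m * Y1 x y)"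
      by (simp add: P1 sum_distrib_left sum_distrib_right)
    finally show ?thesis .
  qed
  show ?thesis unfolding var_form_def l q r ..
qed

text \<open>The dilation bound with trial operators \<open>Y1 tensor 1\<close>. \<open>Q\<close> is
  any positive definite operator rather than a state, since it will be
  \<open>1 tensor (rho + eps)\<close>.\<close>

lemma relative_entropy_mono:
  assumes P: "eigenbasis (X \<times> B) P K \<psi> p" and Q: "eigenbasis (X \<times> B) Q L \<phi> q"
    and p: "\<And>k. k \<in> K \<Longrightarrow> 0 \<le> p k" and q: "\<And>l. l \<in> L \<Longrightarrow> 0 < q l"
    and P1: "eigenbasis X P1 K1 \<psi>1 p1" and Q1: "eigenbasis X Q1 L1 \<phi>1 q1"
    and p1: "\<And>k. k \<in> K1 \<Longrightarrow> 0 \<le> p1 k" and q1: "\<And>l. l \<in> L1 \<Longrightarrow> 0 < q1 l"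
    and fin: "finite X" "finite B"
    and PP1: "\<And>x y. x \<in> X \<Longrightarrow> y \<in> X \<Longrightarrow> P1 x y = (\<Sum>b\<in>B. P (x, b) (y, b))"
    and QQ1: "\<And>x y. x \<in> X \<Longrightarrow> y \<in> X \<Longrightarrow> Q1 x y = (\<Sum>b\<in>B. Q (x, b) (y, b))"
  shows "(\<Sum>k\<in>K1. p1 k * ln (p1 k)) - (\<Sum>l\<in>L1. ln (q1 l) * Re (inner_on X (\<phi>1 l) (apply_op X P1 (\<phi>1 l))))
    \<le> (\<Sum>k\<in>K. p k * ln (p k)) - (\<Sum>l\<in>L. ln (q l) * Re (inner_on (X \<times> B) (\<phi> l) (apply_op (X \<times> B) P (\<phi> l))))"
  unfolding relative_entropy_eigenbasis[OF P Q, symmetric] relative_entropy_eigenbasis[OF P1 Q1, symmetric]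
proof (rule relative_entropy_mono_dilation[OF P Q p q P1 Q1 p1 q1])
  show "\<exists>Y. \<forall>t. var_form (X \<times> B) P Q Y t = var_form X P1 Q1 Y1 t" for Y1
    using var_form_dilate[of X B P1 P Q1 Q, OF fin PP1 QQ1] by blast
  have "trace_on (X \<times> B) P = trace_on X P1"
    by (simp add: trace_on_def PP1 sum.cartesian_product case_prod_beta)
  thus "(\<Sum>k\<in>K. p k) = (\<Sum>k\<in>K1. p1 k)"
    unfolding trace_on_eigenbasis[OF P] trace_on_eigenbasis[OF P1] of_real_eq_iff .
qed

section \<open>Strong subadditivity\<close>

text \<open>The quadratic form of the partial trace at \<open>v\<close> is the sum over
  \<open>a\<close> of the form of \<open>P\<close> at \<open>e_a tensor v\<close>. The formula is
  kept as a second conclusion because it also evaluates cross entropies.\<close>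

lemma psd_partial_trace_fst:
  assumes fin: "finite A" "finite Z" and P: "psd (A \<times> Z) P"
  shows "psd Z (\<lambda>x y. \<Sum>a\<in>A. P (a, x) (a, y))"
    and "(\<Sum>a\<in>A. inner_on (A \<times> Z) (\<lambda>x. of_bool (a = fst x) * v (snd x))
           (apply_op (A \<times> Z) P (\<lambda>x. of_bool (a = fst x) * v (snd x))))
         = inner_on Z v (apply_op Z (\<lambda>x y. \<Sum>a\<in>A. P (a, x) (a, y)) v)"
proof -
  have prod: "(\<Sum>z\<in>A \<times> Z. f z) = (\<Sum>x\<in>A. \<Sum>b\<in>Z. f (x, b))" for f :: "_ \<Rightarrow> complex"
    by (simp add: sum.cartesian_product)
  have cb: "cnj (of_bool a) = of_bool a" for a by (cases a) auto
  have one: "inner_on (A \<times> Z) (\<lambda>x. of_bool (a = fst x) * v (snd x)) (apply_op (A \<times> Z) P (\<lambda>x. of_bool (a = fst x) * v (snd x)))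
      = (\<Sum>x\<in>Z. \<Sum>y\<in>Z. cnj (v x) * (P (a, x) (a, y) * v y))" if a: "a \<in> A" for a v
  proof -
    have d: "(\<Sum>b\<in>A. of_bool (a = b) * f b) = f a" for f :: "_ \<Rightarrow> complex"
      using a fin(1) by (simp add: of_bool_def if_distrib[where f="\<lambda>x. x * _"] cong: if_cong)
    have "inner_on (A \<times> Z) (\<lambda>x. of_bool (a = fst x) * v (snd x)) (apply_op (A \<times> Z) P (\<lambda>x. of_bool (a = fst x) * v (snd x)))
        = (\<Sum>b\<in>A. of_bool (a = b) * (\<Sum>x\<in>Z. cnj (v x) * (\<Sum>c\<in>A. of_bool (a = c) * (\<Sum>y\<in>Z. P (b, x) (c, y) * v y))))"
      unfolding inner_on_def apply_op_def prod by (simp add: cb sum_distrib_left mult_ac)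
    thus ?thesis unfolding d by (simp add: sum_distrib_left)
  qed
  have all: "(\<Sum>a\<in>A. inner_on (A \<times> Z) (\<lambda>x. of_bool (a = fst x) * v (snd x))
           (apply_op (A \<times> Z) P (\<lambda>x. of_bool (a = fst x) * v (snd x))))
         = inner_on Z v (apply_op Z (\<lambda>x y. \<Sum>a\<in>A. P (a, x) (a, y)) v)" for v
  proof -
    have "(\<Sum>a\<in>A. inner_on (A \<times> Z) (\<lambda>x. of_bool (a = fst x) * v (snd x))
           (apply_op (A \<times> Z) P (\<lambda>x. of_bool (a = fst x) * v (snd x))))
      = (\<Sum>a\<in>A. \<Sum>x\<in>Z. \<Sum>y\<in>Z. cnj (v x) * (P (a, x) (a, y) * v y))"
      by (intro sum.cong refl one)
    also have "\<dots> = (\<Sum>x\<in>Z. \<Sum>a\<in>A. \<Sum>y\<in>Z. cnj (v x) * (P (a, x) (a, y) * v y))" by (rule sum.swap)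
    also have "\<dots> = (\<Sum>x\<in>Z. \<Sum>y\<in>Z. \<Sum>a\<in>A. cnj (v x) * (P (a, x) (a, y) * v y))"
      by (rule sum.cong[OF refl], rule sum.swap)
    also have "\<dots> = inner_on Z v (apply_op Z (\<lambda>x y. \<Sum>a\<in>A. P (a, x) (a, y)) v)"
      by (simp add: inner_on_def apply_op_def sum_distrib_left sum_distrib_right)
    finally show ?thesis .
  qed
  thus "(\<Sum>a\<in>A. inner_on (A \<times> Z) (\<lambda>x. of_bool (a = fst x) * v (snd x))
           (apply_op (A \<times> Z) P (\<lambda>x. of_bool (a = fst x) * v (snd x))))
         = inner_on Z v (apply_op Z (\<lambda>x y. \<Sum>a\<in>A. P (a, x) (a, y)) v)" .
  have "0 \<le> inner_on Z v (apply_op Z (\<lambda>x y. \<Sum>a\<in>A. P (a, x) (a, y)) v)" for v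
    unfolding all[symmetric] using P by (intro sum_nonneg) (simp add: psd_def)
  thus "psd Z (\<lambda>x y. \<Sum>a\<in>A. P (a, x) (a, y))" by (simp add: psd_def)
qed

lemma bij_swap: "bij_betw prod.swap (A \<times> B) (B \<times> A)"
  by (auto simp: bij_betw_def inj_on_def)

lemma psd_partial_trace_snd:
  assumes fin: "finite Z" "finite B" and P: "psd (Z \<times> B) P"
  shows "psd Z (\<lambda>x y. \<Sum>b\<in>B. P (x, b) (y, b))"
  using psd_partial_trace_fst(1)[OF fin(2,1) psd_reindex[OF bij_swap P]] by simp

text \<open>With \<open>rho\<close> the partial trace of \<open>P\<close> over \<open>A\<close>,
  \<open>1 tensor (rho + eps)\<close> has the eigenvectors \<open>e_a tensor v l\<close>. Summing
  over \<open>a\<close> gives \<open>Tr P ln (1 tensor (rho + eps)) = Tr rho ln (rho + eps)\<close>,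
  so the relative entropy to this operator is a difference of entropies up to
  \<open>eps\<close>.\<close>

lemma cross_entropy_id_tensor:
  assumes fin: "finite A" "finite Z" and P: "psd (A \<times> Z) P"
    and R: "eigenbasis Z (\<lambda>x y. \<Sum>a\<in>A. P (a, x) (a, y)) L v \<mu>"
  shows "eigenbasis (A \<times> Z) (\<lambda>x y. of_bool (fst x = fst y) *
           ((\<Sum>a\<in>A. P (a, snd x) (a, snd y)) + of_real \<epsilon> * of_bool (snd x = snd y)))
           (A \<times> L) (\<lambda>k x. of_bool (fst k = fst x) * v (snd k) (snd x)) (\<lambda>k. \<mu> (snd k) + \<epsilon>)"
    and "(\<Sum>k\<in>A \<times> L. ln (\<mu> (snd k) + \<epsilon>) * Re (inner_on (A \<times> Z) (\<lambda>x. of_bool (fst k = fst x) * v (snd k) (snd x))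
           (apply_op (A \<times> Z) P (\<lambda>x. of_bool (fst k = fst x) * v (snd k) (snd x)))))
         = (\<Sum>l\<in>L. \<mu> l * ln (\<mu> l + \<epsilon>))"
proof -
  show "eigenbasis (A \<times> Z) (\<lambda>x y. of_bool (fst x = fst y) *
           ((\<Sum>a\<in>A. P (a, snd x) (a, snd y)) + of_real \<epsilon> * of_bool (snd x = snd y)))
           (A \<times> L) (\<lambda>k x. of_bool (fst k = fst x) * v (snd k) (snd x)) (\<lambda>k. \<mu> (snd k) + \<epsilon>)"
    using eigenbasis_tensor[OF eigenbasis_id[OF fin(1)] eigenbasis_shift[OF R, of \<epsilon>]] by simp
  have "(\<Sum>k\<in>A \<times> L. ln (\<mu> (snd k) + \<epsilon>) * Re (inner_on (A \<times> Z) (\<lambda>x. of_bool (fst k = fst x) * v (snd k) (snd x))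
           (apply_op (A \<times> Z) P (\<lambda>x. of_bool (fst k = fst x) * v (snd k) (snd x)))))
     = (\<Sum>a\<in>A. \<Sum>l\<in>L. ln (\<mu> l + \<epsilon>) * Re (inner_on (A \<times> Z) (\<lambda>x. of_bool (a = fst x) * v l (snd x))
           (apply_op (A \<times> Z) P (\<lambda>x. of_bool (a = fst x) * v l (snd x)))))"
    by (simp add: sum.cartesian_product case_prod_beta)
  also have "\<dots> = (\<Sum>l\<in>L. \<Sum>a\<in>A. ln (\<mu> l + \<epsilon>) * Re (inner_on (A \<times> Z) (\<lambda>x. of_bool (a = fst x) * v l (snd x))
           (apply_op (A \<times> Z) P (\<lambda>x. of_bool (a = fst x) * v l (snd x)))))" by (rule sum.swap)
  also have "\<dots> = (\<Sum>l\<in>L. ln (\<mu> l + \<epsilon>) * Re (inner_on Z (v l) (apply_op Z (\<lambda>x y. \<Sum>a\<in>A. P (a, x) (a, y)) (v l))))"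
    by (simp only: psd_partial_trace_fst(2)[OF fin P, symmetric] Re_sum sum_distrib_left)
  also have "\<dots> = (\<Sum>l\<in>L. \<mu> l * ln (\<mu> l + \<epsilon>))"
    by (intro sum.cong refl) (simp add: inner_on_eigvec_apply_op[OF R] eigenbasisD(3)[OF R])
  finally show "(\<Sum>k\<in>A \<times> L. ln (\<mu> (snd k) + \<epsilon>) * Re (inner_on (A \<times> Z) (\<lambda>x. of_bool (fst k = fst x) * v (snd k) (snd x))
           (apply_op (A \<times> Z) P (\<lambda>x. of_bool (fst k = fst x) * v (snd k) (snd x)))))
         = (\<Sum>l\<in>L. \<mu> l * ln (\<mu> l + \<epsilon>))" .
qed

text \<open>At \<open>x = 0\<close> the product is 0 before the limit, so the divergence of
  \<open>ln (c * \<epsilon>)\<close> does no harm: zero eigenvalues pass through the regularisation.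
  The constant \<open>c\<close> will be 1 for \<open>BE\<close> and \<open>|B|\<close> for
  \<open>E\<close>.\<close>

lemma xlnx_shift_tendsto:
  fixes x c :: real
  assumes "0 \<le> x"
  shows "((\<lambda>\<epsilon>. x * ln (x + c * \<epsilon>)) \<longlongrightarrow> x * ln x) (at_right 0)"
proof (cases "x = 0")
  case False
  have "((\<lambda>\<epsilon>. x + c * \<epsilon>) \<longlongrightarrow> x + c * 0) (at_right 0)" by (intro tendsto_intros)
  thus ?thesis using False assms by (intro tendsto_intros) auto
qed simp

lemma entropy_zero:
  assumes "finite I" "\<And>i j. i \<in> I \<Longrightarrow> j \<in> I \<Longrightarrow> M i j = 0"
  shows "entropy I M = 0"
proof -
  have "eigenbasis I M I (\<lambda>k i. of_bool (k = i)) (\<lambda>_. 0)"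
    unfolding eigenbasis_def using eigenbasisD(1,3,4)[OF eigenbasis_id[OF assms(1)]] assms(2) by simp
  from entropy_eq[OF this] show ?thesis by simp
qed

lemma entropy_empty: "entropy {} M = 0"
  by (rule entropy_zero) auto

text \<open>Relative entropy of \<open>P\<close> to \<open>1_A tensor (PBE + eps)\<close> is
  compared with its image under the trace over \<open>B\<close>, which is that of \<open>PAE\<close>
  to \<open>1_A tensor (PE + |B| eps)\<close>. Letting \<open>eps\<close> tend to 0 leaves the four
  entropies.\<close>

lemma strong_subadditivity:
  fixes P :: "'a \<times> 'b \<times> 'e \<Rightarrow> 'a \<times> 'b \<times> 'e \<Rightarrow> complex"
  assumes fin: "finite A" "finite B" "finite E" and psd: "psd (A \<times> B \<times> E) P"
  defines "PAE \<equiv> \<lambda>x y. \<Sum>b\<in>B. P (fst x, b, snd x) (fst y, b, snd y)"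
  defines "PBE \<equiv> \<lambda>x y. \<Sum>a\<in>A. P (a, x) (a, y)"
  defines "PE \<equiv> \<lambda>x y. \<Sum>a\<in>A. \<Sum>b\<in>B. P (a, b, x) (a, b, y)"
  shows "entropy (A \<times> B \<times> E) P + entropy E PE \<le> entropy (A \<times> E) PAE + entropy (B \<times> E) PBE"
proof (cases "B = {}")
  \<comment> \<open>For empty \<open>B\<close> two index sets are empty and the other two operators
    are empty sums, so all four entropies are 0. The case is split off because the shift
    \<open>|B| eps\<close> must be positive.\<close>
  case True
  show ?thesis using True fin by (simp add: entropy_zero entropy_empty PAE_def PE_def)
next
  case False
  \<comment> \<open>Monotonicity traces out the last factor, so \<open>B\<close> is moved behind
    \<open>A\<close> and \<open>E\<close>.\<close>
  define P' where "P' = (\<lambda>x y :: ('a \<times> 'e) \<times> 'b. P (fst (fst x), snd x, snd (fst x)) (fst (fst y), snd y, snd (fst y)))"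
  define h where "h = (\<lambda>x :: ('a \<times> 'e) \<times> 'b. (fst (fst x), snd x, snd (fst x)))"
  have h: "bij_betw h ((A \<times> E) \<times> B) (A \<times> B \<times> E)"
    by (rule bij_betwI[where g = "\<lambda>x. ((fst x, snd (snd x)), fst (snd x))"]) (auto simp: h_def)
  have P'h: "P' = (\<lambda>x y. P (h x) (h y))" by (simp add: P'_def h_def)
  have psd': "psd ((A \<times> E) \<times> B) P'" unfolding P'h by (rule psd_reindex[OF h psd])
  have PAE': "PAE = (\<lambda>x y. \<Sum>b\<in>B. P' (x, b) (y, b))" by (simp add: PAE_def P'_def)
  have psdAE: "psd (A \<times> E) PAE" unfolding PAE' using psd' fin by (intro psd_partial_trace_snd) auto
  have psdBE: "psd (B \<times> E) PBE" unfolding PBE_def using psd fin by (intro psd_partial_trace_fst) auto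
  have PE': "PE = (\<lambda>x y. \<Sum>a\<in>A. PAE (a, x) (a, y))" by (simp add: PE_def PAE_def)
  have psdE: "psd E PE" unfolding PE' using psdAE fin by (intro psd_partial_trace_fst) auto
  obtain u p where P: "eigenbasis (A \<times> B \<times> E) P {..<card (A \<times> B \<times> E)} u p"
    and p: "\<And>k. k < card (A \<times> B \<times> E) \<Longrightarrow> 0 \<le> p k"
    using psd_spectral[OF _ psd] fin by blast
  obtain u1 p1 where P1: "eigenbasis (A \<times> E) PAE {..<card (A \<times> E)} u1 p1"
    and p1: "\<And>k. k < card (A \<times> E) \<Longrightarrow> 0 \<le> p1 k"
    using psd_spectral[OF _ psdAE] fin by blast
  obtain v l where R: "eigenbasis (B \<times> E) PBE {..<card (B \<times> E)} v l"
    and l: "\<And>k. k < card (B \<times> E) \<Longrightarrow> 0 \<le> l k"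
    using psd_spectral[OF _ psdBE] fin by blast
  obtain v1 l1 where R1: "eigenbasis E PE {..<card E} v1 l1"
    and l1: "\<And>k. k < card E \<Longrightarrow> 0 \<le> l1 k"
    using psd_spectral[OF _ psdE] fin by blast
  have P2: "eigenbasis ((A \<times> E) \<times> B) P' {..<card (A \<times> B \<times> E)} (\<lambda>k x. u k (h x)) p"
    unfolding P'h by (rule eigenbasis_reindex[OF h P])
  have finBE: "finite (B \<times> E)" using fin by simp
  \<comment> \<open>Tracing \<open>eps\<close> times the identity over \<open>B\<close> gives
    \<open>card B\<close> times \<open>eps\<close>; this is the shift that \<open>PE\<close>
    receives.\<close>
  define b where "b = real (card B)"
  have b: "b > 0" using False fin by (simp add: b_def card_gt_0_iff)
  have ineq: "(\<Sum>k<card (A \<times> E). p1 k * ln (p1 k)) - (\<Sum>k<card E. l1 k * ln (l1 k + b * \<epsilon>))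
      \<le> (\<Sum>k<card (A \<times> B \<times> E). p k * ln (p k)) - (\<Sum>k<card (B \<times> E). l k * ln (l k + 1 * \<epsilon>))"
    if \<epsilon>: "\<epsilon> > 0" for \<epsilon> :: real
  proof -
    let ?Q = "\<lambda>x y. of_bool (fst x = fst y) * (PBE (snd x) (snd y) + of_real \<epsilon> * of_bool (snd x = snd y))"
    let ?Q1 = "\<lambda>x y. of_bool (fst x = fst y) * (PE (snd x) (snd y) + of_real (b * \<epsilon>) * of_bool (snd x = snd y))"
    have Q: "eigenbasis (A \<times> B \<times> E) ?Q (A \<times> {..<card (B \<times> E)})
        (\<lambda>k x. of_bool (fst k = fst x) * v (snd k) (snd x)) (\<lambda>k. l (snd k) + \<epsilon>)"
      using cross_entropy_id_tensor(1)[OF fin(1) finBE psd R[unfolded PBE_def], of \<epsilon>] unfolding PBE_def .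
    have Q2: "eigenbasis ((A \<times> E) \<times> B) (\<lambda>x y. ?Q (h x) (h y)) (A \<times> {..<card (B \<times> E)})
        (\<lambda>k x. of_bool (fst k = fst (h x)) * v (snd k) (snd (h x))) (\<lambda>k. l (snd k) + \<epsilon>)"
      by (rule eigenbasis_reindex[OF h Q])
    have Q1: "eigenbasis (A \<times> E) ?Q1 (A \<times> {..<card E})
        (\<lambda>k x. of_bool (fst k = fst x) * v1 (snd k) (snd x)) (\<lambda>k. l1 (snd k) + b * \<epsilon>)"
      using cross_entropy_id_tensor(1)[OF fin(1,3) psdAE R1[unfolded PE'], of "b * \<epsilon>"] unfolding PE' .
    have mono: "(\<Sum>k<card (A \<times> E). p1 k * ln (p1 k)) - (\<Sum>k\<in>A \<times> {..<card E}. ln (l1 (snd k) + b * \<epsilon>) *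
          Re (inner_on (A \<times> E) (\<lambda>x. of_bool (fst k = fst x) * v1 (snd k) (snd x))
            (apply_op (A \<times> E) PAE (\<lambda>x. of_bool (fst k = fst x) * v1 (snd k) (snd x)))))
      \<le> (\<Sum>k<card (A \<times> B \<times> E). p k * ln (p k)) - (\<Sum>k\<in>A \<times> {..<card (B \<times> E)}. ln (l (snd k) + \<epsilon>) *
          Re (inner_on ((A \<times> E) \<times> B) (\<lambda>x. of_bool (fst k = fst (h x)) * v (snd k) (snd (h x)))
            (apply_op ((A \<times> E) \<times> B) P' (\<lambda>x. of_bool (fst k = fst (h x)) * v (snd k) (snd (h x))))))"
    proof (rule relative_entropy_mono[OF P2 Q2 _ _ P1 Q1])
      fix x y :: "'a \<times> 'e"
      show "PAE x y = (\<Sum>b\<in>B. P' (x, b) (y, b))" by (simp add: PAE')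
      have "(\<Sum>c\<in>B. PBE (c, snd x) (c, snd y)) = PE (snd x) (snd y)"
        unfolding PBE_def PE_def by (rule sum.swap)
      thus "?Q1 x y = (\<Sum>b\<in>B. ?Q (h (x, b)) (h (y, b)))"
        by (auto simp: h_def sum.distrib b_def of_bool_def)
    qed (use fin p p1 l l1 \<epsilon> b in \<open>auto intro!: add_nonneg_pos mult_pos_pos\<close>)
    have "inner_on ((A \<times> E) \<times> B) (\<lambda>x. w (h x)) (apply_op ((A \<times> E) \<times> B) P' (\<lambda>x. w (h x)))
       = inner_on (A \<times> B \<times> E) w (apply_op (A \<times> B \<times> E) P w)" for w
      unfolding P'h apply_op_reindex[OF h] by (rule inner_on_reindex[OF h])
    note red = this[of "\<lambda>x. of_bool (fst k = fst x) * v (snd k) (snd x)" for k]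
    show ?thesis
      using mono unfolding red cross_entropy_id_tensor(2)[OF fin(1) finBE psd R[unfolded PBE_def]]
        cross_entropy_id_tensor(2)[OF fin(1,3) psdAE R1[unfolded PE']]
      by simp
  qed
  have "(\<Sum>k<card (A \<times> E). p1 k * ln (p1 k)) - (\<Sum>k<card E. l1 k * ln (l1 k))
      \<le> (\<Sum>k<card (A \<times> B \<times> E). p k * ln (p k)) - (\<Sum>k<card (B \<times> E). l k * ln (l k))"
  proof (rule tendsto_le)
    show "((\<lambda>\<epsilon>. (\<Sum>k<card (A \<times> B \<times> E). p k * ln (p k)) - (\<Sum>k<card (B \<times> E). l k * ln (l k + 1 * \<epsilon>)))
        \<longlongrightarrow> (\<Sum>k<card (A \<times> B \<times> E). p k * ln (p k)) - (\<Sum>k<card (B \<times> E). l k * ln (l k))) (at_right 0)"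
      by (intro tendsto_diff tendsto_const tendsto_sum xlnx_shift_tendsto l) simp
    show "((\<lambda>\<epsilon>. (\<Sum>k<card (A \<times> E). p1 k * ln (p1 k)) - (\<Sum>k<card E. l1 k * ln (l1 k + b * \<epsilon>)))
        \<longlongrightarrow> (\<Sum>k<card (A \<times> E). p1 k * ln (p1 k)) - (\<Sum>k<card E. l1 k * ln (l1 k))) (at_right 0)"
      by (intro tendsto_diff tendsto_const tendsto_sum xlnx_shift_tendsto l1) simp
    show "\<forall>\<^sub>F \<epsilon> in at_right 0. (\<Sum>k<card (A \<times> E). p1 k * ln (p1 k)) - (\<Sum>k<card E. l1 k * ln (l1 k + b * \<epsilon>))
      \<le> (\<Sum>k<card (A \<times> B \<times> E). p k * ln (p k)) - (\<Sum>k<card (B \<times> E). l k * ln (l k + 1 * \<epsilon>))"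
      using eventually_at_right_less[of "0::real"] by eventually_elim (rule ineq)
  qed simp
  \<comment> \<open>Calculus was done with \<open>ln\<close>; division by \<open>ln 2\<close>
    changes to base 2.\<close>
  hence "((\<Sum>k<card (A \<times> E). p1 k * ln (p1 k)) - (\<Sum>k<card E. l1 k * ln (l1 k))) / ln 2
      \<le> ((\<Sum>k<card (A \<times> B \<times> E). p k * ln (p k)) - (\<Sum>k<card (B \<times> E). l k * ln (l k))) / ln 2"
    by (rule divide_right_mono) simp
  thus ?thesis
    unfolding entropy_eq[OF P] entropy_eq[OF P1] entropy_eq[OF R] entropy_eq[OF R1]
    by (simp add: log_def sum_divide_distrib diff_divide_distrib)
qed

section \<open>Extensions and conditional mutual information\<close>

text \<open>Eigenbases travel along \<open>h\<close> in both directions with the same labels and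
  eigenvalues. The two descriptions in \<open>entropy_def\<close> thus have the same instances, so
  the values agree even for operators that have no eigenbasis.\<close>

lemma entropy_bij:
  assumes h: "bij_betw h I' I" and M: "\<And>x y. x \<in> I' \<Longrightarrow> y \<in> I' \<Longrightarrow> M' x y = M (h x) (h y)"
  shows "entropy I' M' = entropy I M"
proof -
  let ?g = "inv_into I' h"
  have g: "bij_betw ?g I I'" using h by (rule bij_betw_inv_into)
  have "(\<exists>u. eigenbasis I' M' K u d) \<longleftrightarrow> (\<exists>u. eigenbasis I M K u d)" for K :: "nat set" and d
  proof
    assume "\<exists>u. eigenbasis I M K u d"
    then obtain u where "eigenbasis I M K u d" by blast
    from eigenbasis_reindex[OF h this] show "\<exists>u. eigenbasis I' M' K u d"
      by (subst eigenbasis_cong[OF M]) auto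
  next
    assume "\<exists>u. eigenbasis I' M' K u d"
    then obtain u where "eigenbasis I' M' K u d" by blast
    note F = eigenbasis_reindex[OF g this]
    have "M' (?g x) (?g y) = M x y" if "x \<in> I" "y \<in> I" for x y
      using M[of "?g x" "?g y"] that bij_betw_inv_into_right[OF h] bij_betwE[OF g] by simp
    hence "eigenbasis I (\<lambda>i j. M' (?g i) (?g j)) K u' d \<longleftrightarrow> eigenbasis I M K u' d" for u'
      by (rule eigenbasis_cong)
    with F show "\<exists>u. eigenbasis I M K u d" by blast
  qed
  thus ?thesis unfolding entropy_def by (metis (no_types, lifting))
qed

text \<open>The bijection \<open>h\<close> is a regrouping that brings the factor to be traced out
  to the front; the various marginals below are reduced to this form.\<close>

lemma psd_partial_trace_bij:
  assumes h: "bij_betw h (C \<times> Z) I" and fin: "finite C" "finite Z" and P: "psd I P"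
  shows "psd Z (\<lambda>x y. \<Sum>c\<in>C. P (h (c, x)) (h (c, y)))"
  using psd_partial_trace_fst(1)[OF fin psd_reindex[OF h P]] .

lemma trace_on_partial_trace_bij:
  assumes h: "bij_betw h (C \<times> Z) I"
  shows "trace_on Z (\<lambda>x y. \<Sum>c\<in>C. P (h (c, x)) (h (c, y))) = trace_on I P"
proof -
  have "trace_on Z (\<lambda>x y. \<Sum>c\<in>C. P (h (c, x)) (h (c, y))) = (\<Sum>c\<in>C. \<Sum>x\<in>Z. P (h (c, x)) (h (c, x)))"
    unfolding trace_on_def by (rule sum.swap)
  also have "\<dots> = trace_on (C \<times> Z) (\<lambda>x y. P (h x) (h y))"
    by (simp add: trace_on_def sum.cartesian_product case_prod_beta)
  finally show ?thesis by (simp add: trace_on_reindex[OF h])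
qed

lemma sum_Times: "(\<Sum>z\<in>A \<times> B. f z) = (\<Sum>x\<in>A. \<Sum>y\<in>B. f (x, y))"
  by (simp add: sum.cartesian_product)

definition cond_info :: "'a set \<Rightarrow> 'b set \<Rightarrow> 'e set \<Rightarrow> ('a \<times> 'b \<times> 'e \<Rightarrow> 'a \<times> 'b \<times> 'e \<Rightarrow> complex) \<Rightarrow> real" where
  "cond_info A B E W =
     entropy (A \<times> E) (\<lambda>x y. \<Sum>b\<in>B. W (fst x, b, snd x) (fst y, b, snd y))
     + entropy (B \<times> E) (\<lambda>x y. \<Sum>a\<in>A. W (a, x) (a, y))
     - entropy (A \<times> B \<times> E) W
     - entropy E (\<lambda>x y. \<Sum>a\<in>A. \<Sum>b\<in>B. W (a, b, x) (a, b, y))"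

lemma cond_info_nonneg:
  assumes "finite A" "finite B" "finite E" "psd (A \<times> B \<times> E) W"
  shows "0 \<le> cond_info A B E W"
  using strong_subadditivity[OF assms] by (simp add: cond_info_def)

definition extension :: "'a set \<Rightarrow> 'b set \<Rightarrow> 'e set \<Rightarrow> ('a \<times> 'b \<Rightarrow> 'a \<times> 'b \<Rightarrow> complex)
    \<Rightarrow> ('a \<times> 'b \<times> 'e \<Rightarrow> 'a \<times> 'b \<times> 'e \<Rightarrow> complex) \<Rightarrow> bool" where
  "extension A B E R W \<longleftrightarrow> finite A \<and> finite B \<and> finite E \<and> psd (A \<times> B \<times> E) W \<and> trace_on (A \<times> B \<times> E) W = 1 \<and>
     (\<forall>x\<in>A \<times> B. \<forall>y\<in>A \<times> B. (\<Sum>e\<in>E. W (fst x, snd x, e) (fst y, snd y, e)) = R x y)"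

text \<open>Extension systems are taken from the finite sets of natural numbers only to make the infimum
  range over a single type.\<close>

definition sqe :: "'a set \<Rightarrow> 'b set \<Rightarrow> ('a \<times> 'b \<Rightarrow> 'a \<times> 'b \<Rightarrow> complex) \<Rightarrow> real" where
  "sqe A B R = Inf {1 / 2 * cond_info A B E W | (E :: nat set) W. extension A B E R W}"

lemma extensionD:
  assumes "extension A B E R W"
  shows "finite A" "finite B" "finite E" "psd (A \<times> B \<times> E) W" "trace_on (A \<times> B \<times> E) W = 1"
    "\<And>x y. x \<in> A \<times> B \<Longrightarrow> y \<in> A \<times> B \<Longrightarrow>
      (\<Sum>e\<in>E. W (fst x, snd x, e) (fst y, snd y, e)) = R x y"
  using assms unfolding extension_def by (simp_all only:)

lemma extension_bij:
  assumes f: "bij_betw f A' A" and g: "bij_betw g B' B" and h: "bij_betw h E' E" and X: "extension A B E R W"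
  shows "extension A' B' E' (\<lambda>x y. R (map_prod f g x) (map_prod f g y))
    (\<lambda>x y. W (map_prod f (map_prod g h) x) (map_prod f (map_prod g h) y))"
proof -
  note m = bij_betw_map_prod[OF f bij_betw_map_prod[OF g h]]
  have fin: "finite A'" "finite B'" "finite E'"
    using X bij_betw_finite[OF f] bij_betw_finite[OF g] bij_betw_finite[OF h] by (simp_all add: extension_def)
  have "(\<Sum>e\<in>E'. W (map_prod f (map_prod g h) (fst x, snd x, e)) (map_prod f (map_prod g h) (fst y, snd y, e)))
    = R (map_prod f g x) (map_prod f g y)" if "x \<in> A' \<times> B'" "y \<in> A' \<times> B'" for x y
  proof -
    have "map_prod f g x \<in> A \<times> B" "map_prod f g y \<in> A \<times> B"
      using that bij_betwE[OF bij_betw_map_prod[OF f g]] by blast+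
    hence "(\<Sum>e\<in>E. W (fst (map_prod f g x), snd (map_prod f g x), e) (fst (map_prod f g y), snd (map_prod f g y), e))
      = R (map_prod f g x) (map_prod f g y)" by (rule extensionD(6)[OF X])
    thus ?thesis using sum.reindex_bij_betw[OF h, of "\<lambda>e. W (f (fst x), g (snd x), e) (f (fst y), g (snd y), e)"]
      by simp
  qed
  thus ?thesis unfolding extension_def using X fin psd_reindex[OF m] trace_on_reindex[OF m] by (simp add: extension_def)
qed

lemma cond_info_bij:
  assumes f: "bij_betw f A' A" and g: "bij_betw g B' B" and h: "bij_betw h E' E"
  shows "cond_info A' B' E' (\<lambda>x y. W (map_prod f (map_prod g h) x) (map_prod f (map_prod g h) y)) = cond_info A B E W"
proof -
  let ?W = "\<lambda>x y. W (map_prod f (map_prod g h) x) (map_prod f (map_prod g h) y)"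
  have "entropy (A' \<times> E') (\<lambda>x y. \<Sum>b\<in>B'. ?W (fst x, b, snd x) (fst y, b, snd y))
      = entropy (A \<times> E) (\<lambda>x y. \<Sum>b\<in>B. W (fst x, b, snd x) (fst y, b, snd y))"
    by (rule entropy_bij[OF bij_betw_map_prod[OF f h]])
      (simp add: sum.reindex_bij_betw[OF g, of "\<lambda>b. W (f (fst _), b, h (snd _)) (f (fst _), b, h (snd _))"])
  moreover have "entropy (B' \<times> E') (\<lambda>x y. \<Sum>a\<in>A'. ?W (a, x) (a, y)) = entropy (B \<times> E) (\<lambda>x y. \<Sum>a\<in>A. W (a, x) (a, y))"
    by (rule entropy_bij[OF bij_betw_map_prod[OF g h]])
      (simp add: sum.reindex_bij_betw[OF f, of "\<lambda>a. W (a, map_prod g h _) (a, map_prod g h _)"])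
  moreover have "entropy (A' \<times> B' \<times> E') ?W = entropy (A \<times> B \<times> E) W"
    by (rule entropy_bij[OF bij_betw_map_prod[OF f bij_betw_map_prod[OF g h]]]) simp
  moreover have "entropy E' (\<lambda>x y. \<Sum>a\<in>A'. \<Sum>b\<in>B'. ?W (a, b, x) (a, b, y))
      = entropy E (\<lambda>x y. \<Sum>a\<in>A. \<Sum>b\<in>B. W (a, b, x) (a, b, y))"
    by (rule entropy_bij[OF h])
      (simp add: sum.reindex_bij_betw[OF g, of "\<lambda>b. W (_, b, h _) (_, b, h _)"]
        sum.reindex_bij_betw[OF f, of "\<lambda>a. \<Sum>b\<in>B. W (a, b, h _) (a, b, h _)"])
  ultimately show ?thesis unfolding cond_info_def by simp
qed

lemma extension_cond_info_nonneg: "extension A B E R W \<Longrightarrow> 0 \<le> cond_info A B E W"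
  by (auto simp: extension_def intro: cond_info_nonneg)

text \<open>The extension system may have any type here, for instance a product
  \<open>A \<times> E\<close>; it is enumerated by naturals to meet the definition. Strong
  subadditivity bounds the set below by 0, so that the infimum is a lower bound.\<close>

lemma sqe_le:
  assumes X: "extension A B E R W"
  shows "sqe A B R \<le> 1 / 2 * cond_info A B E W"
proof -
  obtain h where h: "bij_betw h {..<card E} E"
    using ex_bij_betw_nat_finite[of E] X by (auto simp: extension_def atLeast0LessThan)
  have i: "bij_betw (\<lambda>x. x) S S" for S :: "'x set" by (simp add: bij_betw_def)
  have "extension A B {..<card E} R (\<lambda>x y. W (map_prod (\<lambda>x. x) (map_prod (\<lambda>x. x) h) x) (map_prod (\<lambda>x. x) (map_prod (\<lambda>x. x) h) y))"
    using extension_bij[OF i i h X] by (simp add: prod.map_ident)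
  hence "sqe A B R \<le> 1 / 2 * cond_info A B {..<card E} (\<lambda>x y. W (map_prod (\<lambda>x. x) (map_prod (\<lambda>x. x) h) x) (map_prod (\<lambda>x. x) (map_prod (\<lambda>x. x) h) y))"
    unfolding sqe_def by (intro cInf_lower bdd_belowI[of _ 0]) (auto dest: extension_cond_info_nonneg)
  thus ?thesis by (simp only: cond_info_bij[OF i i h])
qed

lemma extension_trivial:
  assumes "finite A" "finite B" "psd (A \<times> B) R" "trace_on (A \<times> B) R = 1"
  shows "extension A B {0 :: nat} R (\<lambda>x y. R (fst x, fst (snd x)) (fst y, fst (snd y)))"
proof -
  have h: "bij_betw (\<lambda>x. (fst x, fst (snd x))) (A \<times> B \<times> {0::nat}) (A \<times> B)"
    by (rule bij_betwI[where g = "\<lambda>x. (fst x, snd x, 0)"]) auto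
  show ?thesis
    unfolding extension_def using psd_reindex[OF h assms(3)] trace_on_reindex[OF h, of R] assms by simp
qed

text \<open>That \<open>R\<close> is a state ensures the trivial extension, hence an infimum over a
  nonempty set.\<close>

lemma le_sqe:
  assumes "finite A" "finite B" "psd (A \<times> B) R" "trace_on (A \<times> B) R = 1"
    and "\<And>(E :: nat set) W. extension A B E R W \<Longrightarrow> c \<le> 1 / 2 * cond_info A B E W"
  shows "c \<le> sqe A B R"
  unfolding sqe_def
proof (rule cInf_greatest)
  show "{1 / 2 * cond_info A B E W | (E :: nat set) W. extension A B E R W} \<noteq> {}"
    using extension_trivial[OF assms(1-4)] by blast
  show "c \<le> x" if "x \<in> {1 / 2 * cond_info A B E W | (E :: nat set) W. extension A B E R W}" for x
    using that assms(5) by blast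
qed

text \<open>Relabelling \<open>A\<close> and \<open>B\<close> while \<open>E\<close> stays fixed
  turns extensions of either state into extensions of the other with equal information, so each
  infimum bounds the other.\<close>

lemma sqe_bij:
  assumes f: "bij_betw f A' A" and g: "bij_betw g B' B" and fin: "finite A" "finite B"
    and R: "psd (A \<times> B) R" "trace_on (A \<times> B) R = 1"
  shows "sqe A' B' (\<lambda>x y. R (map_prod f g x) (map_prod f g y)) = sqe A B R"
proof (rule antisym)
  have i: "bij_betw (\<lambda>x. x) S S" for S :: "'x set" by (simp add: bij_betw_def)
  let ?R = "\<lambda>x y. R (map_prod f g x) (map_prod f g y)"
  show "sqe A' B' ?R \<le> sqe A B R"
    using sqe_le[OF extension_bij[OF f g i]] by (intro le_sqe fin R) (simp add: cond_info_bij[OF f g i])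
  let ?f = "inv_into A' f" and ?g = "inv_into B' g"
  have f': "bij_betw ?f A A'" and g': "bij_betw ?g B B'" using f g by (auto intro: bij_betw_inv_into)
  note m = bij_betw_map_prod[OF f g]
  show "sqe A B R \<le> sqe A' B' ?R"
  proof (rule le_sqe)
    fix E :: "nat set" and W assume X: "extension A' B' E ?R W"
    have eq: "?R (map_prod ?f ?g x) (map_prod ?f ?g y) = R x y" if "x \<in> A \<times> B" "y \<in> A \<times> B" for x y
      using that bij_betw_inv_into_right[OF f] bij_betw_inv_into_right[OF g] by (auto simp: map_prod_def split: prod.splits)
    from extension_bij[OF f' g' i X]
    have "extension A B E R (\<lambda>x y. W (map_prod ?f (map_prod ?g (\<lambda>x. x)) x) (map_prod ?f (map_prod ?g (\<lambda>x. x)) y))"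
      unfolding extension_def using eq by simp
    from sqe_le[OF this] show "sqe A B R \<le> 1 / 2 * cond_info A' B' E W" by (simp only: cond_info_bij[OF f' g' i])
  qed (use fin bij_betw_finite[OF f] bij_betw_finite[OF g] psd_reindex[OF m R(1)] trace_on_reindex[OF m] R(2) in auto)
qed

section \<open>Superadditivity\<close>

text \<open>\<open>W1\<close> is the state of \<open>ABE\<close> and \<open>W2\<close> that of
  \<open>A'B'AE\<close>. The chain rule is never stated on its own: it is the cancellation of
  entropies once each of them is written in one fixed form.\<close>

lemma cond_info_superadditive:
  fixes W :: "('a \<times> 'c) \<times> ('b \<times> 'd) \<times> 'e \<Rightarrow> ('a \<times> 'c) \<times> ('b \<times> 'd) \<times> 'e \<Rightarrow> complex"
  assumes fin: "finite A" "finite A'" "finite B" "finite B'" "finite E"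
    and W: "psd ((A \<times> A') \<times> (B \<times> B') \<times> E) W"
  defines "W1 \<equiv> \<lambda>x y. \<Sum>c\<in>A' \<times> B'. W ((fst x, fst c), (fst (snd x), snd c), snd (snd x))
      ((fst y, fst c), (fst (snd y), snd c), snd (snd y))"
    and "W2 \<equiv> \<lambda>x y. \<Sum>b\<in>B. W ((fst (snd (snd x)), fst x), (b, fst (snd x)), snd (snd (snd x)))
      ((fst (snd (snd y)), fst y), (b, fst (snd y)), snd (snd (snd y)))"
  shows "cond_info A B E W1 + cond_info A' B' (A \<times> E) W2 \<le> cond_info (A \<times> A') (B \<times> B') E W"
proof -
  \<comment> \<open>\<open>ha\<close> puts \<open>A'\<close> first, so that it can be traced out,
    and leaves \<open>A\<close>, \<open>B'\<close> and \<open>BE\<close> as the three parties;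
    \<open>hb\<close> arranges everything into \<open>A'\<close>, \<open>B\<close> and
    \<open>AB'E\<close>.\<close>
  define ha where "ha = (\<lambda>(a', a, b', b, e). ((a :: 'a, a' :: 'c), (b :: 'b, b' :: 'd), e :: 'e))"
  define hb where "hb = (\<lambda>(a', b, a, b', e). ((a :: 'a, a' :: 'c), (b :: 'b, b' :: 'd), e :: 'e))"
  have ha: "bij_betw ha (A' \<times> (A \<times> B' \<times> (B \<times> E))) ((A \<times> A') \<times> (B \<times> B') \<times> E)"
    by (rule bij_betwI[where g = "\<lambda>((a, a'), (b, b'), e). (a', a, b', b, e)"]) (auto simp: ha_def)
  have hb: "bij_betw hb (A' \<times> B \<times> (A \<times> B' \<times> E)) ((A \<times> A') \<times> (B \<times> B') \<times> E)"
    by (rule bij_betwI[where g = "\<lambda>((a, a'), (b, b'), e). (a', b, a, b', e)"]) (auto simp: hb_def)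
  define Pa where "Pa = (\<lambda>x y. \<Sum>c\<in>A'. W (ha (c, x)) (ha (c, y)))"
  define Pb where "Pb = (\<lambda>x y. W (hb x) (hb y))"
  have psdPa: "psd (A \<times> B' \<times> (B \<times> E)) Pa"
    unfolding Pa_def by (rule psd_partial_trace_bij[OF ha _ _ W]) (use fin in auto)
  have psdPb: "psd (A' \<times> B \<times> (A \<times> B' \<times> E)) Pb"
    unfolding Pb_def by (rule psd_reindex[OF hb W])
  \<comment> \<open>The two discarded terms of the chain rule: \<open>I(A;B'|BE)\<close> for
    \<open>Pa\<close> and \<open>I(A';B|AB'E)\<close> for \<open>Pb\<close>.\<close>
  have ssa_a: "0 \<le> cond_info A B' (B \<times> E) Pa" using fin by (intro cond_info_nonneg psdPa) auto
  have ssa_b: "0 \<le> cond_info A' B (A \<times> B' \<times> E) Pb" using fin by (intro cond_info_nonneg psdPb) auto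
  \<comment> \<open>Each fact from here on is named after the subsystem whose entropy it identifies
    in two groupings or orders of summation; \<open>full\<close> is the whole system.\<close>
  have AE: "entropy (A \<times> E) (\<lambda>x y. \<Sum>b\<in>B. W1 (fst x, b, snd x) (fst y, b, snd y))
      = entropy (A \<times> E) (\<lambda>x y. \<Sum>a'\<in>A'. \<Sum>b'\<in>B'. W2 (a', b', x) (a', b', y))"
    unfolding W1_def W2_def sum_Times
    by (rule arg_cong[where f = "entropy (A \<times> E)"], intro ext, simp,
        subst sum.swap, rule sum.cong[OF refl], rule sum.swap)
  have BE: "entropy (B \<times> E) (\<lambda>x y. \<Sum>a\<in>A. W1 (a, x) (a, y))
      = entropy (B \<times> E) (\<lambda>x y. \<Sum>a\<in>A. \<Sum>b'\<in>B'. Pa (a, b', x) (a, b', y))"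
    unfolding W1_def Pa_def sum_Times ha_def
    by (rule arg_cong[where f = "entropy (B \<times> E)"], intro ext, simp add: case_prod_beta,
        rule sum.cong[OF refl], rule sum.swap)
  have ABE: "entropy (A \<times> B \<times> E) W1 = entropy (A \<times> B \<times> E) (\<lambda>x y. \<Sum>b'\<in>B'. Pa (fst x, b', snd x) (fst y, b', snd y))"
    unfolding W1_def Pa_def sum_Times ha_def
    by (rule arg_cong[where f = "entropy (A \<times> B \<times> E)"], intro ext, simp add: case_prod_beta, rule sum.swap)
  have E: "entropy E (\<lambda>x y. \<Sum>a\<in>A. \<Sum>b\<in>B. W1 (a, b, x) (a, b, y))
      = entropy E (\<lambda>x y. \<Sum>a\<in>A \<times> A'. \<Sum>b\<in>B \<times> B'. W (a, b, x) (a, b, y))"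
    unfolding W1_def sum_Times
    by (rule arg_cong[where f = "entropy E"], intro ext, simp, rule sum.cong[OF refl], rule sum.swap)
  have A'AE: "entropy (A' \<times> A \<times> E) (\<lambda>x y. \<Sum>b'\<in>B'. W2 (fst x, b', snd x) (fst y, b', snd y))
      = entropy ((A \<times> A') \<times> E) (\<lambda>x y. \<Sum>b\<in>B \<times> B'. W (fst x, b, snd x) (fst y, b, snd y))"
  proof (rule entropy_bij[where h = "\<lambda>(a', a, e). ((a, a'), e)"])
    show "bij_betw (\<lambda>(a', a, e). ((a, a'), e)) (A' \<times> A \<times> E) ((A \<times> A') \<times> E)"
      by (rule bij_betwI[where g = "\<lambda>((a, a'), e). (a', a, e)"]) auto
  qed (unfold W2_def sum_Times, simp add: case_prod_beta, rule sum.swap)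
  have B'BE: "entropy (B' \<times> B \<times> E) (\<lambda>x y. \<Sum>a\<in>A. Pa (a, x) (a, y))
      = entropy ((B \<times> B') \<times> E) (\<lambda>x y. \<Sum>a\<in>A \<times> A'. W (a, x) (a, y))"
  proof (rule entropy_bij[where h = "\<lambda>(a', a, e). ((a, a'), e)"])
    show "bij_betw (\<lambda>(a', a, e). ((a, a'), e)) (B' \<times> B \<times> E) ((B \<times> B') \<times> E)"
      by (rule bij_betwI[where g = "\<lambda>((a, a'), e). (a', a, e)"]) auto
  qed (unfold Pa_def sum_Times ha_def, simp add: case_prod_beta)
  have full: "entropy (A' \<times> B \<times> A \<times> B' \<times> E) Pb = entropy ((A \<times> A') \<times> (B \<times> B') \<times> E) W"
    unfolding Pb_def by (rule entropy_bij[OF hb]) simp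
  have ABB'E: "entropy (B \<times> A \<times> B' \<times> E) (\<lambda>x y. \<Sum>a'\<in>A'. Pb (a', x) (a', y)) = entropy (A \<times> B' \<times> B \<times> E) Pa"
  proof (rule entropy_bij[where h = "\<lambda>(b, a, b', e). (a, b', b, e)"])
    show "bij_betw (\<lambda>(b, a, b', e). (a, b', b, e)) (B \<times> A \<times> B' \<times> E) (A \<times> B' \<times> B \<times> E)"
      by (rule bij_betwI[where g = "\<lambda>(a, b', b, e). (b, a, b', e)"]) auto
  qed (simp add: Pa_def Pb_def ha_def hb_def case_prod_beta)
  have AB'E: "entropy (A \<times> B' \<times> E) (\<lambda>x y. \<Sum>a'\<in>A'. \<Sum>b\<in>B. Pb (a', b, x) (a', b, y))
      = entropy (B' \<times> A \<times> E) (\<lambda>x y. \<Sum>a'\<in>A'. W2 (a', x) (a', y))"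
  proof (rule entropy_bij[where h = "\<lambda>(a, b', e). (b', a, e)"])
    show "bij_betw (\<lambda>(a, b', e). (b', a, e)) (A \<times> B' \<times> E) (B' \<times> A \<times> E)"
      by (rule bij_betwI[where g = "\<lambda>(b', a, e). (a, b', e)"]) auto
  qed (simp add: W2_def Pb_def hb_def case_prod_beta)
  have AA'B'E: "entropy (A' \<times> A \<times> B' \<times> E) (\<lambda>x y. \<Sum>b\<in>B. Pb (fst x, b, snd x) (fst y, b, snd y))
      = entropy (A' \<times> B' \<times> A \<times> E) W2"
  proof (rule entropy_bij[where h = "\<lambda>(a', a, b', e). (a', b', a, e)"])
    show "bij_betw (\<lambda>(a', a, b', e). (a', b', a, e)) (A' \<times> A \<times> B' \<times> E) (A' \<times> B' \<times> A \<times> E)"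
      by (rule bij_betwI[where g = "\<lambda>(a', b', a, e). (a', a, b', e)"]) auto
  qed (simp add: W2_def Pb_def hb_def case_prod_beta)
  \<comment> \<open>All intermediate entropies occur once with each sign; only those of
    \<open>AA'E\<close>, \<open>BB'E\<close>, the whole system and \<open>E\<close> survive, and
    these form the right-hand side.\<close>
  show ?thesis
    using ssa_a ssa_b unfolding cond_info_def AE BE ABE E A'AE B'BE full ABB'E AB'E AA'B'E by linarith
qed

definition marg1 :: "'c set \<Rightarrow> 'd set \<Rightarrow> (('a \<times> 'c) \<times> ('b \<times> 'd) \<Rightarrow> ('a \<times> 'c) \<times> ('b \<times> 'd) \<Rightarrow> complex)
    \<Rightarrow> 'a \<times> 'b \<Rightarrow> 'a \<times> 'b \<Rightarrow> complex" where
  "marg1 C D R = (\<lambda>x y. \<Sum>c\<in>C \<times> D. R ((fst x, fst c), (snd x, snd c)) ((fst y, fst c), (snd y, snd c)))"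

definition marg2 :: "'a set \<Rightarrow> 'b set \<Rightarrow> (('a \<times> 'c) \<times> ('b \<times> 'd) \<Rightarrow> ('a \<times> 'c) \<times> ('b \<times> 'd) \<Rightarrow> complex)
    \<Rightarrow> 'c \<times> 'd \<Rightarrow> 'c \<times> 'd \<Rightarrow> complex" where
  "marg2 A B R = (\<lambda>x y. \<Sum>c\<in>A \<times> B. R ((fst c, fst x), (snd c, snd x)) ((fst c, fst y), (snd c, snd y)))"

lemma extension_marg1:
  assumes X: "extension (A \<times> A') (B \<times> B') E R W" and fin: "finite A" "finite A'" "finite B" "finite B'"
  shows "extension A B E (marg1 A' B' R) (\<lambda>x y. \<Sum>c\<in>A' \<times> B'. W ((fst x, fst c), (fst (snd x), snd c), snd (snd x))
      ((fst y, fst c), (fst (snd y), snd c), snd (snd y)))"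
proof -
  note x = extensionD[OF X]
  define h where "h = (\<lambda>(c, x). ((fst x :: 'a, fst c :: 'b), (fst (snd x) :: 'c, snd c :: 'd), snd (snd x) :: 'e))"
  have h: "bij_betw h ((A' \<times> B') \<times> (A \<times> B \<times> E)) ((A \<times> A') \<times> (B \<times> B') \<times> E)"
    by (rule bij_betwI[where g = "\<lambda>((a, a'), (b, b'), e). ((a', b'), a, b, e)"]) (auto simp: h_def)
  let ?W = "\<lambda>x y. \<Sum>c\<in>A' \<times> B'. W ((fst x, fst c), (fst (snd x), snd c), snd (snd x))
      ((fst y, fst c), (fst (snd y), snd c), snd (snd y))"
  have "psd (A \<times> B \<times> E) ?W"
    using psd_partial_trace_bij[OF h _ _ x(4)] fin x(3) by (simp add: h_def)
  moreover have "trace_on (A \<times> B \<times> E) ?W = 1"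
    using trace_on_partial_trace_bij[OF h, of W] x(5) by (simp add: h_def)
  moreover have "(\<Sum>e\<in>E. ?W (fst x, snd x, e) (fst y, snd y, e)) = marg1 A' B' R x y"
    if "x \<in> A \<times> B" "y \<in> A \<times> B" for x y
  proof -
    have "(\<Sum>e\<in>E. ?W (fst x, snd x, e) (fst y, snd y, e)) = (\<Sum>c\<in>A' \<times> B'. \<Sum>e\<in>E.
        W ((fst x, fst c), (snd x, snd c), e) ((fst y, fst c), (snd y, snd c), e))"
      by (simp, rule sum.swap)
    also have "\<dots> = marg1 A' B' R x y"
      unfolding marg1_def
    proof (rule sum.cong[OF refl])
      fix c assume "c \<in> A' \<times> B'"
      thus "(\<Sum>e\<in>E. W ((fst x, fst c), (snd x, snd c), e) ((fst y, fst c), (snd y, snd c), e))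
        = R ((fst x, fst c), (snd x, snd c)) ((fst y, fst c), (snd y, snd c))"
        using x(6)[of "((fst x, fst c), (snd x, snd c))" "((fst y, fst c), (snd y, snd c))"] that by auto
    qed
    finally show ?thesis .
  qed
  ultimately show ?thesis unfolding extension_def using fin x(3) by blast
qed

text \<open>Only \<open>B\<close> is traced out. \<open>A\<close> joins the extension system, which
  produces the conditioning on \<open>AE\<close>; tracing over \<open>A\<close> and \<open>E\<close>
  together still leaves the marginal on \<open>A'B'\<close>.\<close>

lemma extension_marg2:
  assumes X: "extension (A \<times> A') (B \<times> B') E R W" and fin: "finite A" "finite A'" "finite B" "finite B'"
  shows "extension A' B' (A \<times> E) (marg2 A B R)
    (\<lambda>x y. \<Sum>b\<in>B. W ((fst (snd (snd x)), fst x), (b, fst (snd x)), snd (snd (snd x)))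
      ((fst (snd (snd y)), fst y), (b, fst (snd y)), snd (snd (snd y))))"
proof -
  note x = extensionD[OF X]
  define h where "h = (\<lambda>(b, x). ((fst (snd (snd x)) :: 'a, fst x :: 'b), (b :: 'c, fst (snd x) :: 'd), snd (snd (snd x)) :: 'e))"
  have h: "bij_betw h (B \<times> (A' \<times> B' \<times> (A \<times> E))) ((A \<times> A') \<times> (B \<times> B') \<times> E)"
    by (rule bij_betwI[where g = "\<lambda>((a, a'), (b, b'), e). (b, a', b', a, e)"]) (auto simp: h_def)
  let ?W = "\<lambda>x y. \<Sum>b\<in>B. W ((fst (snd (snd x)), fst x), (b, fst (snd x)), snd (snd (snd x)))
      ((fst (snd (snd y)), fst y), (b, fst (snd y)), snd (snd (snd y)))"
  have "psd (A' \<times> B' \<times> (A \<times> E)) ?W"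
    using psd_partial_trace_bij[OF h _ _ x(4)] fin x(3) by (simp add: h_def)
  moreover have "trace_on (A' \<times> B' \<times> (A \<times> E)) ?W = 1"
    using trace_on_partial_trace_bij[OF h, of W] x(5) by (simp add: h_def)
  moreover have "(\<Sum>e\<in>A \<times> E. ?W (fst x, snd x, e) (fst y, snd y, e)) = marg2 A B R x y"
    if "x \<in> A' \<times> B'" "y \<in> A' \<times> B'" for x y
  proof -
    have "(\<Sum>e\<in>A \<times> E. ?W (fst x, snd x, e) (fst y, snd y, e)) = (\<Sum>a\<in>A. \<Sum>e\<in>E. \<Sum>b\<in>B.
        W ((a, fst x), (b, snd x), e) ((a, fst y), (b, snd y), e))"
      by (simp add: sum_Times)
    also have "\<dots> = (\<Sum>a\<in>A. \<Sum>b\<in>B. \<Sum>e\<in>E. W ((a, fst x), (b, snd x), e) ((a, fst y), (b, snd y), e))"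
      by (rule sum.cong[OF refl], rule sum.swap)
    also have "\<dots> = marg2 A B R x y"
      unfolding marg2_def sum_Times
    proof (intro sum.cong[OF refl])
      fix a b assume "a \<in> A" "b \<in> B"
      thus "(\<Sum>e\<in>E. W ((a, fst x), (b, snd x), e) ((a, fst y), (b, snd y), e))
        = R ((fst (a, b), fst x), (snd (a, b), snd x)) ((fst (a, b), fst y), (snd (a, b), snd y))"
        using x(6)[of "((a, fst x), (b, snd x))" "((a, fst y), (b, snd y))"] that by auto
    qed
    finally show ?thesis .
  qed
  ultimately show ?thesis unfolding extension_def using fin x(3) by blast
qed

text \<open>One extension \<open>W\<close> of the joint state yields extensions of both marginals,
  with systems \<open>E\<close> and \<open>A \<times> E\<close>, whose informations add up to at
  most that of \<open>W\<close>.\<close>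

lemma sqe_superadditive:
  assumes fin: "finite A" "finite A'" "finite B" "finite B'"
    and R: "psd ((A \<times> A') \<times> (B \<times> B')) R" "trace_on ((A \<times> A') \<times> (B \<times> B')) R = 1"
  shows "sqe A B (marg1 A' B' R) + sqe A' B' (marg2 A B R) \<le> sqe (A \<times> A') (B \<times> B') R"
proof (rule le_sqe[OF _ _ R])
  fix E :: "nat set" and W assume X: "extension (A \<times> A') (B \<times> B') E R W"
  show "sqe A B (marg1 A' B' R) + sqe A' B' (marg2 A B R) \<le> 1 / 2 * cond_info (A \<times> A') (B \<times> B') E W"
    using sqe_le[OF extension_marg1[OF X fin]] sqe_le[OF extension_marg2[OF X fin]]
      cond_info_superadditive[OF fin extensionD(3,4)[OF X]] by linarith
qed (use fin in auto)

section \<open>Additivity on tensor products\<close>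

lemma xlogx_mult:
  fixes d e :: real
  assumes "0 \<le> d" "0 \<le> e"
  shows "d * e * log 2 (d * e) = e * (d * log 2 d) + d * (e * log 2 e)"
proof (cases "d = 0 \<or> e = 0")
  case False
  with assms have "log 2 (d * e) = log 2 d + log 2 e" by (intro log_mult_pos) auto
  thus ?thesis by (simp add: algebra_simps)
qed auto

text \<open>The eigenvalues of the tensor product are the products \<open>d k * e l\<close>. Their
  logarithms add, and each of the two resulting sums contains a factor that is a trace, hence
  1.\<close>

lemma
  assumes fin: "finite I" "finite J" and M: "psd I M" and N: "psd J N"
  shows psd_tensor: "psd (I \<times> J) (\<lambda>x y. M (fst x) (fst y) * N (snd x) (snd y))"
    and entropy_tensor: "trace_on I M = 1 \<Longrightarrow> trace_on J N = 1 \<Longrightarrow>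
      entropy (I \<times> J) (\<lambda>x y. M (fst x) (fst y) * N (snd x) (snd y)) = entropy I M + entropy J N"
proof -
  obtain u d where E: "eigenbasis I M {..<card I} u d" and d: "\<And>k. k < card I \<Longrightarrow> 0 \<le> d k"
    using psd_spectral[OF fin(1) M] by blast
  obtain v e where F: "eigenbasis J N {..<card J} v e" and e: "\<And>k. k < card J \<Longrightarrow> 0 \<le> e k"
    using psd_spectral[OF fin(2) N] by blast
  note T = eigenbasis_tensor[OF E F]
  show "psd (I \<times> J) (\<lambda>x y. M (fst x) (fst y) * N (snd x) (snd y))"
    by (rule psd_eigenbasis[OF T]) (use d e in auto)
  assume "trace_on I M = 1" "trace_on J N = 1"
  hence d1: "(\<Sum>k<card I. d k) = 1" and e1: "(\<Sum>k<card J. e k) = 1"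
    unfolding trace_on_eigenbasis[OF E] trace_on_eigenbasis[OF F] by (simp_all only: of_real_eq_1_iff)
  have "(\<Sum>k\<in>{..<card I} \<times> {..<card J}. d (fst k) * e (snd k) * log 2 (d (fst k) * e (snd k)))
      = (\<Sum>k<card I. \<Sum>l<card J. e l * (d k * log 2 (d k)) + d k * (e l * log 2 (e l)))"
    unfolding sum_Times by (intro sum.cong refl) (simp add: xlogx_mult d e)
  also have "\<dots> = (\<Sum>k<card I. d k * log 2 (d k)) + (\<Sum>l<card J. e l * log 2 (e l))"
    by (simp add: sum.distrib sum_distrib_left[symmetric] sum_distrib_right[symmetric] d1 e1)
  finally show "entropy (I \<times> J) (\<lambda>x y. M (fst x) (fst y) * N (snd x) (snd y)) = entropy I M + entropy J N"
    unfolding entropy_eq[OF E] entropy_eq[OF F] entropy_eq[OF T] by simp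
qed

lemma entropy_tensor_bij:
  assumes h: "bij_betw h S (I \<times> J)" and fin: "finite I" "finite J"
    and MN: "psd I M" "psd J N" "trace_on I M = 1" "trace_on J N = 1"
    and T: "\<And>x y. x \<in> S \<Longrightarrow> y \<in> S \<Longrightarrow> T x y = M (fst (h x)) (fst (h y)) * N (snd (h x)) (snd (h y))"
  shows "entropy S T = entropy I M + entropy J N"
  using entropy_bij[OF h, of T "\<lambda>x y. M (fst x) (fst y) * N (snd x) (snd y)"] T entropy_tensor[OF fin MN] by simp

text \<open>The marginals occurring in \<open>cond_info\<close> are states; this supplies the
  hypotheses under which entropy is additive on their products. Each regrouping places the traced
  systems first.\<close>

lemma
  assumes X: "extension A B E R W"
  shows extension_psd_AE: "psd (A \<times> E) (\<lambda>x y. \<Sum>b\<in>B. W (fst x, b, snd x) (fst y, b, snd y))"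
    and extension_trace_AE: "trace_on (A \<times> E) (\<lambda>x y. \<Sum>b\<in>B. W (fst x, b, snd x) (fst y, b, snd y)) = 1"
    and extension_psd_BE: "psd (B \<times> E) (\<lambda>x y. \<Sum>a\<in>A. W (a, x) (a, y))"
    and extension_trace_BE: "trace_on (B \<times> E) (\<lambda>x y. \<Sum>a\<in>A. W (a, x) (a, y)) = 1"
    and extension_psd_E: "psd E (\<lambda>x y. \<Sum>a\<in>A. \<Sum>b\<in>B. W (a, b, x) (a, b, y))"
    and extension_trace_E: "trace_on E (\<lambda>x y. \<Sum>a\<in>A. \<Sum>b\<in>B. W (a, b, x) (a, b, y)) = 1"
proof -
  note x = extensionD[OF X]
  have 1: "bij_betw (\<lambda>(b, a, e). (a, b, e)) (B \<times> A \<times> E) (A \<times> B \<times> E)"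
    by (rule bij_betwI[where g = "\<lambda>(a, b, e). (b, a, e)"]) auto
  have 2: "bij_betw (\<lambda>x. x) (A \<times> B \<times> E) (A \<times> B \<times> E)" by (simp add: bij_betw_def)
  have 3: "bij_betw (\<lambda>((a, b), e). (a, b, e)) ((A \<times> B) \<times> E) (A \<times> B \<times> E)"
    by (rule bij_betwI[where g = "\<lambda>(a, b, e). ((a, b), e)"]) auto
  show "psd (A \<times> E) (\<lambda>x y. \<Sum>b\<in>B. W (fst x, b, snd x) (fst y, b, snd y))"
    using psd_partial_trace_bij[OF 1 _ _ x(4)] x(1-3) by (simp add: case_prod_beta)
  show "trace_on (A \<times> E) (\<lambda>x y. \<Sum>b\<in>B. W (fst x, b, snd x) (fst y, b, snd y)) = 1"
    using trace_on_partial_trace_bij[OF 1, of W] x(5) by (simp add: case_prod_beta)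
  show "psd (B \<times> E) (\<lambda>x y. \<Sum>a\<in>A. W (a, x) (a, y))"
    using psd_partial_trace_bij[OF 2 _ _ x(4)] x(1-3) by simp
  show "trace_on (B \<times> E) (\<lambda>x y. \<Sum>a\<in>A. W (a, x) (a, y)) = 1"
    using trace_on_partial_trace_bij[OF 2, of W] x(5) by simp
  show "psd E (\<lambda>x y. \<Sum>a\<in>A. \<Sum>b\<in>B. W (a, b, x) (a, b, y))"
    using psd_partial_trace_bij[OF 3 _ _ x(4)] x(1-3) by (simp add: sum_Times)
  show "trace_on E (\<lambda>x y. \<Sum>a\<in>A. \<Sum>b\<in>B. W (a, b, x) (a, b, y)) = 1"
    using trace_on_partial_trace_bij[OF 3, of W] x(5) by (simp add: sum_Times)
qed

text \<open>The product state is already regrouped for the cut \<open>AA'\<close> versus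
  \<open>BB'\<close>; on index sets this takes the place of \<open>swap_middle\<close>.\<close>

definition tensor :: "('a \<times> 'b \<Rightarrow> 'a \<times> 'b \<Rightarrow> complex) \<Rightarrow> ('c \<times> 'd \<Rightarrow> 'c \<times> 'd \<Rightarrow> complex)
    \<Rightarrow> ('a \<times> 'c) \<times> ('b \<times> 'd) \<Rightarrow> ('a \<times> 'c) \<times> ('b \<times> 'd) \<Rightarrow> complex" where
  "tensor R R' = (\<lambda>x y. R (fst (fst x), fst (snd x)) (fst (fst y), fst (snd y))
     * R' (snd (fst x), snd (snd x)) (snd (fst y), snd (snd y)))"

text \<open>Every marginal of \<open>T\<close> that enters conditional information is, after
  regrouping, the product of the corresponding marginals of \<open>W\<close> and \<open>W'\<close>,
  so all four entropies add.\<close>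

lemma
  fixes W :: "'a \<times> 'b \<times> 'e \<Rightarrow> 'a \<times> 'b \<times> 'e \<Rightarrow> complex"
    and W' :: "'c \<times> 'd \<times> 'f \<Rightarrow> 'c \<times> 'd \<times> 'f \<Rightarrow> complex"
  assumes X: "extension A B E R W" and X': "extension A' B' E' R' W'"
  defines "T \<equiv> \<lambda>x y. W (fst (fst x), fst (fst (snd x)), fst (snd (snd x))) (fst (fst y), fst (fst (snd y)), fst (snd (snd y)))
    * W' (snd (fst x), snd (fst (snd x)), snd (snd (snd x))) (snd (fst y), snd (fst (snd y)), snd (snd (snd y)))"
  shows extension_tensor: "extension (A \<times> A') (B \<times> B') (E \<times> E') (tensor R R') T"
    and cond_info_tensor: "cond_info (A \<times> A') (B \<times> B') (E \<times> E') T = cond_info A B E W + cond_info A' B' E' W'"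
proof -
  note x = extensionD[OF X] and x' = extensionD[OF X']
  have prod: "(\<Sum>i\<in>S. f i) * (\<Sum>j\<in>S'. g j) = (\<Sum>i\<in>S. \<Sum>j\<in>S'. f i * g j)"
    for f :: "'x \<Rightarrow> complex" and g :: "'y \<Rightarrow> complex" and S S' by (rule sum_product)
  define h where "h = (\<lambda>((a, a'), (b, b'), e, e'). ((a :: 'a, b :: 'b, e :: 'e), (a' :: 'c, b' :: 'd, e' :: 'f)))"
  have h: "bij_betw h ((A \<times> A') \<times> (B \<times> B') \<times> (E \<times> E')) ((A \<times> B \<times> E) \<times> (A' \<times> B' \<times> E'))"
    by (rule bij_betwI[where g = "\<lambda>((a, b, e), (a', b', e')). ((a, a'), (b, b'), e, e')"]) (auto simp: h_def)
  have T: "T x y = W (fst (h x)) (fst (h y)) * W' (snd (h x)) (snd (h y))" for x y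
    by (simp add: T_def h_def case_prod_beta)
  have fin: "finite (A \<times> B \<times> E)" "finite (A' \<times> B' \<times> E')" using x(1-3) x'(1-3) by auto
  have psdT: "psd ((A \<times> A') \<times> (B \<times> B') \<times> (E \<times> E')) T"
    using psd_reindex[OF h psd_tensor[OF fin x(4) x'(4)]] by (simp only: T[symmetric])
  have "trace_on ((A \<times> B \<times> E) \<times> (A' \<times> B' \<times> E')) (\<lambda>x y. W (fst x) (fst y) * W' (snd x) (snd y)) = 1"
    using x(5) x'(5) prod[of "\<lambda>i. W i i" "A \<times> B \<times> E" "\<lambda>i. W' i i" "A' \<times> B' \<times> E'"]
    unfolding trace_on_def sum_Times[where A = "A \<times> B \<times> E"] by simp
  hence trT: "trace_on ((A \<times> A') \<times> (B \<times> B') \<times> (E \<times> E')) T = 1"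
    using trace_on_reindex[OF h, of "\<lambda>x y. W (fst x) (fst y) * W' (snd x) (snd y)"] by (simp only: T[symmetric])
  have "(\<Sum>e\<in>E \<times> E'. T (fst x, snd x, e) (fst y, snd y, e)) = tensor R R' x y"
    if "x \<in> (A \<times> A') \<times> (B \<times> B')" "y \<in> (A \<times> A') \<times> (B \<times> B')" for x y
  proof -
    have "R (fst (fst x), fst (snd x)) (fst (fst y), fst (snd y))
        = (\<Sum>e\<in>E. W (fst (fst x), fst (snd x), e) (fst (fst y), fst (snd y), e))"
      using that x(6)[of "(fst (fst x), fst (snd x))" "(fst (fst y), fst (snd y))"] by auto
    moreover have "R' (snd (fst x), snd (snd x)) (snd (fst y), snd (snd y))
        = (\<Sum>e\<in>E'. W' (snd (fst x), snd (snd x), e) (snd (fst y), snd (snd y), e))"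
      using that x'(6)[of "(snd (fst x), snd (snd x))" "(snd (fst y), snd (snd y))"] by auto
    ultimately show ?thesis by (simp add: tensor_def T_def sum_Times prod)
  qed
  thus "extension (A \<times> A') (B \<times> B') (E \<times> E') (tensor R R') T"
    unfolding extension_def using x(1-3) x'(1-3) psdT trT by blast
  have AE: "entropy ((A \<times> A') \<times> (E \<times> E')) (\<lambda>x y. \<Sum>b\<in>B \<times> B'. T (fst x, b, snd x) (fst y, b, snd y))
      = entropy (A \<times> E) (\<lambda>x y. \<Sum>b\<in>B. W (fst x, b, snd x) (fst y, b, snd y))
      + entropy (A' \<times> E') (\<lambda>x y. \<Sum>b\<in>B'. W' (fst x, b, snd x) (fst y, b, snd y))"
  proof (rule entropy_tensor_bij[where h = "\<lambda>((a, a'), e, e'). ((a, e), (a', e'))"])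
    show "bij_betw (\<lambda>((a, a'), e, e'). ((a, e), (a', e'))) ((A \<times> A') \<times> (E \<times> E')) ((A \<times> E) \<times> (A' \<times> E'))"
      by (rule bij_betwI[where g = "\<lambda>((a, a'), e, e'). ((a, e), (a', e'))"]) auto
  qed (use x(1-3) x'(1-3) extension_psd_AE[OF X] extension_psd_AE[OF X'] extension_trace_AE[OF X] extension_trace_AE[OF X'] in
      \<open>simp_all add: T_def sum_Times prod case_prod_beta\<close>)
  have BE: "entropy ((B \<times> B') \<times> (E \<times> E')) (\<lambda>x y. \<Sum>a\<in>A \<times> A'. T (a, x) (a, y))
      = entropy (B \<times> E) (\<lambda>x y. \<Sum>a\<in>A. W (a, x) (a, y)) + entropy (B' \<times> E') (\<lambda>x y. \<Sum>a\<in>A'. W' (a, x) (a, y))"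
  proof (rule entropy_tensor_bij[where h = "\<lambda>((a, a'), e, e'). ((a, e), (a', e'))"])
    show "bij_betw (\<lambda>((a, a'), e, e'). ((a, e), (a', e'))) ((B \<times> B') \<times> (E \<times> E')) ((B \<times> E) \<times> (B' \<times> E'))"
      by (rule bij_betwI[where g = "\<lambda>((a, a'), e, e'). ((a, e), (a', e'))"]) auto
  qed (use x(1-3) x'(1-3) extension_psd_BE[OF X] extension_psd_BE[OF X'] extension_trace_BE[OF X] extension_trace_BE[OF X'] in
      \<open>simp_all add: T_def sum_Times prod case_prod_beta\<close>)
  have ABE: "entropy ((A \<times> A') \<times> (B \<times> B') \<times> (E \<times> E')) T = entropy (A \<times> B \<times> E) W + entropy (A' \<times> B' \<times> E') W'"
    by (rule entropy_tensor_bij[OF h fin x(4) x'(4) x(5) x'(5) T])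
  have E: "entropy (E \<times> E') (\<lambda>x y. \<Sum>a\<in>A \<times> A'. \<Sum>b\<in>B \<times> B'. T (a, b, x) (a, b, y))
      = entropy E (\<lambda>x y. \<Sum>a\<in>A. \<Sum>b\<in>B. W (a, b, x) (a, b, y)) + entropy E' (\<lambda>x y. \<Sum>a\<in>A'. \<Sum>b\<in>B'. W' (a, b, x) (a, b, y))"
  proof (rule entropy_tensor_bij[where h = "\<lambda>x. x"])
    show "bij_betw (\<lambda>x. x) (E \<times> E') (E \<times> E')" by (simp add: bij_betw_def)
  qed (use x(1-3) x'(1-3) extension_psd_E[OF X] extension_psd_E[OF X'] extension_trace_E[OF X] extension_trace_E[OF X'] in
      \<open>simp_all add: T_def sum_Times prod\<close>)
  show "cond_info (A \<times> A') (B \<times> B') (E \<times> E') T = cond_info A B E W + cond_info A' B' E' W'"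
    unfolding cond_info_def AE BE ABE E by simp
qed

text \<open>The infima are taken in turn: for fixed \<open>W'\<close> the difference is a lower
  bound over all \<open>W\<close>, and the resulting inequality is a lower bound over all
  \<open>W'\<close>. Neither infimum has to be attained.\<close>

lemma sqe_tensor_le:
  assumes fin: "finite A" "finite A'" "finite B" "finite B'"
    and R: "psd (A \<times> B) R" "trace_on (A \<times> B) R = 1" and R': "psd (A' \<times> B') R'" "trace_on (A' \<times> B') R' = 1"
  shows "sqe (A \<times> A') (B \<times> B') (tensor R R') \<le> sqe A B R + sqe A' B' R'"
proof -
  have "sqe (A \<times> A') (B \<times> B') (tensor R R') - sqe A B R \<le> sqe A' B' R'"
  proof (rule le_sqe[OF fin(2,4) R'])
    fix E' :: "nat set" and W' assume X': "extension A' B' E' R' W'"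
    have "sqe (A \<times> A') (B \<times> B') (tensor R R') - 1 / 2 * cond_info A' B' E' W' \<le> sqe A B R"
    proof (rule le_sqe[OF fin(1,3) R])
      fix E :: "nat set" and W assume X: "extension A B E R W"
      show "sqe (A \<times> A') (B \<times> B') (tensor R R') - 1 / 2 * cond_info A' B' E' W' \<le> 1 / 2 * cond_info A B E W"
        using sqe_le[OF extension_tensor[OF X X']] unfolding cond_info_tensor[OF X X'] by simp
    qed
    thus "sqe (A \<times> A') (B \<times> B') (tensor R R') - sqe A B R \<le> 1 / 2 * cond_info A' B' E' W'" by simp
  qed
  thus ?thesis by simp
qed

section \<open>Matrices as operators on index sets\<close>

definition mat_op :: "complex mat \<Rightarrow> nat \<Rightarrow> nat \<Rightarrow> complex" where
  "mat_op A = (\<lambda>i j. A $$ (i, j))"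

text \<open>\<open>\<bullet>c\<close> conjugates its second argument and \<open>inner_on\<close> its
  first, so both expressions are the form \<open><v, A v>\<close>.\<close>

lemma psd_mat_iff: "psd_mat n A \<longleftrightarrow> A \<in> carrier_mat n n \<and> psd {..<n} (mat_op A)"
proof (cases "A \<in> carrier_mat n n")
  case A: True
  have q: "(A *\<^sub>v v) \<bullet>c v = inner_on {..<n} (\<lambda>i. v $ i) (apply_op {..<n} (mat_op A) (\<lambda>i. v $ i))" if "v \<in> carrier_vec n" for v
    using that A by (simp add: scalar_prod_def inner_on_def apply_op_def mat_op_def atLeast0LessThan mult.commute)
  show ?thesis
  proof
    assume L: "psd_mat n A"
    have "0 \<le> inner_on {..<n} v (apply_op {..<n} (mat_op A) v)" for v
    proof -
      have "0 \<le> (A *\<^sub>v vec n v) \<bullet>c vec n v" using L by (simp add: psd_mat_def)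
      also have "\<dots> = inner_on {..<n} (\<lambda>i. vec n v $ i) (apply_op {..<n} (mat_op A) (\<lambda>i. vec n v $ i))" by (rule q) simp
      also have "\<dots> = inner_on {..<n} v (apply_op {..<n} (mat_op A) v)" by (simp add: inner_on_def apply_op_def)
      finally show ?thesis .
    qed
    thus "A \<in> carrier_mat n n \<and> psd {..<n} (mat_op A)" using A by (simp add: psd_def)
  qed (auto simp: psd_mat_def psd_def q)
qed (simp add: psd_mat_def)

lemma mat_tr_eq: "A \<in> carrier_mat n n \<Longrightarrow> mat_tr A = trace_on {..<n} (mat_op A)"
  by (auto simp: mat_tr_def trace_on_def mat_op_def)

lemma mat_adjoint_entry:
  assumes "U \<in> carrier_mat n n" "i < n" "j < n"
  shows "mat_adjoint U $$ (i, j) = cnj (U $$ (j, i))"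
  using assms by (simp add: mat_adjoint_def mat_of_rows_def)

lemma mat_adjoint_carrier: "U \<in> carrier_mat n n \<Longrightarrow> mat_adjoint U \<in> carrier_mat n n"
  by (auto simp: mat_adjoint_def)

lemma diagonalisation_entry:
  assumes U: "U \<in> carrier_mat n n" and "i < n" "j < n"
  shows "(U * mat_diag n d * mat_adjoint U) $$ (i, j) = (\<Sum>k<n. d k * U $$ (i, k) * cnj (U $$ (j, k)))"
  using assms mat_adjoint_carrier[OF U]
  by (simp add: mat_diag_mult_right[OF U] scalar_prod_def atLeast0LessThan mat_adjoint_entry mult_ac)

lemma unitary_mat_left:
  assumes "unitary_mat n U"
  shows "mat_adjoint U * U = 1\<^sub>m n"
  using assms mat_adjoint_carrier[of U n] mat_mult_left_right_inverse[of U n "mat_adjoint U"]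
  by (simp add: unitary_mat_def)

lemma eigenbasis_of_unitary:
  assumes U: "unitary_mat n U" and A: "A = U * mat_diag n (\<lambda>i. complex_of_real (d i)) * mat_adjoint U"
  shows "eigenbasis {..<n} (mat_op A) {..<n} (\<lambda>k i. U $$ (i, k)) d"
proof -
  have c: "U \<in> carrier_mat n n" using U by (simp add: unitary_mat_def)
  note c' = mat_adjoint_carrier[OF c]
  have "(\<Sum>i<n. cnj (U $$ (i, k)) * U $$ (i, l)) = of_bool (k = l)" if kl: "k < n" "l < n" for k l
  proof -
    have "(\<Sum>i<n. cnj (U $$ (i, k)) * U $$ (i, l)) = (mat_adjoint U * U) $$ (k, l)"
      using kl c c' by (simp add: scalar_prod_def atLeast0LessThan mat_adjoint_entry[OF c])
    also have "\<dots> = of_bool (k = l)" unfolding unitary_mat_left[OF U] using kl by simp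
    finally show ?thesis .
  qed
  moreover have "(\<Sum>k<n. U $$ (i, k) * cnj (U $$ (j, k))) = of_bool (i = j)" if ij: "i < n" "j < n" for i j
  proof -
    have "(\<Sum>k<n. U $$ (i, k) * cnj (U $$ (j, k))) = (U * mat_adjoint U) $$ (i, j)"
      using ij c c' by (simp add: scalar_prod_def atLeast0LessThan mat_adjoint_entry[OF c])
    also have "\<dots> = of_bool (i = j)" using ij U by (simp add: unitary_mat_def)
    finally show ?thesis .
  qed
  moreover have "mat_op A i j = (\<Sum>k<n. of_real (d k) * U $$ (i, k) * cnj (U $$ (j, k)))" if ij: "i < n" "j < n" for i j
    unfolding mat_op_def A by (rule diagonalisation_entry[OF c ij])
  ultimately show ?thesis unfolding eigenbasis_def inner_on_def by simp
qed

lemma unitary_of_eigenbasis: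
  assumes A: "A \<in> carrier_mat n n" and E: "eigenbasis {..<n} (mat_op A) {..<n} u d"
  shows "\<exists>U. unitary_mat n U \<and> A = U * mat_diag n (\<lambda>i. complex_of_real (d i)) * mat_adjoint U"
proof -
  define U where "U = mat n n (\<lambda>(i, k). u k i)"
  have c: "U \<in> carrier_mat n n" by (simp add: U_def)
  note c' = mat_adjoint_carrier[OF c]
  have "(U * mat_adjoint U) $$ (i, j) = 1\<^sub>m n $$ (i, j)" if ij: "i < n" "j < n" for i j
  proof -
    have "(U * mat_adjoint U) $$ (i, j) = (\<Sum>k<n. u k i * cnj (u k j))"
      using ij c c' by (simp add: scalar_prod_def atLeast0LessThan mat_adjoint_entry[OF c]) (simp add: U_def)
    thus ?thesis using ij eigenbasisD(4)[OF E] by simp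
  qed
  hence "unitary_mat n U" using c c' by (auto simp: unitary_mat_def)
  moreover have "A = U * mat_diag n (\<lambda>i. complex_of_real (d i)) * mat_adjoint U"
  proof (rule eq_matI)
    fix i j assume "i < dim_row (U * mat_diag n (\<lambda>i. complex_of_real (d i)) * mat_adjoint U)"
      "j < dim_col (U * mat_diag n (\<lambda>i. complex_of_real (d i)) * mat_adjoint U)"
    hence ij: "i < n" "j < n" using c c' by auto
    have "A $$ (i, j) = (\<Sum>k<n. of_real (d k) * u k i * cnj (u k j))"
      using eigenbasisD(5)[OF E] ij by (simp add: mat_op_def)
    thus "A $$ (i, j) = (U * mat_diag n (\<lambda>i. complex_of_real (d i)) * mat_adjoint U) $$ (i, j)"
      unfolding diagonalisation_entry[OF c ij] using ij by (simp add: U_def)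
  qed (use A c c' in auto)
  ultimately show ?thesis by blast
qed

text \<open>\<open>mat_fun\<close> selects some diagonalisation. The spectral theorem shows that one
  exists, so the selected \<open>U\<close> and \<open>d\<close> serve both \<open>\<rho>\<close> and
  its logarithm; the resulting sum over \<open>d\<close> does not depend on the selection.\<close>

lemma vn_entropy_eq:
  assumes P: "psd_mat n \<rho>"
  shows "vn_entropy \<rho> = entropy {..<n} (mat_op \<rho>)"
proof -
  have r: "\<rho> \<in> carrier_mat n n" and p: "psd {..<n} (mat_op \<rho>)" using P by (auto simp: psd_mat_iff)
  have dim: "dim_row \<rho> = n" using r by simp
  obtain u d0 where "eigenbasis {..<n} (mat_op \<rho>) {..<n} u d0" using psd_spectral[OF finite_lessThan p] unfolding card_lessThan by blast
  from unitary_of_eigenbasis[OF r this] obtain U0 where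
    "unitary_mat n U0 \<and> \<rho> = U0 * mat_diag n (\<lambda>i. complex_of_real (d0 i)) * mat_adjoint U0" by blast
  hence "\<exists>B U d. unitary_mat (dim_row \<rho>) U \<and>
     \<rho> = U * mat_diag (dim_row \<rho>) (\<lambda>i. complex_of_real (d i)) * mat_adjoint U \<and>
     B = U * mat_diag (dim_row \<rho>) (\<lambda>i. complex_of_real (log 2 (d i))) * mat_adjoint U"
    unfolding dim by blast
  from someI_ex[OF this, folded mat_fun_def] obtain U d where U: "unitary_mat n U"
    and A: "\<rho> = U * mat_diag n (\<lambda>i. complex_of_real (d i)) * mat_adjoint U"
    and B: "mat_fun (log 2) \<rho> = U * mat_diag n (\<lambda>i. complex_of_real (log 2 (d i))) * mat_adjoint U"
    unfolding dim by blast
  have c: "U \<in> carrier_mat n n" using U by (simp add: unitary_mat_def)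
  note c' = mat_adjoint_carrier[OF c]
  let ?D = "mat_diag n (\<lambda>i. complex_of_real (d i))" and ?L = "mat_diag n (\<lambda>i. complex_of_real (log 2 (d i)))"
  have D: "?D \<in> carrier_mat n n" "?L \<in> carrier_mat n n" by simp_all
  \<comment> \<open>The inner \<open>mat_adjoint U * U\<close> cancels by unitarity, the outer pair
    by cyclicity of the trace.\<close>
  have "\<rho> * mat_fun (log 2) \<rho> = (U * ?D * mat_adjoint U) * (U * ?L * mat_adjoint U)"
    unfolding B by (simp only: A[symmetric])
  also have "\<dots> = U * (?D * ((mat_adjoint U * U) * (?L * mat_adjoint U)))"
    using c c' D by (simp add: assoc_mult_mat[of _ n n _ n _ n] mult_carrier_mat[of _ n n _ n])
  also have "\<dots> = U * ((?D * ?L) * mat_adjoint U)"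
  proof -
    have "?L * mat_adjoint U \<in> carrier_mat n n" using c' D by (simp add: mult_carrier_mat[of _ n n _ n])
    hence "(mat_adjoint U * U) * (?L * mat_adjoint U) = ?L * mat_adjoint U"
      unfolding unitary_mat_left[OF U] by (rule left_mult_one_mat)
    moreover have "?D * (?L * mat_adjoint U) = (?D * ?L) * mat_adjoint U"
      by (rule assoc_mult_mat[OF D c', symmetric])
    ultimately show ?thesis by (simp only:)
  qed
  finally have "mat_tr (\<rho> * mat_fun (log 2) \<rho>) = mat_tr (U * ((?D * ?L) * mat_adjoint U))" by simp
  also have "\<dots> = mat_tr (((?D * ?L) * mat_adjoint U) * U)"
    by (rule mat_tr_mult_commute[OF c mult_carrier_mat[OF mult_carrier_mat[OF D] c']])
  also have "\<dots> = mat_tr (?D * ?L)"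
  proof -
    have "((?D * ?L) * mat_adjoint U) * U = (?D * ?L) * (mat_adjoint U * U)"
      by (rule assoc_mult_mat[OF mult_carrier_mat[OF D] c' c])
    thus ?thesis unfolding unitary_mat_left[OF U] right_mult_one_mat[OF mult_carrier_mat[OF D]] by (simp only:)
  qed
  also have "\<dots> = of_real (\<Sum>k<n. d k * log 2 (d k))" unfolding mat_diag_diag by (simp add: mat_tr_def mat_diag_def)
  finally show ?thesis
    unfolding vn_entropy_def entropy_eq[OF eigenbasis_of_unitary[OF U A]] by simp
qed

section \<open>Numerical indices of tensor factors\<close>

lemma index_less:
  fixes i j m n :: nat
  assumes "i < m" "j < n"
  shows "i * n + j < m * n"
proof -
  have "i * n + j < (i + 1) * n" using assms by simp
  also have "\<dots> \<le> m * n" using assms by (intro mult_le_mono1) simp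
  finally show ?thesis .
qed

lemma bij_index: "bij_betw (\<lambda>(i, j). i * n + j) ({..<m} \<times> {..<n}) {..<m * n :: nat}"
proof (rule bij_betwI[where g = "\<lambda>i. (i div n, i mod n)"])
  show "(\<lambda>(i, j). i * n + j) \<in> {..<m} \<times> {..<n} \<rightarrow> {..<m * n}" by (auto simp: index_less)
  show "(\<lambda>i. (i div n, i mod n)) \<in> {..<m * n} \<rightarrow> {..<m} \<times> {..<n}"
    by (cases "n = 0") (auto simp: less_mult_imp_div_less)
qed auto

lemma bij_index3:
  "bij_betw (\<lambda>(i, j, k). (i * n + j) * r + k) ({..<m} \<times> {..<n} \<times> {..<r}) {..<m * n * r :: nat}"
proof -
  have 1: "bij_betw (\<lambda>(i, j, k). ((i, j), k)) ({..<m} \<times> {..<n} \<times> {..<r}) (({..<m} \<times> {..<n}) \<times> {..<r})"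
    by (rule bij_betwI[where g = "\<lambda>((i, j), k). (i, j, k)"]) auto
  have i: "bij_betw (\<lambda>x. x) {..<r} {..<r}" by (simp add: bij_betw_def)
  have "bij_betw (\<lambda>x. (\<lambda>(i, j). i * r + j) (map_prod (\<lambda>(i, j). i * n + j) (\<lambda>x. x) ((\<lambda>(i, j, k). ((i, j), k)) x)))
      ({..<m} \<times> {..<n} \<times> {..<r}) {..<m * n * r}"
    using bij_betw_trans[OF 1 bij_betw_trans[OF bij_betw_map_prod[OF bij_index i] bij_index]]
    by (simp add: comp_def)
  thus ?thesis by (rule bij_betw_cong[THEN iffD1, rotated]) auto
qed

lemma partial_trace_carrier: "partial_trace l m r M \<in> carrier_mat (l * r) (l * r)"
  by (simp add: partial_trace_def)

lemma partial_trace_entry: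
  assumes "i < l" "j < l" "k < r" "k' < r"
  shows "partial_trace l m r M $$ (i * r + k, j * r + k')
    = (\<Sum>c<m. M $$ ((i * m + c) * r + k, (j * m + c) * r + k'))"
  using assms by (simp add: partial_trace_def index_less)

text \<open>Positivity, trace and entropy pass from a matrix to any index set that encodes its row
  numbers, so that the index arithmetic stays confined to the encoding \<open>h\<close>.\<close>

lemma mat_op_bij:
  assumes h: "bij_betw h S {..<n}" and A: "A \<in> carrier_mat n n"
    and M: "\<And>x y. x \<in> S \<Longrightarrow> y \<in> S \<Longrightarrow> A $$ (h x, h y) = M x y"
  shows "psd_mat n A \<longleftrightarrow> psd S M" "mat_tr A = trace_on S M"
    "psd S M \<Longrightarrow> vn_entropy A = entropy S M"
proof -
  let ?g = "inv_into S h"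
  have g: "bij_betw ?g {..<n} S" using h by (rule bij_betw_inv_into)
  have hg: "h (?g i) = i" if "i < n" for i using bij_betw_inv_into_right[OF h] that by simp
  have gS: "?g i \<in> S" if "i < n" for i using bij_betwE[OF g] that by simp
  have M': "M (?g i) (?g j) = mat_op A i j" if "i < n" "j < n" for i j
    using M[of "?g i" "?g j"] gS that hg by (simp add: mat_op_def)
  have "psd S M" if "psd {..<n} (mat_op A)"
    using psd_reindex[OF h that] psd_cong[of S "\<lambda>x y. mat_op A (h x) (h y)" M] M by (simp add: mat_op_def)
  moreover have "psd {..<n} (mat_op A)" if "psd S M"
    using psd_reindex[OF g that] psd_cong[of "{..<n}" "\<lambda>x y. M (?g x) (?g y)" "mat_op A"] M' by simp
  ultimately show iff: "psd_mat n A \<longleftrightarrow> psd S M" using A by (auto simp: psd_mat_iff)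
  show "mat_tr A = trace_on S M"
    unfolding mat_tr_eq[OF A] trace_on_reindex[OF h, symmetric] by (simp add: trace_on_def mat_op_def M)
  assume "psd S M"
  hence "vn_entropy A = entropy {..<n} (mat_op A)" using iff by (intro vn_entropy_eq) simp
  also have "\<dots> = entropy S M" by (rule entropy_bij[OF h, symmetric]) (simp add: mat_op_def M)
  finally show "vn_entropy A = entropy S M" .
qed

lemma partial_trace_density:
  assumes M: "density_operator (l * m * r) M"
  shows "density_operator (l * r) (partial_trace l m r M)"
proof -
  have c: "M \<in> carrier_mat (l * m * r) (l * m * r)" using M by (simp add: density_operator_def psd_mat_def)
  define W where "W = (\<lambda>(x, y, z) (x', y', z'). M $$ ((x * m + y) * r + z, (x' * m + y') * r + z'))"
  have W: "M $$ ((\<lambda>(i, j, k). (i * m + j) * r + k) x, (\<lambda>(i, j, k). (i * m + j) * r + k) y) = W x y" for x y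
    by (simp add: W_def case_prod_beta)
  note t = mat_op_bij[OF bij_index3 c W]
  \<comment> \<open>The traced factor is the middle one; it is moved to the front.\<close>
  have b: "bij_betw (\<lambda>(y, x, z). (x, y, z)) ({..<m} \<times> {..<l} \<times> {..<r}) ({..<l} \<times> {..<m} \<times> {..<r})"
    by (rule bij_betwI[where g = "\<lambda>(y, x, z). (x, y, z)"]) auto
  let ?P = "\<lambda>x y. \<Sum>c<m. W (fst x, c, snd x) (fst y, c, snd y)"
  have P: "partial_trace l m r M $$ ((\<lambda>(i, j). i * r + j) x, (\<lambda>(i, j). i * r + j) y) = ?P x y"
    if "x \<in> {..<l} \<times> {..<r}" "y \<in> {..<l} \<times> {..<r}" for x y
    using that by (auto simp: partial_trace_entry W_def)
  note t' = mat_op_bij[OF bij_index partial_trace_carrier P]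
  have "psd ({..<l} \<times> {..<r}) ?P"
    using psd_partial_trace_bij[OF b, of W] M by (simp add: density_operator_def t(1) case_prod_beta)
  moreover have "trace_on ({..<l} \<times> {..<r}) ?P = 1"
    using trace_on_partial_trace_bij[OF b, of W] M by (simp add: density_operator_def t(2) case_prod_beta)
  ultimately show ?thesis by (simp add: density_operator_def t'(1) t'(2))
qed

section \<open>Squashed entanglement of matrices\<close>

lemma cond_info_cong:
  assumes "\<And>x y. x \<in> A \<times> B \<times> E \<Longrightarrow> y \<in> A \<times> B \<times> E \<Longrightarrow> W x y = W' x y"
  shows "cond_info A B E W = cond_info A B E W'"
proof -
  have "entropy (A \<times> E) (\<lambda>x y. \<Sum>b\<in>B. W (fst x, b, snd x) (fst y, b, snd y))
      = entropy (A \<times> E) (\<lambda>x y. \<Sum>b\<in>B. W' (fst x, b, snd x) (fst y, b, snd y))"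
    by (rule entropy_cong, rule sum.cong[OF refl], rule assms) auto
  moreover have "entropy (B \<times> E) (\<lambda>x y. \<Sum>a\<in>A. W (a, x) (a, y)) = entropy (B \<times> E) (\<lambda>x y. \<Sum>a\<in>A. W' (a, x) (a, y))"
    by (rule entropy_cong, rule sum.cong[OF refl], rule assms) auto
  moreover have "entropy E (\<lambda>x y. \<Sum>a\<in>A. \<Sum>b\<in>B. W (a, b, x) (a, b, y))
      = entropy E (\<lambda>x y. \<Sum>a\<in>A. \<Sum>b\<in>B. W' (a, b, x) (a, b, y))"
    by (rule entropy_cong, rule sum.cong[OF refl], rule sum.cong[OF refl], rule assms) auto
  moreover have "entropy (A \<times> B \<times> E) W = entropy (A \<times> B \<times> E) W'" by (rule entropy_cong) (rule assms)
  ultimately show ?thesis unfolding cond_info_def by simp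
qed

lemma sqe_cong:
  assumes "\<And>x y. x \<in> A \<times> B \<Longrightarrow> y \<in> A \<times> B \<Longrightarrow> R x y = R' x y"
  shows "sqe A B R = sqe A B R'"
proof -
  have "extension A B E R W \<longleftrightarrow> extension A B E R' W" for E :: "nat set" and W
    unfolding extension_def using assms by simp
  thus ?thesis unfolding sqe_def by simp
qed

definition mat_op2 :: "nat \<Rightarrow> complex mat \<Rightarrow> nat \<times> nat \<Rightarrow> nat \<times> nat \<Rightarrow> complex" where
  "mat_op2 n M = (\<lambda>x y. M $$ (fst x * n + snd x, fst y * n + snd y))"

definition mat_op3 :: "nat \<Rightarrow> nat \<Rightarrow> complex mat \<Rightarrow> nat \<times> nat \<times> nat \<Rightarrow> nat \<times> nat \<times> nat \<Rightarrow> complex" where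
  "mat_op3 n r M = (\<lambda>x y. M $$ ((fst x * n + fst (snd x)) * r + snd (snd x),
                             (fst y * n + fst (snd y)) * r + snd (snd y)))"

lemma
  assumes "M \<in> carrier_mat (m * n) (m * n)"
  shows psd_mat_op2: "psd_mat (m * n) M \<longleftrightarrow> psd ({..<m} \<times> {..<n}) (mat_op2 n M)"
    and mat_tr_op2: "mat_tr M = trace_on ({..<m} \<times> {..<n}) (mat_op2 n M)"
    and vn_entropy_op2: "psd_mat (m * n) M \<Longrightarrow> vn_entropy M = entropy ({..<m} \<times> {..<n}) (mat_op2 n M)"
  using mat_op_bij[OF bij_index assms, of "mat_op2 n M"] by (auto simp: mat_op2_def case_prod_beta)

lemma
  assumes "M \<in> carrier_mat (m * n * r) (m * n * r)"
  shows psd_mat_op3: "psd_mat (m * n * r) M \<longleftrightarrow> psd ({..<m} \<times> {..<n} \<times> {..<r}) (mat_op3 n r M)"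
    and mat_tr_op3: "mat_tr M = trace_on ({..<m} \<times> {..<n} \<times> {..<r}) (mat_op3 n r M)"
    and vn_entropy_op3: "psd_mat (m * n * r) M \<Longrightarrow> vn_entropy M = entropy ({..<m} \<times> {..<n} \<times> {..<r}) (mat_op3 n r M)"
  using mat_op_bij[OF bij_index3 assms, of "mat_op3 n r M"] by (auto simp: mat_op3_def case_prod_beta)

lemma density_carrier: "density_operator n M \<Longrightarrow> M \<in> carrier_mat n n"
  by (simp add: density_operator_def psd_mat_def)

lemma density_psd: "density_operator n M \<Longrightarrow> psd_mat n M"
  by (simp add: density_operator_def)

lemma cond_mutual_info_eq_cond_info:
  assumes D: "density_operator (a * b * e) \<sigma>"
  shows "cond_mutual_info a b e \<sigma> = cond_info {..<a} {..<b} {..<e} (mat_op3 b e \<sigma>)"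
proof -
  have D': "density_operator (1 * a * (b * e)) \<sigma>" "density_operator (1 * (a * b) * e) \<sigma>"
    using D by (simp_all add: mult.assoc)
  have "vn_entropy (partial_trace a b e \<sigma>) = entropy ({..<a} \<times> {..<e}) (mat_op2 e (partial_trace a b e \<sigma>))"
    by (rule vn_entropy_op2[OF partial_trace_carrier density_psd[OF partial_trace_density[OF D]]])
  also have "\<dots> = entropy ({..<a} \<times> {..<e}) (\<lambda>x y. \<Sum>c<b. mat_op3 b e \<sigma> (fst x, c, snd x) (fst y, c, snd y))"
    by (rule entropy_cong) (auto simp: mat_op2_def mat_op3_def partial_trace_entry)
  finally have 1: "vn_entropy (partial_trace a b e \<sigma>) = \<dots>" .
  have "partial_trace 1 a (b * e) \<sigma> \<in> carrier_mat (b * e) (b * e)"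
    using partial_trace_carrier[of 1 a "b * e"] by simp
  moreover have "psd_mat (b * e) (partial_trace 1 a (b * e) \<sigma>)"
    using density_psd[OF partial_trace_density[OF D'(1)]] by simp
  ultimately have "vn_entropy (partial_trace 1 a (b * e) \<sigma>) = entropy ({..<b} \<times> {..<e}) (mat_op2 e (partial_trace 1 a (b * e) \<sigma>))"
    by (rule vn_entropy_op2)
  also have "\<dots> = entropy ({..<b} \<times> {..<e}) (\<lambda>x y. \<Sum>c<a. mat_op3 b e \<sigma> (c, x) (c, y))"
  proof (rule entropy_cong)
    fix x y assume "x \<in> {..<b} \<times> {..<e}" "y \<in> {..<b} \<times> {..<e}"
    hence "fst x * e + snd x < b * e" "fst y * e + snd y < b * e" by (auto simp: index_less)
    \<comment> \<open>The left factor has dimension 1, so its index is 0 and the product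
      \<open>b * e\<close> acts as a single right factor.\<close>
    from partial_trace_entry[of 0 1 0, OF _ _ this, of a \<sigma>]
    show "mat_op2 e (partial_trace 1 a (b * e) \<sigma>) x y = (\<Sum>c<a. mat_op3 b e \<sigma> (c, x) (c, y))"
      by (simp add: mat_op2_def mat_op3_def algebra_simps)
  qed
  finally have 2: "vn_entropy (partial_trace 1 a (b * e) \<sigma>) = \<dots>" .
  have 3: "vn_entropy \<sigma> = entropy ({..<a} \<times> {..<b} \<times> {..<e}) (mat_op3 b e \<sigma>)"
    by (rule vn_entropy_op3[OF density_carrier[OF D] density_psd[OF D]])
  have "psd_mat e (partial_trace 1 (a * b) e \<sigma>)"
    using density_psd[OF partial_trace_density[OF D'(2)]] by simp
  hence "vn_entropy (partial_trace 1 (a * b) e \<sigma>) = entropy {..<e} (mat_op (partial_trace 1 (a * b) e \<sigma>))"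
    by (rule vn_entropy_eq)
  also have "\<dots> = entropy {..<e} (\<lambda>x y. \<Sum>i<a. \<Sum>j<b. mat_op3 b e \<sigma> (i, j, x) (i, j, y))"
  proof (rule entropy_cong)
    fix x y assume xy: "x \<in> {..<e}" "y \<in> {..<e}"
    have "mat_op (partial_trace 1 (a * b) e \<sigma>) x y = (\<Sum>c<a * b. \<sigma> $$ (c * e + x, c * e + y))"
      using partial_trace_entry[of 0 1 0 x e y "a * b" \<sigma>] xy by (simp add: mat_op_def)
    \<comment> \<open>The combined index of \<open>AB\<close>, traced out as one factor of dimension
      \<open>a * b\<close>, is split into a pair.\<close>
    also have "\<dots> = (\<Sum>z\<in>{..<a} \<times> {..<b}. \<sigma> $$ ((\<lambda>(i, j). i * b + j) z * e + x, (\<lambda>(i, j). i * b + j) z * e + y))"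
      by (rule sum.reindex_bij_betw[OF bij_index, symmetric])
    finally show "mat_op (partial_trace 1 (a * b) e \<sigma>) x y = (\<Sum>i<a. \<Sum>j<b. mat_op3 b e \<sigma> (i, j, x) (i, j, y))"
      by (simp add: sum_Times mat_op3_def)
  qed
  finally have 4: "vn_entropy (partial_trace 1 (a * b) e \<sigma>) = \<dots>" .
  show ?thesis unfolding cond_mutual_info_def cond_info_def 1 2 3 4 by simp
qed

lemma extension_op3_iff:
  assumes R: "\<rho> \<in> carrier_mat (a * b) (a * b)" and S: "\<sigma> \<in> carrier_mat (a * b * e) (a * b * e)"
  shows "extension {..<a} {..<b} {..<e} (mat_op2 b \<rho>) (mat_op3 b e \<sigma>) \<longleftrightarrow>
    density_operator (a * b * e) \<sigma> \<and> partial_trace (a * b) e 1 \<sigma> = \<rho>"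
proof -
  have pt: "partial_trace (a * b) e 1 \<sigma> $$ (i, j) = (\<Sum>k<e. \<sigma> $$ (i * e + k, j * e + k))"
    if "i < a * b" "j < a * b" for i j
    using partial_trace_entry[OF that, of 0 1 0 e \<sigma>] by simp
  have ab: "(\<lambda>(i, j). i * b + j) ` ({..<a} \<times> {..<b}) = {..<a * b}"
    using bij_index by (simp add: bij_betw_def)
  have "partial_trace (a * b) e 1 \<sigma> = \<rho> \<longleftrightarrow>
      (\<forall>i\<in>{..<a * b}. \<forall>j\<in>{..<a * b}. (\<Sum>k<e. \<sigma> $$ (i * e + k, j * e + k)) = \<rho> $$ (i, j))"
  proof
    assume "\<forall>i\<in>{..<a * b}. \<forall>j\<in>{..<a * b}. (\<Sum>k<e. \<sigma> $$ (i * e + k, j * e + k)) = \<rho> $$ (i, j)"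
    thus "partial_trace (a * b) e 1 \<sigma> = \<rho>"
      using R partial_trace_carrier[of "a * b" e 1 \<sigma>] pt by (intro eq_matI) auto
  qed (use pt in auto)
  also have "\<dots> \<longleftrightarrow> (\<forall>x\<in>{..<a} \<times> {..<b}. \<forall>y\<in>{..<a} \<times> {..<b}.
      (\<Sum>k<e. mat_op3 b e \<sigma> (fst x, snd x, k) (fst y, snd y, k)) = mat_op2 b \<rho> x y)"
    unfolding ab[symmetric] by (simp add: mat_op2_def mat_op3_def)
  finally show ?thesis
    unfolding extension_def density_operator_def psd_mat_op3[OF S] mat_tr_op3[OF S] by auto
qed

text \<open>The two sets of values coincide: a matrix extension gives the system
  \<open>{..<e}\<close>, and a finite set \<open>E\<close> is enumerated by
  \<open>{..<card E}\<close> before its operator is written as a matrix.\<close>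

lemma squashed_entanglement_eq_sqe:
  assumes R: "\<rho> \<in> carrier_mat (a * b) (a * b)"
  shows "squashed_entanglement a b \<rho> = sqe {..<a} {..<b} (mat_op2 b \<rho>)"
proof -
  have "{1 / 2 * cond_mutual_info a b e \<sigma> | e \<sigma>. density_operator (a * b * e) \<sigma> \<and> partial_trace (a * b) e 1 \<sigma> = \<rho>}
    = {1 / 2 * cond_info {..<a} {..<b} E W | (E :: nat set) W. extension {..<a} {..<b} E (mat_op2 b \<rho>) W}"
    (is "?L = ?R")
  proof (intro equalityI subsetI)
    fix x assume "x \<in> ?L"
    then obtain e \<sigma> where D: "density_operator (a * b * e) \<sigma>" and pt: "partial_trace (a * b) e 1 \<sigma> = \<rho>"
      and x: "x = 1 / 2 * cond_mutual_info a b e \<sigma>" by blast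
    have "extension {..<a} {..<b} {..<e} (mat_op2 b \<rho>) (mat_op3 b e \<sigma>)"
      using extension_op3_iff[OF R density_carrier[OF D]] D pt by simp
    thus "x \<in> ?R" unfolding x cond_mutual_info_eq_cond_info[OF D] by blast
  next
    fix x assume "x \<in> ?R"
    then obtain E :: "nat set" and W where X: "extension {..<a} {..<b} E (mat_op2 b \<rho>) W"
      and x: "x = 1 / 2 * cond_info {..<a} {..<b} E W" by blast
    define e where "e = card E"
    obtain h where h: "bij_betw h {..<e} E"
      using ex_bij_betw_nat_finite[OF extensionD(3)[OF X]] by (auto simp: atLeast0LessThan e_def)
    have i: "bij_betw (\<lambda>x. x) S S" for S :: "nat set" by (simp add: bij_betw_def)
    define V where "V = (\<lambda>x y. W (map_prod (\<lambda>x. x) (map_prod (\<lambda>x. x) h) x) (map_prod (\<lambda>x. x) (map_prod (\<lambda>x. x) h) y))"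
    have XV: "extension {..<a} {..<b} {..<e} (mat_op2 b \<rho>) V"
      using extension_bij[OF i i h X] by (simp add: V_def prod.map_ident)
    have cV: "cond_info {..<a} {..<b} {..<e} V = cond_info {..<a} {..<b} E W"
      unfolding V_def by (rule cond_info_bij[OF i i h])
    \<comment> \<open>Division and remainder decode the index \<open>(i * b + j) * e + k\<close>
      back into a triple.\<close>
    define \<sigma> where "\<sigma> = mat (a * b * e) (a * b * e) (\<lambda>(i, j).
      V (i div e div b, i div e mod b, i mod e) (j div e div b, j div e mod b, j mod e))"
    have S: "\<sigma> \<in> carrier_mat (a * b * e) (a * b * e)" by (simp add: \<sigma>_def)
    have eq: "mat_op3 b e \<sigma> x y = V x y" if "x \<in> {..<a} \<times> {..<b} \<times> {..<e}" "y \<in> {..<a} \<times> {..<b} \<times> {..<e}" for x y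
      using that by (auto simp: mat_op3_def \<sigma>_def index_less)
    have "extension {..<a} {..<b} {..<e} (mat_op2 b \<rho>) (mat_op3 b e \<sigma>) \<longleftrightarrow> extension {..<a} {..<b} {..<e} (mat_op2 b \<rho>) V"
    proof -
      have "trace_on ({..<a} \<times> {..<b} \<times> {..<e}) (mat_op3 b e \<sigma>) = trace_on ({..<a} \<times> {..<b} \<times> {..<e}) V"
        unfolding trace_on_def by (intro sum.cong refl eq)
      thus ?thesis unfolding extension_def
        using psd_cong[of "{..<a} \<times> {..<b} \<times> {..<e}" "mat_op3 b e \<sigma>" V, OF eq] by (simp add: eq)
    qed
    hence D: "density_operator (a * b * e) \<sigma>" and pt: "partial_trace (a * b) e 1 \<sigma> = \<rho>"
      using XV extension_op3_iff[OF R S] by auto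
    have "x = 1 / 2 * cond_mutual_info a b e \<sigma>"
      unfolding x cond_mutual_info_eq_cond_info[OF D] cV[symmetric] by (simp add: cond_info_cong[OF eq])
    thus "x \<in> ?L" using D pt by blast
  qed
  thus ?thesis unfolding squashed_entanglement_def sqe_def by simp
qed

text \<open>In the factor order \<open>A A' B B'\<close> neither pair of traced systems is
  contiguous, so each marginal takes two partial traces. The tensor product of the marginals has the
  order \<open>A B A' B'\<close>, which \<open>swap_middle\<close> corrects.\<close>

theorem proposition4:
  fixes a a' b b' :: nat and \<rho> \<rho>AB \<rho>A'B' :: "complex mat"
  assumes "density_operator ((a * a') * (b * b')) \<rho>"
    and "\<rho>AB = partial_trace a a' b (partial_trace (a * a' * b) b' 1 \<rho>)"
    and "\<rho>A'B' = partial_trace a' b b' (partial_trace 1 a (a' * b * b') \<rho>)"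
  shows "squashed_entanglement (a * a') (b * b') \<rho>
           \<ge> squashed_entanglement a b \<rho>AB + squashed_entanglement a' b' \<rho>A'B' \<and>
         (\<rho> = swap_middle a b a' b' (tensor_mat \<rho>AB \<rho>A'B') \<longrightarrow>
           squashed_entanglement (a * a') (b * b') \<rho>
             = squashed_entanglement a b \<rho>AB + squashed_entanglement a' b' \<rho>A'B')"
proof -
  define A where "A = {..<a}"
  define A' where "A' = {..<a'}"
  define B where "B = {..<b}"
  define B' where "B' = {..<b'}"
  have fin: "finite A" "finite A'" "finite B" "finite B'" by (simp_all add: A_def A'_def B_def B'_def)
  define f where "f = (\<lambda>(i, j). i * a' + j)"
  define g where "g = (\<lambda>(i, j). i * b' + j)"
  have f: "bij_betw f (A \<times> A') {..<a * a'}" and g: "bij_betw g (B \<times> B') {..<b * b'}"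
    unfolding f_def g_def A_def A'_def B_def B'_def by (rule bij_index)+
  \<comment> \<open>The same state with structured indices in
    \<open>(A \<times> A') \<times> (B \<times> B')\<close>, the form that the results on index sets
    expect.\<close>
  define R where "R = (\<lambda>x y. mat_op2 (b * b') \<rho> (map_prod f g x) (map_prod f g y))"
  have R_entry: "R ((x, x'), (y, y')) ((u, u'), (v, v'))
      = \<rho> $$ ((x * a' + x') * (b * b') + (y * b' + y'), (u * a' + u') * (b * b') + (v * b' + v'))"
    for x x' y y' u u' v v' by (simp add: R_def mat_op2_def f_def g_def)
  note c = density_carrier[OF assms(1)]
  have R0: "psd ({..<a * a'} \<times> {..<b * b'}) (mat_op2 (b * b') \<rho>)" "trace_on ({..<a * a'} \<times> {..<b * b'}) (mat_op2 (b * b') \<rho>) = 1"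
    using assms(1) psd_mat_op2[OF c] mat_tr_op2[OF c] by (simp_all add: density_operator_def)
  have R: "psd ((A \<times> A') \<times> (B \<times> B')) R" "trace_on ((A \<times> A') \<times> (B \<times> B')) R = 1"
    unfolding R_def using psd_reindex[OF bij_betw_map_prod[OF f g] R0(1)] trace_on_reindex[OF bij_betw_map_prod[OF f g], of "mat_op2 (b * b') \<rho>"] R0(2)
    by simp_all
  have sqR: "squashed_entanglement (a * a') (b * b') \<rho> = sqe (A \<times> A') (B \<times> B') R"
    unfolding squashed_entanglement_eq_sqe[OF c] R_def by (rule sqe_bij[OF f g _ _ R0, symmetric]) simp_all

  have D1: "density_operator (a * a' * b * b' * 1) \<rho>" "density_operator (1 * a * (a' * b * b')) \<rho>"
    using assms(1) by (simp_all add: mult.assoc)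
  have DAB: "density_operator (a * b) \<rho>AB"
    unfolding assms(2) using partial_trace_density[OF D1(1)] by (intro partial_trace_density) simp
  have DAB': "density_operator (a' * b') \<rho>A'B'"
    unfolding assms(3) using partial_trace_density[OF D1(2)] by (intro partial_trace_density) simp
  have AB: "mat_op2 b \<rho>AB x y = marg1 A' B' R x y" if "x \<in> A \<times> B" "y \<in> A \<times> B" for x y
  proof -
    obtain i j k l where xy: "x = (i, j)" "y = (k, l)" by fastforce
    have ij: "i < a" "j < b" "k < a" "l < b" using that by (simp_all add: xy A_def B_def)
    have "mat_op2 b \<rho>AB x y = (\<Sum>c<a'. partial_trace (a * a' * b) b' 1 \<rho> $$ ((i * a' + c) * b + j, (k * a' + c) * b + l))"
      unfolding mat_op2_def xy assms(2) using ij by (simp add: partial_trace_entry)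
    also have "\<dots> = (\<Sum>c<a'. \<Sum>d<b'. \<rho> $$ (((i * a' + c) * b + j) * b' + d, ((k * a' + c) * b + l) * b' + d))"
    proof (rule sum.cong[OF refl])
      fix c assume "c \<in> {..<a'}"
      hence "(i * a' + c) * b + j < a * a' * b" "(k * a' + c) * b + l < a * a' * b"
        using ij by (simp_all add: index_less)
      from partial_trace_entry[OF this, of 0 1 0 b' \<rho>]
      show "partial_trace (a * a' * b) b' 1 \<rho> $$ ((i * a' + c) * b + j, (k * a' + c) * b + l)
        = (\<Sum>d<b'. \<rho> $$ (((i * a' + c) * b + j) * b' + d, ((k * a' + c) * b + l) * b' + d))" by simp
    qed
    also have "\<dots> = marg1 A' B' R x y"
      unfolding marg1_def sum_Times A'_def B'_def xy by (simp add: R_entry algebra_simps)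
    finally show ?thesis .
  qed
  have AB': "mat_op2 b' \<rho>A'B' x y = marg2 A B R x y" if "x \<in> A' \<times> B'" "y \<in> A' \<times> B'" for x y
  proof -
    obtain i j k l where xy: "x = (i, j)" "y = (k, l)" by fastforce
    have ij: "i < a'" "j < b'" "k < a'" "l < b'" using that by (simp_all add: xy A'_def B'_def)
    have "mat_op2 b' \<rho>A'B' x y = (\<Sum>d<b. partial_trace 1 a (a' * b * b') \<rho> $$ ((i * b + d) * b' + j, (k * b + d) * b' + l))"
      unfolding mat_op2_def xy assms(3) using ij by (simp add: partial_trace_entry)
    also have "\<dots> = (\<Sum>d<b. \<Sum>c<a. \<rho> $$ (c * (a' * b * b') + ((i * b + d) * b' + j), c * (a' * b * b') + ((k * b + d) * b' + l)))"
    proof (rule sum.cong[OF refl])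
      fix d assume "d \<in> {..<b}"
      hence "(i * b + d) * b' + j < a' * b * b'" "(k * b + d) * b' + l < a' * b * b'"
        using ij by (simp_all add: index_less)
      from partial_trace_entry[of 0 1 0, OF _ _ this, of a \<rho>]
      show "partial_trace 1 a (a' * b * b') \<rho> $$ ((i * b + d) * b' + j, (k * b + d) * b' + l)
        = (\<Sum>c<a. \<rho> $$ (c * (a' * b * b') + ((i * b + d) * b' + j), c * (a' * b * b') + ((k * b + d) * b' + l)))" by simp
    qed
    \<comment> \<open>The outer partial trace is the one over \<open>B\<close>, whereas
      \<open>marg2\<close> sums over \<open>A\<close> first.\<close>
    also have "\<dots> = (\<Sum>c<a. \<Sum>d<b. \<rho> $$ (c * (a' * b * b') + ((i * b + d) * b' + j), c * (a' * b * b') + ((k * b + d) * b' + l)))"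
      by (rule sum.swap)
    also have "\<dots> = marg2 A B R x y"
      unfolding marg2_def sum_Times A_def B_def xy by (simp add: R_entry algebra_simps)
    finally show ?thesis .
  qed
  note cAB = density_carrier[OF DAB] and cAB' = density_carrier[OF DAB']
  have sqAB: "squashed_entanglement a b \<rho>AB = sqe A B (mat_op2 b \<rho>AB)"
    unfolding A_def B_def by (rule squashed_entanglement_eq_sqe[OF cAB])
  have sqAB': "squashed_entanglement a' b' \<rho>A'B' = sqe A' B' (mat_op2 b' \<rho>A'B')"
    unfolding A'_def B'_def by (rule squashed_entanglement_eq_sqe[OF cAB'])
  have super: "squashed_entanglement a b \<rho>AB + squashed_entanglement a' b' \<rho>A'B'
      \<le> squashed_entanglement (a * a') (b * b') \<rho>"
    using sqe_superadditive[OF fin R] sqe_cong[of A B "mat_op2 b \<rho>AB", OF AB] sqe_cong[of A' B' "mat_op2 b' \<rho>A'B'", OF AB']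
    unfolding sqR sqAB sqAB' by simp
  moreover have "squashed_entanglement (a * a') (b * b') \<rho>
      \<le> squashed_entanglement a b \<rho>AB + squashed_entanglement a' b' \<rho>A'B'"
    if prod: "\<rho> = swap_middle a b a' b' (tensor_mat \<rho>AB \<rho>A'B')"
  proof -
    have "R x y = tensor (mat_op2 b \<rho>AB) (mat_op2 b' \<rho>A'B') x y"
      if xy: "x \<in> (A \<times> A') \<times> (B \<times> B')" "y \<in> (A \<times> A') \<times> (B \<times> B')" for x y
    proof -
      have entry: "swap_middle a b a' b' (tensor_mat \<rho>AB \<rho>A'B') $$
          ((i * a' + i') * (b * b') + (j * b' + j'), (k * a' + k') * (b * b') + (l * b' + l'))
        = \<rho>AB $$ (i * b + j, k * b + l) * \<rho>A'B' $$ (i' * b' + j', k' * b' + l')"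
        if "i < a" "i' < a'" "j < b" "j' < b'" "k < a" "k' < a'" "l < b" "l' < b'" for i i' j j' k k' l l'
      proof -
        have s: "swap_middle_index b a' b' ((i * a' + i') * (b * b') + (j * b' + j')) = (i * b + j) * (a' * b') + (i' * b' + j')"
          if "i < a" "i' < a'" "j < b" "j' < b'" for i i' j j'
        proof -
          \<comment> \<open>Fully nested form of the index, from which division and remainder in
            \<open>swap_middle_index\<close> peel off one factor at a time.\<close>
          have e: "(i * a' + i') * (b * b') + (j * b' + j') = ((i * a' + i') * b + j) * b' + j'" by (simp add: algebra_simps)
          show ?thesis unfolding e swap_middle_index_def using that by (simp add: Let_def) (simp add: algebra_simps)
        qed
        have m: "(i * a' + i') * (b * b') + (j * b' + j') < a * a' * b * b'"
          if "i < a" "i' < a'" "j < b" "j' < b'" for i i' j j'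
          using index_less[OF index_less[OF that(1,2)] index_less[OF that(3,4)]] by (simp add: mult.assoc)
        have n: "(i * b + j) * (a' * b') + (i' * b' + j') < a * b * (a' * b')" "i' * b' + j' < a' * b'"
          if "i < a" "i' < a'" "j < b" "j' < b'" for i i' j j'
          using index_less[OF index_less[OF that(1,3)] index_less[OF that(2,4)]] index_less[OF that(2,4)] by simp_all
        have dims: "dim_row \<rho>AB = a * b" "dim_col \<rho>AB = a * b" "dim_row \<rho>A'B' = a' * b'" "dim_col \<rho>A'B' = a' * b'"
          using cAB cAB' by auto
        show ?thesis
          unfolding swap_middle_def tensor_mat_def dims
          using that by (simp add: m n s)
      qed
      obtain i i' j j' k k' l l' where e: "x = ((i, i'), (j, j'))" "y = ((k, k'), (l, l'))"
        by (metis surj_pair)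
      show ?thesis
        using xy entry[of i i' j j' k k' l l'] prod
        by (simp add: e R_entry tensor_def mat_op2_def A_def A'_def B_def B'_def)
    qed
    hence "sqe (A \<times> A') (B \<times> B') R = sqe (A \<times> A') (B \<times> B') (tensor (mat_op2 b \<rho>AB) (mat_op2 b' \<rho>A'B'))"
      by (rule sqe_cong)
    also have "\<dots> \<le> sqe A B (mat_op2 b \<rho>AB) + sqe A' B' (mat_op2 b' \<rho>A'B')"
      using DAB DAB' psd_mat_op2[OF cAB] mat_tr_op2[OF cAB] psd_mat_op2[OF cAB'] mat_tr_op2[OF cAB']
      by (intro sqe_tensor_le fin) (simp_all add: density_operator_def A_def A'_def B_def B'_def)
    finally show ?thesis unfolding sqR sqAB sqAB' .
  qed
  ultimately show ?thesis by (auto intro: antisym)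
qed

end
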